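(* In the realizability model $\mathcal{N}$: for every individual $a$ there exists an ordinal $\kappa$ such that there is no surjection from $a$ onto $\kappa$, i.e. no function $f$ with domain $a$ such that for every $\rho\in\kappa$ there is $x\,\varepsilon\,a$ with $f(x)\simeq\rho$.
   Context: Classical realizability (Krivine): ground model $\mathcal{M}$ of ZF + V = L with a realizability algebra; the realizability model $\mathcal{N}$ has the same individuals as $\mathcal{M}$, and formulas of ZF$_\varepsilon$ (atomic $a\not\varepsilon b$, $a\notin b$, $a\subset b$, $\bot$; $\to,\forall$) have truth values in $\mathcal{P}(\Pi)$; a formula holds in $\mathcal{N}$ if realized by a proof-like term. $x\,\varepsilon\,y$ is $\neg(x\not\varepsilon y)$ (strong membership), $x\in y$ is $\neg(x\notin y)$, $x\simeq y$ is $x\subset y\wedge y\subset x$; ordinals are ordinals in the ZF-model $\mathcal{N}_\in$ (membership $\in$, equality $\simeq$), taken up to $\simeq$. A function with domain $D$ is an individual $\phi$ with $(\forall z\,\varepsilon\,\phi)(\exists x\,\varepsilon\,D)\exists y(z=(x,y))$, $(\forall x\,\varepsilon\,D)\exists y((x,y)\,\varepsilon\,\phi)$, and $\forall x\forall y\forall y'((x,y)\,\varepsilon\,\phi,(x,y')\,\varepsilon\,\phi\to y=y')$ (pairs formed with Krivine's pairing symbol, $=$ being Leibniz equality of $\mathcal{N}$); $f(x)\simeq\rho$ means $\exists y((x,y)\,\varepsilon\,f\wedge y\simeq\rho)$. *)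

theory Defs
  imports Main
begin

section \<open>The ground model: ZF + V = L, as a first-order theory\<close>

text \<open>
  First-order formulas of set theory with named variables. They are only needed for the
  separation and replacement schemes.
\<close>

datatype set_formula =
    Mem nat nat
  | Equ nat nat
  | Negation set_formula
  | Conjunction set_formula set_formula
  | Exist nat set_formula

primrec sat :: "('m \<Rightarrow> 'm \<Rightarrow> bool) \<Rightarrow> (nat \<Rightarrow> 'm) \<Rightarrow> set_formula \<Rightarrow> bool" where
  "sat E e (Mem i j) = E (e i) (e j)"
| "sat E e (Equ i j) = (e i = e j)"
| "sat E e (Negation F) = (\<not> sat E e F)"
| "sat E e (Conjunction F G) = (sat E e F \<and> sat E e G)"
| "sat E e (Exist i F) = (\<exists>x. sat E (e(i := x)) F)"

text \<open>
  A structure for the language of set theory: its individuals are the elements of the type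
  \<open>'m\<close>, and no well-foundedness in the sense of the metatheory is assumed. All set-theoretic
  notions below are the internal ones: their quantifiers range over individuals. HOL sets of
  individuals play the role of classes, and \<open>mk S\<close> is the individual whose elements form
  the class \<open>S\<close>; it is only meaningful if there is one.
\<close>

locale set_structure =
  fixes mem :: "'m \<Rightarrow> 'm \<Rightarrow> bool"  (infix "\<in>\<^sub>M" 50)
begin

definition elts :: "'m \<Rightarrow> 'm set" where
  "elts x = {y. y \<in>\<^sub>M x}"

definition mk :: "'m set \<Rightarrow> 'm" where
  "mk S = (THE x. elts x = S)"

definition opair :: "'m \<Rightarrow> 'm \<Rightarrow> 'm" where
  "opair x y = mk {mk {x}, mk {x, y}}"

definition cartesian :: "'m \<Rightarrow> 'm \<Rightarrow> 'm" where
  "cartesian A B = mk {opair x y | x y. x \<in>\<^sub>M A \<and> y \<in>\<^sub>M B}"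

definition maps :: "'m \<Rightarrow> 'm \<Rightarrow> 'm \<Rightarrow> bool" where
  "maps f A B \<longleftrightarrow> elts f \<subseteq> {opair x y | x y. x \<in>\<^sub>M A \<and> y \<in>\<^sub>M B} \<and>
     (\<forall>x\<in>elts A. \<exists>!y. opair x y \<in>\<^sub>M f)"

definition ap :: "'m \<Rightarrow> 'm \<Rightarrow> 'm" where
  "ap f x = (THE y. opair x y \<in>\<^sub>M f)"

definition transitive :: "'m \<Rightarrow> bool" where
  "transitive x \<longleftrightarrow> (\<forall>y\<in>elts x. elts y \<subseteq> elts x)"

definition ordinal :: "'m \<Rightarrow> bool" where
  "ordinal x \<longleftrightarrow> transitive x \<and> (\<forall>y\<in>elts x. transitive y)"

definition is_inductive :: "'m \<Rightarrow> bool" where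
  "is_inductive w \<longleftrightarrow> (\<exists>z\<in>elts w. elts z = {}) \<and>
     (\<forall>n\<in>elts w. \<exists>s\<in>elts w. elts s = insert n (elts n))"

definition zero :: 'm where
  "zero = mk {}"

definition omega :: 'm where
  "omega = mk {n. \<forall>w. is_inductive w \<longrightarrow> n \<in>\<^sub>M w}"

text \<open>
  Definability over \<open>(A, \<in>)\<close>, expressed inside the structure. Assignments are internal
  functions from \<open>\<omega>\<close> to \<open>A\<close>. Following Tarski's truth definition, the sets of assignments
  satisfying some internal formula form the least internal family containing the
  interpretations of \<open>v\<^sub>i \<in> v\<^sub>j\<close> and \<open>v\<^sub>i = v\<^sub>j\<close> and closed under complement,
  intersection and the quantifiers \<open>\<exists>v\<^sub>i\<close>.
\<close>

definition assignments :: "'m \<Rightarrow> 'm set" where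
  "assignments A = {s. maps s omega A}"

definition variant :: "'m \<Rightarrow> 'm \<Rightarrow> 'm \<Rightarrow> bool" where
  "variant i s t \<longleftrightarrow> (\<forall>j\<in>elts omega. j \<noteq> i \<longrightarrow> ap s j = ap t j)"

definition definability_family :: "'m \<Rightarrow> 'm \<Rightarrow> bool" where
  "definability_family A D \<longleftrightarrow>
     (\<forall>R\<in>elts D. elts R \<subseteq> assignments A) \<and>
     (\<forall>i\<in>elts omega. \<forall>j\<in>elts omega.
        mk {s \<in> assignments A. ap s i \<in>\<^sub>M ap s j} \<in>\<^sub>M D \<and>
        mk {s \<in> assignments A. ap s i = ap s j} \<in>\<^sub>M D) \<and>
     (\<forall>R\<in>elts D. mk (assignments A - elts R) \<in>\<^sub>M D) \<and>
     (\<forall>R\<in>elts D. \<forall>S\<in>elts D. mk (elts R \<inter> elts S) \<in>\<^sub>M D) \<and>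
     (\<forall>R\<in>elts D. \<forall>i\<in>elts omega.
        mk {s \<in> assignments A. \<exists>t\<in>elts R. variant i s t} \<in>\<^sub>M D)"

text \<open>
  \<open>definable_subset A X\<close> means \<open>X \<in> Def(A)\<close>: \<open>X\<close> is the set of \<open>x \<in> A\<close> such that
  \<open>(A, \<in>)\<close> satisfies some formula at \<open>s(0 := x)\<close>, where \<open>s\<close> provides the parameters. The
  empty set is listed separately because there is no assignment when \<open>A\<close> is empty.
\<close>

definition definable_subset :: "'m \<Rightarrow> 'm \<Rightarrow> bool" where
  "definable_subset A X \<longleftrightarrow> elts X = {} \<or>
     (\<exists>R. \<exists>s\<in>assignments A.
        (\<forall>D. definability_family A D \<longrightarrow> R \<in>\<^sub>M D) \<and>
        elts X = {x \<in> elts A. \<exists>t\<in>elts R. variant zero s t \<and> ap t zero = x})"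

text \<open>
  \<open>f\<close> is the sequence of the \<open>L\<^sub>\<beta>\<close> for \<open>\<beta> \<le> \<alpha>\<close>, where \<open>L\<^sub>\<beta>\<close> is the union of the
  \<open>Def(L\<^sub>\<gamma>)\<close> for \<open>\<gamma> < \<beta>\<close>.
\<close>

definition constructible_hierarchy :: "'m \<Rightarrow> 'm \<Rightarrow> bool" where
  "constructible_hierarchy \<alpha> f \<longleftrightarrow>
     (\<forall>\<beta>\<in>insert \<alpha> (elts \<alpha>). (\<exists>!y. opair \<beta> y \<in>\<^sub>M f) \<and>
        elts (ap f \<beta>) = {X. \<exists>\<gamma>\<in>elts \<beta>. definable_subset (ap f \<gamma>) X})"

definition constructible :: "'m \<Rightarrow> bool" where
  "constructible x \<longleftrightarrow>
     (\<exists>\<alpha> f. ordinal \<alpha> \<and> constructible_hierarchy \<alpha> f \<and> x \<in>\<^sub>M ap f \<alpha>)"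

end

locale ground_model = set_structure +
  assumes extensionality: "elts x = elts y \<Longrightarrow> x = y"
    and foundation: "elts x \<noteq> {} \<Longrightarrow> \<exists>y\<in>elts x. elts y \<inter> elts x = {}"
    and pairing: "\<exists>z. elts z = {x, y}"
    and union: "\<exists>z. elts z = (\<Union>y\<in>elts x. elts y)"
    and power_set: "\<exists>z. elts z = {y. elts y \<subseteq> elts x}"
    and infinity: "\<exists>w. is_inductive w"
    and separation: "\<exists>z. elts z = {x \<in> elts a. sat (\<in>\<^sub>M) (e(0 := x)) F}"
    and replacement:
      "(\<And>x y y'. x \<in>\<^sub>M a \<Longrightarrow> sat (\<in>\<^sub>M) (e(0 := x, 1 := y)) F \<Longrightarrow>
          sat (\<in>\<^sub>M) (e(0 := x, 1 := y')) F \<Longrightarrow> y = y') \<Longrightarrow>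
       \<exists>z. elts z = {y. \<exists>x\<in>elts a. sat (\<in>\<^sub>M) (e(0 := x, 1 := y)) F}"
    and V_eq_L: "constructible x"


section \<open>Formulas of ZF\<open>\<^sub>\<epsilon>\<close>\<close>

text \<open>
  Closed formulas with parameters in the ground model; \<open>NotEps\<close> is strong non-membership,
  \<open>NotIn\<close> extensional non-membership. The quantifier is represented by the family of its
  instances, so a function symbol is applied to individuals by applying the functional
  that interprets it.
\<close>

datatype 'm zfe =
    Bot
  | NotEps 'm 'm
  | NotIn 'm 'm
  | Subset 'm 'm
  | Imp "'m zfe" "'m zfe"  (infixr "\<^bold>\<longrightarrow>" 25)
  | Forall "'m \<Rightarrow> 'm zfe"  (binder "\<^bold>\<forall>" 10)

definition Neg :: "'m zfe \<Rightarrow> 'm zfe"  ("\<^bold>\<not> _" [40] 40) where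
  "(\<^bold>\<not> F) = (F \<^bold>\<longrightarrow> Bot)"

definition And :: "'m zfe \<Rightarrow> 'm zfe \<Rightarrow> 'm zfe"  (infixr "\<^bold>\<and>" 35) where
  "(F \<^bold>\<and> G) = ((F \<^bold>\<longrightarrow> G \<^bold>\<longrightarrow> Bot) \<^bold>\<longrightarrow> Bot)"

definition Exists :: "('m \<Rightarrow> 'm zfe) \<Rightarrow> 'm zfe"  (binder "\<^bold>\<exists>" 10) where
  "(\<^bold>\<exists>x. F x) = (\<^bold>\<not> (\<^bold>\<forall>x. \<^bold>\<not> F x))"

definition Eps :: "'m \<Rightarrow> 'm \<Rightarrow> 'm zfe"  (infix "\<^bold>\<epsilon>" 50) where
  "(x \<^bold>\<epsilon> y) = (\<^bold>\<not> NotEps x y)"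

definition In :: "'m \<Rightarrow> 'm \<Rightarrow> 'm zfe"  (infix "\<^bold>\<in>" 50) where
  "(x \<^bold>\<in> y) = (\<^bold>\<not> NotIn x y)"

definition ExtEq :: "'m \<Rightarrow> 'm \<Rightarrow> 'm zfe"  (infix "\<^bold>\<simeq>" 50) where
  "(x \<^bold>\<simeq> y) = (Subset x y \<^bold>\<and> Subset y x)"

text \<open>Leibniz equality.\<close>

definition Eq :: "'m \<Rightarrow> 'm \<Rightarrow> 'm zfe"  (infix "\<^bold>=" 50) where
  "(x \<^bold>= y) = (\<^bold>\<forall>z. NotEps y z \<^bold>\<longrightarrow> NotEps x z)"

definition all_eps :: "'m \<Rightarrow> ('m \<Rightarrow> 'm zfe) \<Rightarrow> 'm zfe" where
  "all_eps a F = (\<^bold>\<forall>x. \<^bold>\<not> F x \<^bold>\<longrightarrow> NotEps x a)"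

definition ex_eps :: "'m \<Rightarrow> ('m \<Rightarrow> 'm zfe) \<Rightarrow> 'm zfe" where
  "ex_eps a F = (\<^bold>\<not> (\<^bold>\<forall>x. F x \<^bold>\<longrightarrow> NotEps x a))"

definition all_in :: "'m \<Rightarrow> ('m \<Rightarrow> 'm zfe) \<Rightarrow> 'm zfe" where
  "all_in a F = (\<^bold>\<forall>x. \<^bold>\<not> F x \<^bold>\<longrightarrow> NotIn x a)"

text \<open>Ordinals in the sense of \<open>\<in>\<close>: transitive sets of transitive sets.\<close>

definition Trans :: "'m \<Rightarrow> 'm zfe" where
  "Trans x = all_in x (\<lambda>y. all_in y (\<lambda>z. z \<^bold>\<in> x))"

definition Ord :: "'m \<Rightarrow> 'm zfe" where
  "Ord x = (Trans x \<^bold>\<and> all_in x Trans)"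

text \<open>Here \<open>op\<close> is the functional interpreting the pairing symbol.\<close>

definition function_on :: "('m \<Rightarrow> 'm \<Rightarrow> 'm) \<Rightarrow> 'm \<Rightarrow> 'm \<Rightarrow> 'm zfe" where
  "function_on op f D =
     (all_eps f (\<lambda>z. ex_eps D (\<lambda>x. \<^bold>\<exists>y. z \<^bold>= op x y)) \<^bold>\<and>
      all_eps D (\<lambda>x. \<^bold>\<exists>y. op x y \<^bold>\<epsilon> f) \<^bold>\<and>
      (\<^bold>\<forall>x. \<^bold>\<forall>y. \<^bold>\<forall>y'. op x y \<^bold>\<epsilon> f \<^bold>\<longrightarrow> op x y' \<^bold>\<epsilon> f \<^bold>\<longrightarrow> y \<^bold>= y'))"

definition value_sim :: "('m \<Rightarrow> 'm \<Rightarrow> 'm) \<Rightarrow> 'm \<Rightarrow> 'm \<Rightarrow> 'm \<Rightarrow> 'm zfe" where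
  "value_sim op f x r = (\<^bold>\<exists>y. op x y \<^bold>\<epsilon> f \<^bold>\<and> y \<^bold>\<simeq> r)"


section \<open>Realizability algebras and the realizability model\<close>

text \<open>All components are individuals; the operations are internal functions.\<close>

record 'm algebra =
  terms :: 'm
  stacks :: 'm
  processes :: 'm
  app_fun :: 'm
  push_fun :: 'm
  star_fun :: 'm
  cont_fun :: 'm
  cB :: 'm
  cC :: 'm
  cI :: 'm
  cK :: 'm
  cW :: 'm
  cc :: 'm
  pole :: 'm
  prooflike :: 'm

locale algebra_structure = set_structure +
  fixes A :: "'a algebra"
begin

definition app :: "'a \<Rightarrow> 'a \<Rightarrow> 'a"  (infixl "\<cdot>" 75) where
  "\<xi> \<cdot> \<eta> = ap (app_fun A) (opair \<xi> \<eta>)"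

definition push :: "'a \<Rightarrow> 'a \<Rightarrow> 'a"  (infixr "\<triangleright>" 70) where
  "\<xi> \<triangleright> \<pi> = ap (push_fun A) (opair \<xi> \<pi>)"

definition star :: "'a \<Rightarrow> 'a \<Rightarrow> 'a"  (infix "\<star>" 65) where
  "\<xi> \<star> \<pi> = ap (star_fun A) (opair \<xi> \<pi>)"

definition cont :: "'a \<Rightarrow> 'a" where
  "cont \<pi> = ap (cont_fun A) \<pi>"

definition realizes_set :: "'a \<Rightarrow> 'a set \<Rightarrow> bool" where
  "realizes_set \<xi> X \<longleftrightarrow> \<xi> \<in>\<^sub>M terms A \<and> (\<forall>\<pi>\<in>X. \<xi> \<star> \<pi> \<in>\<^sub>M pole A)"

text \<open>
  The truth values of \<open>a \<subset> b\<close> and \<open>a \<notin> b\<close> are defined by simultaneous transfinite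
  recursion inside the ground model. As usual, the recursively defined functional is the
  union of its set-sized fragments: \<open>fragment T S N\<close> says that the individuals \<open>S\<close> and
  \<open>N\<close> code the two truth values for all \<open>a, b\<close> in the transitive individual \<open>T\<close>.
\<close>

definition section_at :: "'a \<Rightarrow> 'a \<Rightarrow> 'a \<Rightarrow> 'a set" where
  "section_at F a b = {\<pi>. opair (opair a b) \<pi> \<in>\<^sub>M F}"

definition fragment :: "'a \<Rightarrow> 'a \<Rightarrow> 'a \<Rightarrow> bool" where
  "fragment T S N \<longleftrightarrow> transitive T \<and>
     (\<forall>a\<in>elts T. \<forall>b\<in>elts T.
        section_at S a b =
          {\<xi> \<triangleright> \<pi> | c \<xi> \<pi>. opair c \<pi> \<in>\<^sub>M a \<and> \<pi> \<in>\<^sub>M stacks A \<and>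
             realizes_set \<xi> (section_at N c b)} \<and>
        section_at N a b =
          {\<xi> \<triangleright> \<xi>' \<triangleright> \<pi> | c \<xi> \<xi>' \<pi>. opair c \<pi> \<in>\<^sub>M b \<and> \<pi> \<in>\<^sub>M stacks A \<and>
             realizes_set \<xi> (section_at S a c) \<and> realizes_set \<xi>' (section_at S c a)})"

primrec truth :: "'a zfe \<Rightarrow> 'a set" where
  "truth Bot = elts (stacks A)"
| "truth (NotEps a b) = {\<pi>. \<pi> \<in>\<^sub>M stacks A \<and> opair a \<pi> \<in>\<^sub>M b}"
| "truth (NotIn a b) =
     {\<pi>. \<exists>T S N. fragment T S N \<and> a \<in>\<^sub>M T \<and> b \<in>\<^sub>M T \<and> \<pi> \<in> section_at N a b}"
| "truth (Subset a b) =
     {\<pi>. \<exists>T S N. fragment T S N \<and> a \<in>\<^sub>M T \<and> b \<in>\<^sub>M T \<and> \<pi> \<in> section_at S a b}"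
| "truth (Imp F G) = {\<xi> \<triangleright> \<pi> | \<xi> \<pi>. realizes_set \<xi> (truth F) \<and> \<pi> \<in> truth G}"
| "truth (Forall F) = (\<Union>a. truth (F a))"

definition realizes :: "'a \<Rightarrow> 'a zfe \<Rightarrow> bool" where
  "realizes \<xi> F \<longleftrightarrow> realizes_set \<xi> (truth F)"

definition holds :: "'a zfe \<Rightarrow> bool" where
  "holds F \<longleftrightarrow> (\<exists>\<theta>. \<theta> \<in>\<^sub>M prooflike A \<and> realizes \<theta> F)"

text \<open>
  Krivine's pairing: \<open>pair a b = {a, b} \<times> \<Pi>\<close> is the unordered pair in the sense of the
  strong membership of the realizability model, and \<open>op a b\<close> is the ordered pair built
  from it.
\<close>

definition pair :: "'a \<Rightarrow> 'a \<Rightarrow> 'a" where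
  "pair a b = cartesian (mk {a, b}) (stacks A)"

definition op :: "'a \<Rightarrow> 'a \<Rightarrow> 'a" where
  "op a b = pair (pair a a) (pair a b)"

end

text \<open>
  The axioms on the pole say that it is closed under anti-reduction of processes.
\<close>

locale realizability_algebra = ground_model mem + algebra_structure mem A
  for mem :: "'m \<Rightarrow> 'm \<Rightarrow> bool"  (infix "\<in>\<^sub>M" 50) and A :: "'m algebra" +
  assumes app_maps: "maps (app_fun A) (cartesian (terms A) (terms A)) (terms A)"
    and push_maps: "maps (push_fun A) (cartesian (terms A) (stacks A)) (stacks A)"
    and star_maps: "maps (star_fun A) (cartesian (terms A) (stacks A)) (processes A)"
    and cont_maps: "maps (cont_fun A) (stacks A) (terms A)"
    and pole_subset: "elts (pole A) \<subseteq> elts (processes A)"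
    and prooflike_subset: "elts (prooflike A) \<subseteq> elts (terms A)"
    and prooflike_combinators: "{cB A, cC A, cI A, cK A, cW A, cc A} \<subseteq> elts (prooflike A)"
    and prooflike_app: "\<lbrakk>\<xi> \<in>\<^sub>M prooflike A; \<eta> \<in>\<^sub>M prooflike A\<rbrakk> \<Longrightarrow> \<xi> \<cdot> \<eta> \<in>\<^sub>M prooflike A"
    and pole_app: "\<lbrakk>\<xi> \<in>\<^sub>M terms A; \<eta> \<in>\<^sub>M terms A; \<pi> \<in>\<^sub>M stacks A;
        \<xi> \<star> \<eta> \<triangleright> \<pi> \<in>\<^sub>M pole A\<rbrakk> \<Longrightarrow> \<xi> \<cdot> \<eta> \<star> \<pi> \<in>\<^sub>M pole A"
    and pole_B: "\<lbrakk>\<xi> \<in>\<^sub>M terms A; \<eta> \<in>\<^sub>M terms A; \<zeta> \<in>\<^sub>M terms A; \<pi> \<in>\<^sub>M stacks A;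
        \<xi> \<star> (\<eta> \<cdot> \<zeta>) \<triangleright> \<pi> \<in>\<^sub>M pole A\<rbrakk> \<Longrightarrow> cB A \<star> \<xi> \<triangleright> \<eta> \<triangleright> \<zeta> \<triangleright> \<pi> \<in>\<^sub>M pole A"
    and pole_C: "\<lbrakk>\<xi> \<in>\<^sub>M terms A; \<eta> \<in>\<^sub>M terms A; \<zeta> \<in>\<^sub>M terms A; \<pi> \<in>\<^sub>M stacks A;
        \<xi> \<star> \<zeta> \<triangleright> \<eta> \<triangleright> \<pi> \<in>\<^sub>M pole A\<rbrakk> \<Longrightarrow> cC A \<star> \<xi> \<triangleright> \<eta> \<triangleright> \<zeta> \<triangleright> \<pi> \<in>\<^sub>M pole A"
    and pole_I: "\<lbrakk>\<xi> \<in>\<^sub>M terms A; \<pi> \<in>\<^sub>M stacks A;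
        \<xi> \<star> \<pi> \<in>\<^sub>M pole A\<rbrakk> \<Longrightarrow> cI A \<star> \<xi> \<triangleright> \<pi> \<in>\<^sub>M pole A"
    and pole_K: "\<lbrakk>\<xi> \<in>\<^sub>M terms A; \<eta> \<in>\<^sub>M terms A; \<pi> \<in>\<^sub>M stacks A;
        \<xi> \<star> \<pi> \<in>\<^sub>M pole A\<rbrakk> \<Longrightarrow> cK A \<star> \<xi> \<triangleright> \<eta> \<triangleright> \<pi> \<in>\<^sub>M pole A"
    and pole_W: "\<lbrakk>\<xi> \<in>\<^sub>M terms A; \<eta> \<in>\<^sub>M terms A; \<pi> \<in>\<^sub>M stacks A;
        \<xi> \<star> \<eta> \<triangleright> \<eta> \<triangleright> \<pi> \<in>\<^sub>M pole A\<rbrakk> \<Longrightarrow> cW A \<star> \<xi> \<triangleright> \<eta> \<triangleright> \<pi> \<in>\<^sub>M pole A"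
    and pole_cc: "\<lbrakk>\<xi> \<in>\<^sub>M terms A; \<pi> \<in>\<^sub>M stacks A;
        \<xi> \<star> cont \<pi> \<triangleright> \<pi> \<in>\<^sub>M pole A\<rbrakk> \<Longrightarrow> cc A \<star> \<xi> \<triangleright> \<pi> \<in>\<^sub>M pole A"
    and pole_cont: "\<lbrakk>\<xi> \<in>\<^sub>M terms A; \<pi> \<in>\<^sub>M stacks A; \<rho> \<in>\<^sub>M stacks A;
        \<xi> \<star> \<pi> \<in>\<^sub>M pole A\<rbrakk> \<Longrightarrow> cont \<pi> \<star> \<xi> \<triangleright> \<rho> \<in>\<^sub>M pole A"

end

theory Submission
  imports Defs "HOL-Library.Countable"
begin

text \<open>
  Truth in the realizability model is a classical theory, so a Henkin construction reduces the
  claim to ordinary structures satisfying the realized axioms. The axioms needed are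
  extensionality, \<open>\<epsilon>\<close>-induction (realized by a fixed point combinator), Leibniz's law, and one
  instance of replacement in the ground model: for each \<open>a\<close> there are ordinals \<open>\<alpha> < \<beta>\<close> whose
  canonical names \<open>\<alpha>'\<close>, \<open>\<beta>'\<close> satisfy that every surjection \<open>f\<close> of \<open>a\<close> onto \<open>\<alpha>'\<close> has a
  surjection \<open>g\<close> of \<open>a\<close> onto \<open>\<beta>'\<close> inducing the same preorder on \<open>a\<close>. Indeed the truth
  values of these preorders, paired with the realizers of ``\<open>f\<close> is onto'', range over a fixed
  set of the ground model, while the ordinals do not form a set. Since a map onto an ordinal is
  determined by the preorder it induces, \<open>\<alpha>' \<simeq> \<beta>'\<close>, which contradicts \<open>\<alpha>' \<in> \<beta>'\<close>;
  so \<open>\<alpha>'\<close> is not an image of \<open>a\<close>.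
\<close>

section \<open>Definable classes of the ground model\<close>

text \<open>The ground model need not be well founded in the metatheory, and separation, replacement
  and induction are available in it only for classes given by a formula; hence the closure rules for
  definability that everything else rests on. The individuals \<open>f\<close> form a proper class,
  so a Hartogs argument cannot count functions: what can be counted is the trace of the induced
  preorder on a set containing all names that occur in \<open>a\<close>. The realizers are counted
  together with these traces so that one and the same term realizes "\<open>f\<close> is onto
  \<alpha>'" and "\<open>g\<close> is onto \<beta>'". The proof-like term witnessing the axiom then
  just passes that realizer on, and it stays fixed although \<alpha> and \<beta> depend on
  \<open>a\<close>, and \<open>g\<close> on the realizer as well. The pairing symbol occurs only in
  statements that \<open>op x y\<close> is strongly outside an individual, or Leibniz equalities
  reducible to these; treating them as one more relation keeps function symbols out of the Henkin
  construction.\<close>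

lemma sat_finite_support:
  "\<exists>N. \<forall>e e'. (\<forall>n<N. e n = e' n) \<longrightarrow> sat E e F = sat E e' F"
proof (induction F)
  case (Mem i j)
  show ?case by (rule exI[of _ "Suc (max i j)"]) (simp add: less_Suc_eq_le)
next
  case (Equ i j)
  show ?case by (rule exI[of _ "Suc (max i j)"]) (simp add: less_Suc_eq_le)
next
  case (Negation F)
  then show ?case by auto
next
  case (Conjunction F G)
  then obtain N N' where
    N: "\<And>e e'. (\<forall>n<N. e n = e' n) \<Longrightarrow> sat E e F = sat E e' F" and
    N': "\<And>e e'. (\<forall>n<N'. e n = e' n) \<Longrightarrow> sat E e G = sat E e' G" by blast
  show ?case
  proof (intro exI[of _ "max N N'"] allI impI)
    fix e e' :: "nat \<Rightarrow> 'a"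
    assume "\<forall>n<max N N'. e n = e' n"
    then have "sat E e F = sat E e' F" "sat E e G = sat E e' G"
      using N[of e e'] N'[of e e'] by simp_all
    then show "sat E e (Conjunction F G) = sat E e' (Conjunction F G)" by simp
  qed
next
  case (Exist i F)
  then obtain N where N: "\<And>e e'. (\<forall>n<N. e n = e' n) \<Longrightarrow> sat E e F = sat E e' F" by blast
  show ?case
  proof (intro exI[of _ N] allI impI)
    fix e e' :: "nat \<Rightarrow> 'a"
    assume "\<forall>n<N. e n = e' n"
    then have "sat E (e(i := x)) F = sat E (e'(i := x)) F" for x by (intro N) simp
    then show "sat E e (Exist i F) = sat E e' (Exist i F)" by simp
  qed
qed

text \<open>The renaming may be non-injective, so a bound variable has to be moved out of the way of
  the images of the free ones.\<close>

lemma sat_substitution: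
  "\<exists>G. \<forall>e. sat E e G = sat E (\<lambda>n. e (\<sigma> n)) F"
proof (induction F arbitrary: \<sigma>)
  case (Mem i j)
  show ?case by (rule exI[of _ "Mem (\<sigma> i) (\<sigma> j)"]) simp
next
  case (Equ i j)
  show ?case by (rule exI[of _ "Equ (\<sigma> i) (\<sigma> j)"]) simp
next
  case (Negation F)
  obtain G where "\<forall>e. sat E e G = sat E (\<lambda>n. e (\<sigma> n)) F"
    using Negation[of \<sigma>] by (rule exE)
  then show ?case by (intro exI[of _ "Negation G"]) simp
next
  case (Conjunction F F')
  obtain G where "\<forall>e. sat E e G = sat E (\<lambda>n. e (\<sigma> n)) F"
    using Conjunction(1)[of \<sigma>] by (rule exE)
  moreover obtain G' where "\<forall>e. sat E e G' = sat E (\<lambda>n. e (\<sigma> n)) F'"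
    using Conjunction(2)[of \<sigma>] by (rule exE)
  ultimately show ?case by (intro exI[of _ "Conjunction G G'"]) simp
next
  case (Exist i F)
  obtain N where N: "\<And>e e'. (\<forall>n<N. e n = e' n) \<Longrightarrow> sat E e F = sat E e' F"
    using sat_finite_support[of E F] by blast
  \<comment> \<open>A bound name avoiding the images of all variables on which \<open>F\<close>
    depends; finite support guarantees that it exists.\<close>
  obtain j where j: "j \<notin> \<sigma> ` {..<N}"
    by (meson ex_new_if_finite finite_imageI finite_lessThan infinite_UNIV_nat)
  obtain G where G: "\<And>e. sat E e G = sat E (\<lambda>n. e ((\<sigma>(i := j)) n)) F"
    using Exist[of "\<sigma>(i := j)"] by blast
  have "sat E (e(j := x)) G = sat E ((\<lambda>n. e (\<sigma> n))(i := x)) F" for e x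
    unfolding G by (rule N) (use j in auto)
  then show ?case by (intro exI[of _ "Exist j G"]) simp
qed

text \<open>Interleaving leaves infinitely many places for arguments and for parameters, and lets
  two parameter sequences be stored in one.\<close>

definition merge :: "(nat \<Rightarrow> 'a) \<Rightarrow> (nat \<Rightarrow> 'a) \<Rightarrow> nat \<Rightarrow> 'a" where
  "merge e r n = (if even n then e (n div 2) else r (n div 2))"

lemma merge_simps [simp]:
  "merge e r (2 * n) = e n" "merge e r (Suc (2 * n)) = r n"
  "merge e r (n * 2) = e n" "merge e r (Suc (n * 2)) = r n"
  by (simp_all add: merge_def)

lemma merge_eqI:
  "(\<And>n. f (2 * n) = e n) \<Longrightarrow> (\<And>n. f (Suc (2 * n)) = r n) \<Longrightarrow> merge e r = f"
proof (rule ext)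
  fix n
  assume f: "\<And>n. f (2 * n) = e n" "\<And>n. f (Suc (2 * n)) = r n"
  show "merge e r n = f n"
    using f[of "n div 2"] by (cases "even n") (auto simp: merge_def)
qed

abbreviation tl_env :: "(nat \<Rightarrow> 'a) \<Rightarrow> nat \<Rightarrow> 'a" where
  "tl_env e \<equiv> (\<lambda>n. e (Suc n))"

section \<open>Definable predicates and class functions: closure under logic and
  substitution\<close>

context set_structure
begin

text \<open>The even variables carry the arguments of the predicate, the odd ones its parameters.\<close>

definition definable :: "((nat \<Rightarrow> 'm) \<Rightarrow> bool) \<Rightarrow> bool" where
  "definable P \<longleftrightarrow> (\<exists>F r. \<forall>e. P e = sat (\<in>\<^sub>M) (merge e r) F)"

definition definable_fn :: "((nat \<Rightarrow> 'm) \<Rightarrow> 'm) \<Rightarrow> bool" where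
  "definable_fn t \<longleftrightarrow> definable (\<lambda>e. e 0 = t (tl_env e))"

lemma definable_subst:
  assumes "definable P"
    and "\<And>n. (\<exists>i. \<forall>e. t n e = e i) \<or> (\<exists>c. \<forall>e. t n e = c)"
  shows "definable (\<lambda>e. P (\<lambda>n. t n e))"
proof -
  obtain F r where F: "\<And>e. P e = sat (\<in>\<^sub>M) (merge e r) F"
    using assms(1) unfolding definable_def by blast
  obtain i s where ts: "\<And>n e. t n e = (case i n of None \<Rightarrow> s n | Some j \<Rightarrow> e j)"
  proof -
    have "\<exists>js. \<forall>e. t n e = (case fst js of None \<Rightarrow> snd js | Some j \<Rightarrow> e j)" for n
      using assms(2)[of n] by (metis fst_conv option.case snd_conv)
    then obtain g where "\<And>n e. t n e = (case fst (g n) of None \<Rightarrow> snd (g n) | Some j \<Rightarrow> e j)"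
      by metis
    then show thesis by (rule that)
  qed
  \<comment> \<open>In \<open>merge e (merge r s)\<close> an old parameter \<open>r n\<close> sits
    at \<open>Suc (2 * (2 * n))\<close> and a substituted constant \<open>s n\<close> at
    \<open>Suc (2 * Suc (2 * n))\<close>.\<close>
  define \<sigma> where "\<sigma> = merge (\<lambda>n. case i n of None \<Rightarrow> Suc (2 * Suc (2 * n)) | Some j \<Rightarrow> 2 * j)
    (\<lambda>n. Suc (2 * (2 * n)))"
  obtain G where G: "\<And>e. sat (\<in>\<^sub>M) e G = sat (\<in>\<^sub>M) (\<lambda>n. e (\<sigma> n)) F"
    using sat_substitution by blast
  have "merge (\<lambda>n. t n e) r = (\<lambda>n. merge e (merge r s) (\<sigma> n))" for e
  proof (rule merge_eqI)
    show "merge e (merge r s) (\<sigma> (2 * n)) = t n e" for n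
      by (cases "i n") (simp_all only: \<sigma>_def merge_simps ts option.case)
    show "merge e (merge r s) (\<sigma> (Suc (2 * n))) = r n" for n
      by (simp only: \<sigma>_def merge_simps)
  qed
  then show ?thesis unfolding definable_def F by (intro exI[of _ G] exI[of _ "merge r s"]) (simp add: G)
qed

lemma definable_rename:
  "definable P \<Longrightarrow> definable (\<lambda>e. P (\<lambda>n. e (\<sigma> n)))"
  by (rule definable_subst) blast+

lemma definable_not: "definable P \<Longrightarrow> definable (\<lambda>e. \<not> P e)"
  unfolding definable_def by (metis sat.simps(3))

text \<open>The conjuncts come with separate parameter sequences \<open>r\<close> and
  \<open>s\<close>; both formulas are renamed so as to read theirs from
  \<open>merge r s\<close>.\<close>

lemma definable_conj:
  assumes "definable P" "definable Q"
  shows "definable (\<lambda>e. P e \<and> Q e)"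
proof -
  obtain F r where F: "\<And>e. P e = sat (\<in>\<^sub>M) (merge e r) F"
    using assms(1) unfolding definable_def by blast
  obtain G s where G: "\<And>e. Q e = sat (\<in>\<^sub>M) (merge e s) G"
    using assms(2) unfolding definable_def by blast
  obtain F' where F': "\<And>e. sat (\<in>\<^sub>M) e F' =
      sat (\<in>\<^sub>M) (\<lambda>n. e (merge (\<lambda>n. 2 * n) (\<lambda>n. Suc (2 * (2 * n))) n)) F"
    using sat_substitution by blast
  obtain G' where G': "\<And>e. sat (\<in>\<^sub>M) e G' =
      sat (\<in>\<^sub>M) (\<lambda>n. e (merge (\<lambda>n. 2 * n) (\<lambda>n. Suc (2 * Suc (2 * n))) n)) G"
    using sat_substitution by blast
  have r: "merge e r =
      (\<lambda>n. merge e (merge r s) (merge (\<lambda>n. 2 * n) (\<lambda>n. Suc (2 * (2 * n))) n))" for e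
    by (rule merge_eqI) (simp_all only: merge_simps)
  have s: "merge e s =
      (\<lambda>n. merge e (merge r s) (merge (\<lambda>n. 2 * n) (\<lambda>n. Suc (2 * Suc (2 * n))) n))" for e
    by (rule merge_eqI) (simp_all only: merge_simps)
  have "(P e \<and> Q e) = sat (\<in>\<^sub>M) (merge e (merge r s)) (Conjunction F' G')" for e
    by (simp only: sat.simps F G F' G' flip: r s)
  then show ?thesis unfolding definable_def by blast
qed

lemma definable_ex:
  assumes "definable (\<lambda>e. Q (tl_env e) (e 0))"
  shows "definable (\<lambda>e. \<exists>x. Q e x)"
proof -
  obtain F r where F: "\<And>e. Q (tl_env e) (e 0) = sat (\<in>\<^sub>M) (merge e r) F"
    using assms(1) unfolding definable_def by blast
  have Q: "Q e x = sat (\<in>\<^sub>M) (merge (case_nat x e) r) F" for e x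
    using F[of "case_nat x e"] by simp
  obtain N where N: "\<And>e e'. (\<forall>n<N. e n = e' n) \<Longrightarrow> sat (\<in>\<^sub>M) e F = sat (\<in>\<^sub>M) e' F"
    using sat_finite_support by blast
  \<comment> \<open>Argument 0 becomes the named variable \<open>2 * N\<close>, the other arguments
    move down by one. Being even, \<open>2 * N\<close> is no parameter; being beyond the support, it
    clashes with no argument that \<open>F\<close> reads.\<close>
  define \<sigma> where "\<sigma> = merge (case_nat (2 * N) (\<lambda>n. 2 * n)) (\<lambda>n. Suc (2 * n))"
  obtain G where G: "\<And>e. sat (\<in>\<^sub>M) e G = sat (\<in>\<^sub>M) (\<lambda>n. e (\<sigma> n)) F"
    using sat_substitution by blast
  have "sat (\<in>\<^sub>M) ((merge e r)(2 * N := x)) G = sat (\<in>\<^sub>M) (merge (case_nat x e) r) F" for e x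
    unfolding G
  proof (rule N, intro allI impI)
    fix n assume n: "n < N"
    show "((merge e r)(2 * N := x)) (\<sigma> n) = merge (case_nat x e) r n"
    proof (cases "even n")
      case True
      then obtain m where m: "n = 2 * m" by blast
      have "m \<noteq> Suc N" using n m by simp
      then show ?thesis using n unfolding m \<sigma>_def merge_simps
        by (cases m) simp_all
    next
      case False
      then obtain m where m: "n = Suc (2 * m)" by (metis oddE Suc_eq_plus1)
      have "Suc (2 * m) \<noteq> 2 * N" by presburger
      then show ?thesis unfolding m \<sigma>_def by simp
    qed
  qed
  then show ?thesis unfolding definable_def Q
    by (intro exI[of _ "Exist (2 * N) G"] exI[of _ r]) simp
qed

lemma definable_atom_mem: "definable (\<lambda>e. e i \<in>\<^sub>M e j)"
  unfolding definable_def by (rule exI[of _ "Mem (2 * i) (2 * j)"]) simp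

lemma definable_atom_eq: "definable (\<lambda>e. e i = e j)"
  unfolding definable_def by (rule exI[of _ "Equ (2 * i) (2 * j)"]) simp

lemma definable_const: "definable (\<lambda>e. c)"
proof -
  have "definable (\<lambda>e. (e 0 = e 0) = True)" using definable_atom_eq[of 0 0] by simp
  then show ?thesis using definable_not[OF definable_atom_eq[of 0 0]] by (cases c) auto
qed

lemma definable_imp: "definable P \<Longrightarrow> definable Q \<Longrightarrow> definable (\<lambda>e. P e \<longrightarrow> Q e)"
  using definable_not[OF definable_conj[of P "\<lambda>e. \<not> Q e"]] definable_not[of Q] by simp

lemma definable_disj: "definable P \<Longrightarrow> definable Q \<Longrightarrow> definable (\<lambda>e. P e \<or> Q e)"
  using definable_imp[of "\<lambda>e. \<not> P e" Q] definable_not[of P] by (simp add: disj_imp)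

lemma definable_iff: "definable P \<Longrightarrow> definable Q \<Longrightarrow> definable (\<lambda>e. P e = Q e)"
  using definable_conj[OF definable_imp[of P Q] definable_imp[of Q P]]
  by (simp add: iff_conv_conj_imp)

lemma definable_all:
  "definable (\<lambda>e. Q (tl_env e) (e 0)) \<Longrightarrow> definable (\<lambda>e. \<forall>x. Q e x)"
  using definable_not[OF definable_ex[of "\<lambda>e x. \<not> Q e x"]]
    definable_not[of "\<lambda>e. Q (tl_env e) (e 0)"] by simp

text \<open>A term is eliminated as in \<exists>x. x = t e \<and> Q e x. All later rules for
  substituting terms into predicates and class functions are iterations of this one.\<close>

lemma definable_let:
  assumes "definable (\<lambda>e. Q (tl_env e) (e 0))" "definable_fn t"
  shows "definable (\<lambda>e. Q e (t e))"
  using definable_ex[OF definable_conj[of "\<lambda>e. e 0 = t (tl_env e)" "\<lambda>e. Q (tl_env e) (e 0)"]] assms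
  unfolding definable_fn_def by simp

lemma definable_app1:
  assumes "definable (\<lambda>e. P (e 0))" "definable_fn s"
  shows "definable (\<lambda>e. P (s e))"
  by (rule definable_let[OF _ assms(2)]) (rule assms(1))

lemma definable_fn_rename:
  "definable_fn t \<Longrightarrow> definable_fn (\<lambda>e. t (\<lambda>n. e (\<sigma> n)))"
  unfolding definable_fn_def
  by (drule definable_rename[where \<sigma> = "case_nat 0 (\<lambda>n. Suc (\<sigma> n))"]) simp

lemma definable_app2:
  assumes "definable (\<lambda>e. P (e 0) (e 1))" "definable_fn s" "definable_fn t"
  shows "definable (\<lambda>e. P (s e) (t e))"
proof (rule definable_let[OF _ assms(2)])
  show "definable (\<lambda>e. P (e 0) (t (tl_env e)))"
  proof (rule definable_let[OF _ definable_fn_rename[OF assms(3), of Suc]])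
    show "definable (\<lambda>e. P (tl_env e 0) (e 0))"
      using definable_rename[OF assms(1), of "case_nat 1 (\<lambda>_. 0)"] by simp
  qed
qed

lemma definable_app3:
  assumes "definable (\<lambda>e. P (e 0) (e 1) (e 2))" "definable_fn s" "definable_fn t" "definable_fn u"
  shows "definable (\<lambda>e. P (s e) (t e) (u e))"
proof (rule definable_let[OF _ assms(2)])
  show "definable (\<lambda>e. P (e 0) (t (tl_env e)) (u (tl_env e)))"
  proof (rule definable_let[OF _ definable_fn_rename[OF assms(3), of Suc]])
    show "definable (\<lambda>e. P (tl_env e 0) (e 0) (u (tl_env (tl_env e))))"
    proof (rule definable_let[OF _ definable_fn_rename[OF assms(4), of "\<lambda>n. Suc (Suc n)"]])
      show "definable (\<lambda>e. P (tl_env (tl_env e) 0) (tl_env e 0) (e 0))"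
        using definable_rename[OF assms(1), of "case_nat 2 (case_nat 1 (\<lambda>_. 0))"]
        by (simp add: numeral_2_eq_2)
    qed
  qed
qed

lemma definable_fn_var: "definable_fn (\<lambda>e. e n)"
  unfolding definable_fn_def by (rule definable_atom_eq)

lemma definable_fn_const: "definable_fn (\<lambda>e. c)"
proof -
  have "definable (\<lambda>e. case_nat (\<lambda>e. e 0) (\<lambda>_ _. c) 0 e = case_nat (\<lambda>e. e 0) (\<lambda>_ _. c) 1 e)"
    by (rule definable_subst[OF definable_atom_eq[of 0 1]]) (auto split: nat.split)
  then show ?thesis unfolding definable_fn_def by simp
qed

lemma definable_mem: "definable_fn s \<Longrightarrow> definable_fn t \<Longrightarrow> definable (\<lambda>e. s e \<in>\<^sub>M t e)"
  by (rule definable_app2) (rule definable_atom_mem)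

lemma definable_eq: "definable_fn s \<Longrightarrow> definable_fn t \<Longrightarrow> definable (\<lambda>e. s e = t e)"
  by (rule definable_app2) (rule definable_atom_eq)

lemma definable_mem_elts: "definable_fn s \<Longrightarrow> definable_fn t \<Longrightarrow> definable (\<lambda>e. s e \<in> elts (t e))"
  unfolding elts_def by (simp add: definable_mem)

lemma definable_ball:
  assumes "definable_fn t" "definable (\<lambda>e. Q (tl_env e) (e 0))"
  shows "definable (\<lambda>e. \<forall>x\<in>elts (t e). Q e x)"
  unfolding Ball_def
  by (intro definable_all definable_imp definable_mem_elts definable_fn_var
      definable_fn_rename[OF assms(1)] assms(2))

lemma definable_bex:
  assumes "definable_fn t" "definable (\<lambda>e. Q (tl_env e) (e 0))"
  shows "definable (\<lambda>e. \<exists>x\<in>elts (t e). Q e x)"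
  unfolding Bex_def
  by (intro definable_ex definable_conj definable_mem_elts definable_fn_var
      definable_fn_rename[OF assms(1)] assms(2))

lemmas definable_intros =
  definable_not definable_conj definable_disj definable_imp definable_iff definable_all definable_ex
  definable_mem definable_eq definable_mem_elts definable_ball definable_bex
  definable_fn_var definable_fn_const definable_const

lemma definable_fn_app1:
  assumes "definable (\<lambda>e. e 0 = g (e 1))" "definable_fn s"
  shows "definable_fn (\<lambda>e. g (s e))"
  unfolding definable_fn_def
  by (rule definable_app2[where P = "\<lambda>z x. z = g x"])
    (use assms definable_fn_var definable_fn_rename[OF assms(2)] in auto)

lemma definable_fn_app2:
  assumes "definable (\<lambda>e. e 0 = g (e 1) (e 2))" "definable_fn s" "definable_fn t"
  shows "definable_fn (\<lambda>e. g (s e) (t e))"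
  unfolding definable_fn_def
  by (rule definable_app3[where P = "\<lambda>z x y. z = g x y"])
    (use assms definable_fn_var definable_fn_rename[OF assms(2)] definable_fn_rename[OF assms(3)] in auto)

definition small :: "'m set \<Rightarrow> bool" where
  "small S \<longleftrightarrow> (\<exists>z. elts z = S)"

lemma small_elts [simp]: "small (elts x)"
  unfolding small_def by blast

end

section \<open>Sets, pairs, products and induction inside the ground model\<close>

context ground_model
begin

lemma mk_elts [simp]: "mk (elts x) = x"
  unfolding mk_def by (rule the_equality) (simp_all add: extensionality)

lemma elts_mk [simp]: "small S \<Longrightarrow> elts (mk S) = S"
  unfolding small_def using mk_elts by fastforce

lemma eq_mk_iff: "small S \<Longrightarrow> x = mk S \<longleftrightarrow> elts x = S"
  using elts_mk mk_elts by metis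

lemma mk_inject: "small S \<Longrightarrow> small T \<Longrightarrow> mk S = mk T \<longleftrightarrow> S = T"
  using elts_mk by metis

lemma elts_iff: "x \<in> elts y \<longleftrightarrow> x \<in>\<^sub>M y"
  unfolding elts_def by simp

lemma small_pair [simp]: "small {x, y}"
  unfolding small_def by (rule pairing)

lemma small_singleton [simp]: "small {x}"
  using small_pair[of x x] by simp

lemma small_Union: "small S \<Longrightarrow> small (\<Union>y\<in>S. elts y)"
  unfolding small_def using union by metis

lemma small_Un: "small S \<Longrightarrow> small T \<Longrightarrow> small (S \<union> T)"
  using small_Union[OF small_pair[of "mk S" "mk T"]] by simp

lemma small_insert [simp]: "small S \<Longrightarrow> small (insert x S)"
  using small_Un[of "{x}" S] by simp

lemma small_Pow: "small {y. elts y \<subseteq> elts x}"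
  unfolding small_def by (rule power_set)

lemma small_separation:
  assumes "definable (\<lambda>e. P (e 0))"
  shows "small {x \<in> elts a. P x}"
proof -
  obtain F r where F: "\<And>e. P (e 0) = sat (\<in>\<^sub>M) (merge e r) F"
    using assms unfolding definable_def by blast
  \<comment> \<open>The scheme varies only variable 0: all argument places are identified with it,
    and the parameters follow from 1 on.\<close>
  obtain G where G: "\<And>e. sat (\<in>\<^sub>M) e G = sat (\<in>\<^sub>M) (\<lambda>n. e (merge (\<lambda>_. 0) Suc n)) F"
    using sat_substitution by blast
  have "merge (\<lambda>_. x) r = (\<lambda>n. ((case_nat a r)(0 := x)) (merge (\<lambda>_. 0) Suc n))" for x
    by (rule merge_eqI) (simp_all only: merge_simps, simp_all)
  then have "sat (\<in>\<^sub>M) ((case_nat a r)(0 := x)) G = P x" for x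
    unfolding G using F[of "\<lambda>_. x"] by simp
  then show ?thesis unfolding small_def using separation[of a "case_nat a r" G] by simp
qed

lemma small_replacement:
  assumes "definable (\<lambda>e. P (e 0) (e 1))"
    and fn: "\<And>x y y'. x \<in> elts a \<Longrightarrow> P x y \<Longrightarrow> P x y' \<Longrightarrow> y = y'"
  shows "small {y. \<exists>x\<in>elts a. P x y}"
proof -
  obtain F r where F: "\<And>e. P (e 0) (e 1) = sat (\<in>\<^sub>M) (merge e r) F"
    using assms unfolding definable_def by blast
  define \<sigma> where "\<sigma> = merge (\<lambda>n. if n = 0 then 0 else 1) (\<lambda>n. Suc (Suc n))"
  obtain G where G: "\<And>e. sat (\<in>\<^sub>M) e G = sat (\<in>\<^sub>M) (\<lambda>n. e (\<sigma> n)) F"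
    using sat_substitution by blast
  define E where "E = (\<lambda>n. r (n - 2))"
  have "merge (\<lambda>n. if n = 0 then x else y) r = (\<lambda>n. (E(0 := x, 1 := y)) (\<sigma> n))" for x y
    by (rule merge_eqI) (simp_all only: \<sigma>_def merge_simps, simp_all add: E_def)
  then have "sat (\<in>\<^sub>M) (E(0 := x, 1 := y)) G = P x y" for x y
    unfolding G using F[of "\<lambda>n. if n = 0 then x else y"] by simp
  then show ?thesis
    unfolding small_def using replacement[of a E G] fn by (simp add: elts_def)
qed

lemma opair_inject [simp]: "opair x y = opair x' y' \<longleftrightarrow> x = x' \<and> y = y'"
  unfolding opair_def by (auto simp: mk_inject doubleton_eq_iff)

lemma elts_opair: "elts (opair x y) = {mk {x}, mk {x, y}}"
  unfolding opair_def by simp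

lemma definable_fn_mk_pair:
  "definable_fn s \<Longrightarrow> definable_fn t \<Longrightarrow> definable_fn (\<lambda>e. mk {s e, t e})"
proof (rule definable_fn_app2[where g = "\<lambda>x y. mk {x, y}"])
  show "definable (\<lambda>e. e 0 = mk {e 1, e 2})"
    unfolding eq_mk_iff[OF small_pair] set_eq_iff insert_iff empty_iff
    by (intro definable_intros)
qed

lemma definable_fn_opair [intro]:
  "definable_fn s \<Longrightarrow> definable_fn t \<Longrightarrow> definable_fn (\<lambda>e. opair (s e) (t e))"
  unfolding opair_def
  using definable_fn_mk_pair[of s s] by (simp add: definable_fn_mk_pair)

lemma definable_subset:
  assumes "definable_fn s" "definable_fn t"
  shows "definable (\<lambda>e. elts (s e) \<subseteq> elts (t e))"
  unfolding subset_eq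
  by (intro definable_intros assms definable_fn_rename[OF assms(2)])

text \<open>Kuratowski pairs over the union of \<open>A\<close> and \<open>B\<close> lie in its
  double power set, where separation picks them out.\<close>

lemma small_cartesian: "small {opair x y | x y. x \<in>\<^sub>M A \<and> y \<in>\<^sub>M B}"
proof -
  define U where "U = mk (elts A \<union> elts B)"
  define P where "P = mk {y. elts y \<subseteq> elts U}"
  define Q where "Q = mk {y. elts y \<subseteq> elts P}"
  have U: "elts U = elts A \<union> elts B" unfolding U_def by (simp add: small_Un)
  have P: "elts P = {y. elts y \<subseteq> elts U}" unfolding P_def using small_Pow by simp
  have Q: "elts Q = {y. elts y \<subseteq> elts P}" unfolding Q_def using small_Pow by simp
  have eq: "{z \<in> elts Q. \<exists>x y. z = opair x y \<and> x \<in> elts A \<and> y \<in> elts B} =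
      {opair x y | x y. x \<in> elts A \<and> y \<in> elts B}"
    by (auto simp: Q P U elts_opair)
  have "small {z \<in> elts Q. \<exists>x y. z = opair x y \<and> x \<in> elts A \<and> y \<in> elts B}"
    by (rule small_separation) (intro definable_intros definable_fn_opair)
  then show ?thesis unfolding eq by (simp add: elts_iff)
qed

lemma elts_cartesian [simp]:
  "elts (cartesian A B) = {opair x y | x y. x \<in>\<^sub>M A \<and> y \<in>\<^sub>M B}"
  unfolding cartesian_def using small_cartesian by simp

lemma mem_cartesian [simp]: "opair x y \<in>\<^sub>M cartesian A B \<longleftrightarrow> x \<in>\<^sub>M A \<and> y \<in>\<^sub>M B"
  using elts_iff[of "opair x y" "cartesian A B"] by simp

lemma definable_fn_mk_separation:
  assumes "definable (\<lambda>e. P (tl_env e) (e 0))"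
  shows "definable_fn (\<lambda>e. mk {z \<in> elts c. P e z})"
proof -
  have "small {z \<in> elts c. P e z}" for e
  proof (rule small_separation)
    show "definable (\<lambda>e'. P e (e' 0))"
    proof -
      \<comment> \<open>With \<open>e\<close> fixed, its entries are substituted as constants and
        only the element variable stays free.\<close>
      have "definable (\<lambda>e'. P (tl_env (\<lambda>n. case_nat (\<lambda>e. e 0) (\<lambda>n _. e n) n e'))
          (case_nat (\<lambda>e. e 0) (\<lambda>n _. e n) 0 e'))"
        by (rule definable_subst[OF assms]) (auto split: nat.split)
      then show ?thesis by simp
    qed
  qed
  moreover have "definable (\<lambda>e. \<forall>z. z \<in> elts (e 0) \<longleftrightarrow> z \<in> elts c \<and> P (tl_env e) z)"
    by (intro definable_intros)
      (use definable_rename[OF assms, of "case_nat 0 (\<lambda>n. Suc (Suc n))"] in simp)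
  ultimately show ?thesis
    unfolding definable_fn_def by (simp add: eq_mk_iff set_eq_iff)
qed

text \<open>The union of a sequence \<open>(L\<^sub>\<beta>)\<^sub>\<beta>\<^sub>\<le>\<^sub>\<alpha>\<close> containing \<open>x\<close> is transitive, so
  \<open>V = L\<close> yields transitive closures without a recursion over \<open>\<omega>\<close>.\<close>

lemma transitive_cover: "\<exists>T. transitive T \<and> x \<in> elts T"
proof -
  obtain \<alpha> f where \<alpha>: "ordinal \<alpha>" and f: "constructible_hierarchy \<alpha> f" and x: "x \<in>\<^sub>M ap f \<alpha>"
    using V_eq_L unfolding constructible_def by blast
  define I where "I = insert \<alpha> (elts \<alpha>)"
  have I: "\<gamma> \<in> I" if "\<beta> \<in> I" "\<gamma> \<in> elts \<beta>" for \<beta> \<gamma>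
    using \<alpha> that unfolding I_def ordinal_def transitive_def by blast
  have ex1: "\<exists>!y. opair \<beta> y \<in>\<^sub>M f" if "\<beta> \<in> I" for \<beta>
    using f that unfolding constructible_hierarchy_def I_def by blast
  have ap: "opair \<beta> y \<in>\<^sub>M f \<longleftrightarrow> y = ap f \<beta>" if "\<beta> \<in> I" for \<beta> y
    unfolding ap_def using theI'[OF ex1[OF that]] the1_equality[OF ex1[OF that]] by blast
  \<comment> \<open>The stages form a set because the restriction of \<open>f\<close> to indices in
    \<open>I\<close> is single-valued, so replacement applies.\<close>
  have "small {y. \<exists>\<beta>\<in>elts (mk I). opair \<beta> y \<in>\<^sub>M f}"
  proof (rule small_replacement[where P = "\<lambda>\<beta> y. opair \<beta> y \<in>\<^sub>M f"])
    show "definable (\<lambda>e. opair (e 0) (e 1) \<in>\<^sub>M f)"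
      by (intro definable_intros definable_fn_opair)
    show "y = y'" if "\<beta> \<in> elts (mk I)" "opair \<beta> y \<in>\<^sub>M f" "opair \<beta> y' \<in>\<^sub>M f" for \<beta> y y'
      using that ap by (simp add: I_def)
  qed
  moreover have "{y. \<exists>\<beta>\<in>elts (mk I). opair \<beta> y \<in>\<^sub>M f} = ap f ` I"
    using ap by (auto simp: I_def)
  ultimately have "small (\<Union>\<beta>\<in>I. elts (ap f \<beta>))" using small_Union[of "ap f ` I"] by simp
  then have T: "elts (mk (\<Union>\<beta>\<in>I. elts (ap f \<beta>))) = (\<Union>\<beta>\<in>I. elts (ap f \<beta>))" by simp
  \<comment> \<open>An element of a stage is a definable subset of an earlier stage; being a subset
    is what makes the union transitive.\<close>
  have sub: "\<exists>\<gamma>\<in>I. elts y \<subseteq> elts (ap f \<gamma>)" if \<beta>: "\<beta> \<in> I" and y: "y \<in> elts (ap f \<beta>)" for \<beta> y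
  proof -
    have "elts (ap f \<beta>) = {X. \<exists>\<gamma>\<in>elts \<beta>. definable_subset (ap f \<gamma>) X}"
      using f \<beta> unfolding constructible_hierarchy_def I_def by blast
    then obtain \<gamma> where \<gamma>: "\<gamma> \<in> elts \<beta>" "definable_subset (ap f \<gamma>) y" using y by blast
    then have "elts y \<subseteq> elts (ap f \<gamma>)" unfolding definable_subset_def by blast
    then show ?thesis using I[OF \<beta> \<gamma>(1)] by blast
  qed
  have "\<exists>\<beta>\<in>I. z \<in> elts (ap f \<beta>)" if "\<beta> \<in> I" "y \<in> elts (ap f \<beta>)" "z \<in> elts y" for \<beta> y z
    using sub[OF that(1,2)] that(3) by blast
  then have "transitive (mk (\<Union>\<beta>\<in>I. elts (ap f \<beta>)))"
    unfolding transitive_def T by blast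
  moreover have "x \<in> elts (mk (\<Union>\<beta>\<in>I. elts (ap f \<beta>)))"
    unfolding T using x by (auto simp: I_def elts_iff)
  ultimately show ?thesis by blast
qed

text \<open>Foundation gives a minimal counterexample within a transitive set; all its elements lie
  in that set too, so they satisfy \<open>P\<close>.\<close>

lemma mem_induct:
  assumes "definable (\<lambda>e. P (e 0))"
    and step: "\<And>x. (\<And>y. y \<in> elts x \<Longrightarrow> P y) \<Longrightarrow> P x"
  shows "P x"
proof (rule ccontr)
  assume x: "\<not> P x"
  obtain T where T: "transitive T" "x \<in> elts T" using transitive_cover by blast
  have Z: "elts (mk {y \<in> elts T. \<not> P y}) = {y \<in> elts T. \<not> P y}"
    by (rule elts_mk, rule small_separation) (rule definable_not[OF assms(1)])
  then obtain y where "y \<in> elts T" "\<not> P y" "elts y \<inter> {y \<in> elts T. \<not> P y} = {}"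
    using foundation[of "mk {y \<in> elts T. \<not> P y}"] x T by auto
  then show False using step[of y] T(1) unfolding transitive_def by blast
qed

lemma not_mem_self: "x \<notin> elts x"
proof (rule mem_induct[of "\<lambda>x. x \<notin> elts x"])
  show "definable (\<lambda>e. e 0 \<notin> elts (e 0))" by (intro definable_intros)
qed blast

lemma elts_elts_opair: "c \<in> elts (mk {c})" "mk {c} \<in> elts (opair c p)"
  by (simp_all add: elts_opair)

lemma transitive_opair_mem:
  "transitive T \<Longrightarrow> a \<in> elts T \<Longrightarrow> opair c p \<in>\<^sub>M a \<Longrightarrow> c \<in> elts T"
  unfolding transitive_def elts_iff[symmetric, of _ a] using elts_elts_opair by blast

text \<open>Induction along the relation ``\<open>c\<close> occurs as a first component in \<open>a\<close>'', which is
  contained in the third iterate of \<open>\<in>\<close>.\<close>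

lemma name_induct:
  assumes P: "definable (\<lambda>e. P (e 0))"
    and step: "\<And>a. (\<And>c p. opair c p \<in>\<^sub>M a \<Longrightarrow> P c) \<Longrightarrow> P a"
  shows "P a"
proof -
  \<comment> \<open>From \<open>c\<close> to \<open>a\<close> there are three membership steps,
    through \<open>mk {c}\<close> and \<open>opair c p\<close>. Carrying two further levels along
    lets a single step of induction reach \<open>c\<close>.\<close>
  have "P a \<and> (\<forall>y\<in>elts a. P y \<and> (\<forall>z\<in>elts y. P z))"
  proof (rule mem_induct[where P = "\<lambda>a. P a \<and> (\<forall>y\<in>elts a. P y \<and> (\<forall>z\<in>elts y. P z))"])
    show "definable (\<lambda>e. P (e 0) \<and> (\<forall>y\<in>elts (e 0). P y \<and> (\<forall>z\<in>elts y. P z)))"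
      by (intro definable_not definable_conj definable_ball definable_fn_var P
          definable_app1[of P, OF P])
  next
    fix x
    assume IH: "\<And>y. y \<in> elts x \<Longrightarrow> P y \<and> (\<forall>z\<in>elts y. P z \<and> (\<forall>z'\<in>elts z. P z'))"
    have "P x"
    proof (rule step)
      fix c p
      assume "opair c p \<in>\<^sub>M x"
      then show "P c" using IH elts_elts_opair unfolding elts_iff[symmetric, of _ x] by blast
    qed
    then show "P x \<and> (\<forall>y\<in>elts x. P y \<and> (\<forall>z\<in>elts y. P z))" using IH by blast
  qed
  then show ?thesis by blast
qed

text \<open>Outside the domain, \<open>ap\<close> is a description without witness and hence equals
  the fixed individual \<open>THE y. False\<close>. With this default as a parameter the total
  functional is definable.\<close>

lemma maps_ap_eq:
  assumes "maps f A B"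
  shows "y = ap f x \<longleftrightarrow> opair x y \<in>\<^sub>M f \<or> (\<forall>y. \<not> opair x y \<in>\<^sub>M f) \<and> y = (THE y. False)"
proof (cases "\<exists>y. opair x y \<in>\<^sub>M f")
  case True
  then have "x \<in> elts A" using assms unfolding maps_def elts_def by fastforce
  then have *: "\<exists>!y. opair x y \<in>\<^sub>M f" using assms unfolding maps_def by blast
  show ?thesis unfolding ap_def using True theI'[OF *] the1_equality[OF *] by blast
next
  case False
  then have no: "\<not> opair x z \<in>\<^sub>M f" for z by blast
  show ?thesis unfolding ap_def by (simp add: no)
qed

lemma definable_fn_ap:
  assumes "maps f A B" "definable_fn t"
  shows "definable_fn (\<lambda>e. ap f (t e))"
proof (rule definable_fn_app1[OF _ assms(2)])
  show "definable (\<lambda>e. e 0 = ap f (e 1))"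
    unfolding maps_ap_eq[OF assms(1)]
    by (intro definable_intros definable_fn_opair)
qed

lemma maps_ap: "maps f A B \<Longrightarrow> x \<in>\<^sub>M A \<Longrightarrow> ap f x \<in>\<^sub>M B"
proof -
  assume f: "maps f A B" and x: "x \<in>\<^sub>M A"
  then have *: "\<exists>!y. opair x y \<in>\<^sub>M f" unfolding maps_def by (simp add: elts_iff)
  have "opair x (ap f x) \<in>\<^sub>M f" unfolding ap_def using theI'[OF *] .
  then show "ap f x \<in>\<^sub>M B" using f unfolding maps_def elts_def by fastforce
qed

end

section \<open>Ordinals and names\<close>

context ground_model
begin

lemma definable_transitive: "definable_fn t \<Longrightarrow> definable (\<lambda>e. transitive (t e))"
proof (rule definable_app1[of transitive])
  show "definable (\<lambda>e. transitive (e 0))"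
    unfolding transitive_def by (intro definable_intros definable_subset)
qed

lemma definable_ordinal: "definable_fn t \<Longrightarrow> definable (\<lambda>e. ordinal (t e))"
proof (rule definable_app1[of ordinal])
  show "definable (\<lambda>e. ordinal (e 0))"
    unfolding ordinal_def by (intro definable_intros definable_transitive)
qed

lemma ordinal_mem: "ordinal \<alpha> \<Longrightarrow> \<beta> \<in> elts \<alpha> \<Longrightarrow> ordinal \<beta>"
  unfolding ordinal_def transitive_def by blast

lemma ordinal_trans: "ordinal \<alpha> \<Longrightarrow> \<beta> \<in> elts \<alpha> \<Longrightarrow> \<gamma> \<in> elts \<beta> \<Longrightarrow> \<gamma> \<in> elts \<alpha>"
  unfolding ordinal_def transitive_def by blast

text \<open>Double membership induction: if neither ordinal belongs to the other, the two induction
  hypotheses put all elements of each into the other, and extensionality makes them equal.\<close>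

lemma ordinal_linear:
  assumes "ordinal \<alpha>" "ordinal \<beta>"
  shows "\<alpha> \<in> elts \<beta> \<or> \<alpha> = \<beta> \<or> \<beta> \<in> elts \<alpha>"
proof -
  have "ordinal \<alpha> \<longrightarrow> (\<forall>\<beta>. ordinal \<beta> \<longrightarrow> \<alpha> \<in> elts \<beta> \<or> \<alpha> = \<beta> \<or> \<beta> \<in> elts \<alpha>)"
  proof (rule mem_induct[where P = "\<lambda>\<alpha>. ordinal \<alpha> \<longrightarrow>
      (\<forall>\<beta>. ordinal \<beta> \<longrightarrow> \<alpha> \<in> elts \<beta> \<or> \<alpha> = \<beta> \<or> \<beta> \<in> elts \<alpha>)"])
    show "definable (\<lambda>e. ordinal (e 0) \<longrightarrow>
      (\<forall>\<beta>. ordinal \<beta> \<longrightarrow> e 0 \<in> elts \<beta> \<or> e 0 = \<beta> \<or> \<beta> \<in> elts (e 0)))"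
      by (intro definable_ordinal definable_intros)
  next
    fix \<alpha>
    assume IH: "\<And>\<gamma>. \<gamma> \<in> elts \<alpha> \<Longrightarrow> ordinal \<gamma> \<longrightarrow>
      (\<forall>\<beta>. ordinal \<beta> \<longrightarrow> \<gamma> \<in> elts \<beta> \<or> \<gamma> = \<beta> \<or> \<beta> \<in> elts \<gamma>)"
    show "ordinal \<alpha> \<longrightarrow> (\<forall>\<beta>. ordinal \<beta> \<longrightarrow> \<alpha> \<in> elts \<beta> \<or> \<alpha> = \<beta> \<or> \<beta> \<in> elts \<alpha>)"
    proof (intro impI allI)
      fix \<beta>
      assume \<alpha>: "ordinal \<alpha>" and \<beta>: "ordinal \<beta>"
      have "ordinal \<beta> \<longrightarrow> \<alpha> \<in> elts \<beta> \<or> \<alpha> = \<beta> \<or> \<beta> \<in> elts \<alpha>"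
      proof (rule mem_induct[where P = "\<lambda>\<beta>. ordinal \<beta> \<longrightarrow> \<alpha> \<in> elts \<beta> \<or> \<alpha> = \<beta> \<or> \<beta> \<in> elts \<alpha>"])
        show "definable (\<lambda>e. ordinal (e 0) \<longrightarrow> \<alpha> \<in> elts (e 0) \<or> \<alpha> = e 0 \<or> e 0 \<in> elts \<alpha>)"
          by (intro definable_ordinal definable_intros)
      next
        fix \<beta>
        assume IH': "\<And>\<delta>. \<delta> \<in> elts \<beta> \<Longrightarrow> ordinal \<delta> \<longrightarrow> \<alpha> \<in> elts \<delta> \<or> \<alpha> = \<delta> \<or> \<delta> \<in> elts \<alpha>"
        show "ordinal \<beta> \<longrightarrow> \<alpha> \<in> elts \<beta> \<or> \<alpha> = \<beta> \<or> \<beta> \<in> elts \<alpha>"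
        proof (intro impI, rule ccontr)
          assume \<beta>: "ordinal \<beta>" and no: "\<not> (\<alpha> \<in> elts \<beta> \<or> \<alpha> = \<beta> \<or> \<beta> \<in> elts \<alpha>)"
          have "\<gamma> \<in> elts \<beta>" if "\<gamma> \<in> elts \<alpha>" for \<gamma>
            using IH[OF that] ordinal_mem[OF \<alpha> that] \<beta> ordinal_trans[OF \<alpha> that] no that by blast
          moreover have "\<delta> \<in> elts \<alpha>" if "\<delta> \<in> elts \<beta>" for \<delta>
            using IH'[OF that] ordinal_mem[OF \<beta> that] ordinal_trans[OF \<beta> that] no that by blast
          ultimately have "elts \<alpha> = elts \<beta>" by blast
          then show False using no extensionality by blast
        qed
      qed
      then show "\<alpha> \<in> elts \<beta> \<or> \<alpha> = \<beta> \<or> \<beta> \<in> elts \<alpha>" using \<beta> by blast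
    qed
  qed
  then show ?thesis using assms by blast
qed

lemma burali_forti: "\<not> small {\<alpha>. ordinal \<alpha>}"
proof
  assume "small {\<alpha>. ordinal \<alpha>}"
  then obtain z where z: "elts z = {\<alpha>. ordinal \<alpha>}" unfolding small_def by blast
  have "ordinal z"
    unfolding ordinal_def transitive_def z
    using ordinal_mem unfolding ordinal_def transitive_def by blast
  then show False using z not_mem_self by blast
qed

text \<open>Were \<open>G\<close> injective on ordinals, replacement along its inverse would turn a
  subset of \<open>q\<close> into the set of all ordinals.\<close>

lemma ordinal_pigeonhole:
  assumes G: "definable_fn (\<lambda>e. G (e 0))" and Q: "\<And>\<alpha>. G \<alpha> \<in> elts q"
  shows "\<exists>\<alpha> \<beta>. ordinal \<alpha> \<and> ordinal \<beta> \<and> \<alpha> \<in> elts \<beta> \<and> G \<alpha> = G \<beta>"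
proof (rule ccontr)
  assume no: "\<nexists>\<alpha> \<beta>. ordinal \<alpha> \<and> ordinal \<beta> \<and> \<alpha> \<in> elts \<beta> \<and> G \<alpha> = G \<beta>"
  have "small {\<alpha>. \<exists>g\<in>elts q. ordinal \<alpha> \<and> g = G \<alpha>}"
  proof (rule small_replacement[where P = "\<lambda>g \<alpha>. ordinal \<alpha> \<and> g = G \<alpha>"])
    show "definable (\<lambda>e. ordinal (e 1) \<and> e 0 = G (e 1))"
      by (intro definable_conj definable_ordinal definable_fn_var)
        (use G[unfolded definable_fn_def] in simp)
    show "\<alpha> = \<beta>" if "ordinal \<alpha> \<and> g = G \<alpha>" "ordinal \<beta> \<and> g = G \<beta>" for g \<alpha> \<beta>
      using no that ordinal_linear by metis
  qed
  moreover have "{\<alpha>. \<exists>g\<in>elts q. ordinal \<alpha> \<and> g = G \<alpha>} = {\<alpha>. ordinal \<alpha>}" using Q by blast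
  ultimately show False using burali_forti by simp
qed

text \<open>The hereditary name \<open>hat p x\<close> of a set \<open>x\<close> of the ground model, where \<open>p\<close> is the set
  of stacks.\<close>

definition hat_attempt :: "'a \<Rightarrow> 'a \<Rightarrow> bool" where
  "hat_attempt p g \<longleftrightarrow> (\<forall>x z. opair x z \<in>\<^sub>M g \<longrightarrow>
     (\<forall>y\<in>elts x. \<exists>w. opair y w \<in>\<^sub>M g) \<and>
     (\<forall>q. q \<in> elts z \<longleftrightarrow> (\<exists>y\<in>elts x. \<exists>w. opair y w \<in>\<^sub>M g \<and> (\<exists>\<pi>\<in>elts p. q = opair w \<pi>))))"

definition is_hat :: "'a \<Rightarrow> 'a \<Rightarrow> 'a \<Rightarrow> bool" where
  "is_hat p x z \<longleftrightarrow> (\<exists>g. hat_attempt p g \<and> opair x z \<in>\<^sub>M g)"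

definition hat :: "'a \<Rightarrow> 'a \<Rightarrow> 'a" where
  "hat p x = (THE z. is_hat p x z)"

lemma definable_is_hat:
  "definable_fn s \<Longrightarrow> definable_fn t \<Longrightarrow> definable (\<lambda>e. is_hat p (s e) (t e))"
proof (rule definable_app2[where P = "is_hat p"])
  show "definable (\<lambda>e. is_hat p (e 0) (e 1))"
    unfolding is_hat_def hat_attempt_def
    by (intro definable_intros definable_fn_opair)
qed

lemma is_hat_pred: "is_hat p x z \<Longrightarrow> y \<in> elts x \<Longrightarrow> \<exists>w. is_hat p y w"
  unfolding is_hat_def hat_attempt_def by blast

text \<open>Two attempts agree on the elements of \<open>x\<close> by induction, and the recursion
  clause then determines the value at \<open>x\<close>.\<close>

lemma is_hat_unique: "is_hat p x z \<Longrightarrow> is_hat p x z' \<Longrightarrow> z = z'"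
proof -
  have "\<forall>z z'. is_hat p x z \<longrightarrow> is_hat p x z' \<longrightarrow> z = z'"
  proof (rule mem_induct[where P = "\<lambda>x. \<forall>z z'. is_hat p x z \<longrightarrow> is_hat p x z' \<longrightarrow> z = z'"])
    show "definable (\<lambda>e. \<forall>z z'. is_hat p (e 0) z \<longrightarrow> is_hat p (e 0) z' \<longrightarrow> z = z')"
      by (intro definable_intros definable_is_hat)
  next
    fix x
    assume IH: "\<And>y. y \<in> elts x \<Longrightarrow> \<forall>z z'. is_hat p y z \<longrightarrow> is_hat p y z' \<longrightarrow> z = z'"
    have le: "elts z \<subseteq> elts z'"
      if g: "hat_attempt p g" "opair x z \<in>\<^sub>M g" and g': "hat_attempt p g'" "opair x z' \<in>\<^sub>M g'"
      for z z' g g'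
    proof
      fix q
      assume "q \<in> elts z"
      then obtain y w \<pi> where y: "y \<in> elts x" and w: "opair y w \<in>\<^sub>M g"
        and \<pi>: "\<pi> \<in> elts p" "q = opair w \<pi>"
        using g unfolding hat_attempt_def by blast
      obtain w' where w': "opair y w' \<in>\<^sub>M g'" using g' y unfolding hat_attempt_def by blast
      have "w = w'" using IH[OF y] g(1) g'(1) w w' unfolding is_hat_def by blast
      then show "q \<in> elts z'" using g' y w' \<pi> unfolding hat_attempt_def by blast
    qed
    show "\<forall>z z'. is_hat p x z \<longrightarrow> is_hat p x z' \<longrightarrow> z = z'"
    proof (intro allI impI)
      fix z z'
      assume "is_hat p x z" "is_hat p x z'"
      then obtain g g' where "hat_attempt p g" "opair x z \<in>\<^sub>M g"
        "hat_attempt p g'" "opair x z' \<in>\<^sub>M g'" unfolding is_hat_def by blast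
      then have "elts z = elts z'" using le by (intro equalityI) blast+
      then show "z = z'" by (rule extensionality)
    qed
  qed
  then show "is_hat p x z \<Longrightarrow> is_hat p x z' \<Longrightarrow> z = z'" by blast
qed

lemma is_hat_elts:
  assumes "is_hat p x z"
  shows "q \<in> elts z \<longleftrightarrow> (\<exists>y\<in>elts x. \<exists>w. is_hat p y w \<and> (\<exists>\<pi>\<in>elts p. q = opair w \<pi>))"
proof -
  obtain g where g: "hat_attempt p g" "opair x z \<in>\<^sub>M g" using assms unfolding is_hat_def by blast
  have step: "\<forall>y\<in>elts x. \<exists>w. opair y w \<in>\<^sub>M g" "q \<in> elts z \<longleftrightarrow>
      (\<exists>y\<in>elts x. \<exists>w. opair y w \<in>\<^sub>M g \<and> (\<exists>\<pi>\<in>elts p. q = opair w \<pi>))"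
    using g unfolding hat_attempt_def by simp_all
  have "is_hat p y w \<longleftrightarrow> opair y w \<in>\<^sub>M g" if y: "y \<in> elts x" for y w
  proof
    assume "is_hat p y w"
    moreover obtain w' where w': "opair y w' \<in>\<^sub>M g" using step(1) y by blast
    moreover have "is_hat p y w'" using g(1) w' unfolding is_hat_def by blast
    ultimately show "opair y w \<in>\<^sub>M g" using is_hat_unique by blast
  qed (use g(1) in \<open>unfold is_hat_def, blast\<close>)
  then show ?thesis using step(2) by simp
qed

text \<open>Within a transitive set, the names that already exist are collected into one attempt
  \<open>H\<close>, which is then extended by a single pair for \<open>x\<close>.\<close>

lemma is_hat_ex: "\<exists>z. is_hat p x z"
proof -
  obtain T where T: "transitive T" "x \<in> elts T" using transitive_cover by blast
  define T0 where "T0 = {y \<in> elts T. \<exists>z. is_hat p y z}"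
  have "small T0" unfolding T0_def
    by (rule small_separation) (intro definable_intros definable_is_hat)
  then have T0: "elts (mk T0) = T0" by simp
  have "small {q. \<exists>y\<in>elts (mk T0). \<exists>z. is_hat p y z \<and> q = opair y z}"
  proof (rule small_replacement[where P = "\<lambda>y q. \<exists>z. is_hat p y z \<and> q = opair y z"])
    show "definable (\<lambda>e. \<exists>z. is_hat p (e 0) z \<and> e 1 = opair (e 0) z)"
      by (intro definable_intros definable_is_hat definable_fn_opair)
  qed (use is_hat_unique in blast)
  then obtain H where H: "elts H = {q. \<exists>y\<in>T0. \<exists>z. is_hat p y z \<and> q = opair y z}"
    unfolding small_def T0 by blast
  have "x \<in> elts T \<longrightarrow> (\<exists>z. is_hat p x z)"
  proof (rule mem_induct[where P = "\<lambda>x. x \<in> elts T \<longrightarrow> (\<exists>z. is_hat p x z)"])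
    show "definable (\<lambda>e. e 0 \<in> elts T \<longrightarrow> (\<exists>z. is_hat p (e 0) z))"
      by (intro definable_intros definable_is_hat)
  next
    fix x
    assume IH: "\<And>y. y \<in> elts x \<Longrightarrow> y \<in> elts T \<longrightarrow> (\<exists>z. is_hat p y z)"
    show "x \<in> elts T \<longrightarrow> (\<exists>z. is_hat p x z)"
    proof (intro impI, rule ccontr)
      assume x: "x \<in> elts T" and no: "\<nexists>z. is_hat p x z"
      have sub: "elts x \<subseteq> T0" using IH x T(1) unfolding T0_def transitive_def by blast
      \<comment> \<open>This is the use of arguing by contradiction: \<open>x\<close> has no entry
        in \<open>H\<close>, so the added pair cannot give a second value to an argument in
        \<open>T0\<close>.\<close>
      have "x \<notin> T0" using no unfolding T0_def by blast
      \<comment> \<open>The name of \<open>x\<close> is the image of the product of \<open>x\<close>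
        and \<open>p\<close> when first components are replaced by their names.\<close>
      have "small {q. \<exists>q'\<in>elts (cartesian x p). \<exists>y \<pi> w. is_hat p y w \<and> q' = opair y \<pi> \<and> q = opair w \<pi>}"
      proof (rule small_replacement[where
            P = "\<lambda>q' q. \<exists>y \<pi> w. is_hat p y w \<and> q' = opair y \<pi> \<and> q = opair w \<pi>"])
        show "definable (\<lambda>e. \<exists>y \<pi> w. is_hat p y w \<and> e 0 = opair y \<pi> \<and> e 1 = opair w \<pi>)"
          by (intro definable_intros definable_is_hat definable_fn_opair)
      qed (use is_hat_unique in auto)
      moreover have "{q. \<exists>q'\<in>elts (cartesian x p). \<exists>y \<pi> w. is_hat p y w \<and> q' = opair y \<pi> \<and> q = opair w \<pi>}
          = {q. \<exists>y\<in>elts x. \<exists>w. is_hat p y w \<and> (\<exists>\<pi>\<in>elts p. q = opair w \<pi>)}"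
        by (auto simp: elts_iff) blast
      ultimately obtain z where
        z: "elts z = {q. \<exists>y\<in>elts x. \<exists>w. is_hat p y w \<and> (\<exists>\<pi>\<in>elts p. q = opair w \<pi>)}"
        unfolding small_def by auto
      define g where "g = mk (insert (opair x z) (elts H))"
      have gE: "elts g = insert (opair x z) (elts H)" unfolding g_def by (rule elts_mk) simp
      have g: "opair y w \<in>\<^sub>M g \<longleftrightarrow> y \<in> T0 \<and> is_hat p y w \<or> y = x \<and> w = z" for y w
        using elts_iff[of "opair y w" g] unfolding gE H by auto
      have "hat_attempt p g"
        unfolding hat_attempt_def
      proof (intro allI impI)
        fix y w
        assume yw: "opair y w \<in>\<^sub>M g"
        have 1: "elts y \<subseteq> T0"
          using yw sub T(1) is_hat_pred unfolding g T0_def transitive_def by blast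
        then have "\<exists>v. opair u v \<in>\<^sub>M g" if "u \<in> elts y" for u
          using that unfolding g T0_def by blast
        moreover have "q \<in> elts w \<longleftrightarrow>
            (\<exists>u\<in>elts y. \<exists>v. is_hat p u v \<and> (\<exists>\<pi>\<in>elts p. q = opair v \<pi>))" for q
          using yw is_hat_elts z unfolding g by blast
        moreover have "opair u v \<in>\<^sub>M g \<longleftrightarrow> is_hat p u v" if "u \<in> elts y" for u v
          using 1 that \<open>x \<notin> T0\<close> unfolding g by blast
        ultimately show "(\<forall>u\<in>elts y. \<exists>v. opair u v \<in>\<^sub>M g) \<and>
          (\<forall>q. q \<in> elts w \<longleftrightarrow> (\<exists>u\<in>elts y. \<exists>v. opair u v \<in>\<^sub>M g \<and> (\<exists>\<pi>\<in>elts p. q = opair v \<pi>)))"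
          by blast
      qed
      then have "is_hat p x z" unfolding is_hat_def using g by blast
      then show False using no by blast
    qed
  qed
  then show ?thesis using T(2) by blast
qed

lemma hat_eq_iff: "z = hat p x \<longleftrightarrow> is_hat p x z"
  unfolding hat_def using is_hat_ex[of p x] is_hat_unique[of p x] theI[of "is_hat p x"] by metis

lemma definable_fn_hat: "definable_fn t \<Longrightarrow> definable_fn (\<lambda>e. hat p (t e))"
proof (rule definable_fn_app1[where g = "hat p"])
  show "definable (\<lambda>e. e 0 = hat p (e 1))"
    unfolding hat_eq_iff by (intro definable_is_hat definable_fn_var)
qed

lemma opair_mem_hat: "opair c \<pi> \<in>\<^sub>M hat p x \<longleftrightarrow> (\<exists>y\<in>elts x. c = hat p y) \<and> \<pi> \<in>\<^sub>M p"
proof -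
  have "is_hat p x (hat p x)" using hat_eq_iff by blast
  from is_hat_elts[OF this, of "opair c \<pi>"] show ?thesis
    by (auto simp: elts_iff hat_eq_iff)
qed

end

section \<open>Truth values of atomic formulas\<close>

context realizability_algebra
begin

lemma app_in_terms [simp]: "\<xi> \<in>\<^sub>M terms A \<Longrightarrow> \<eta> \<in>\<^sub>M terms A \<Longrightarrow> \<xi> \<cdot> \<eta> \<in>\<^sub>M terms A"
  unfolding app_def by (rule maps_ap[OF app_maps]) simp

lemma push_in_stacks [simp]: "\<xi> \<in>\<^sub>M terms A \<Longrightarrow> \<pi> \<in>\<^sub>M stacks A \<Longrightarrow> \<xi> \<triangleright> \<pi> \<in>\<^sub>M stacks A"
  unfolding push_def by (rule maps_ap[OF push_maps]) simp

lemma cont_in_terms [simp]: "\<pi> \<in>\<^sub>M stacks A \<Longrightarrow> cont \<pi> \<in>\<^sub>M terms A"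
  unfolding cont_def by (rule maps_ap[OF cont_maps])

lemma prooflike_in_terms: "\<theta> \<in>\<^sub>M prooflike A \<Longrightarrow> \<theta> \<in>\<^sub>M terms A"
  using prooflike_subset unfolding elts_def by blast

lemma combinators_prooflike [simp]:
  "cB A \<in>\<^sub>M prooflike A" "cC A \<in>\<^sub>M prooflike A" "cI A \<in>\<^sub>M prooflike A"
  "cK A \<in>\<^sub>M prooflike A" "cW A \<in>\<^sub>M prooflike A" "cc A \<in>\<^sub>M prooflike A"
  using prooflike_combinators unfolding elts_def by auto

lemma combinators_in_terms [simp]:
  "cB A \<in>\<^sub>M terms A" "cC A \<in>\<^sub>M terms A" "cI A \<in>\<^sub>M terms A"
  "cK A \<in>\<^sub>M terms A" "cW A \<in>\<^sub>M terms A" "cc A \<in>\<^sub>M terms A"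
  by (simp_all add: prooflike_in_terms)

lemma definable_fn_push:
  "definable_fn s \<Longrightarrow> definable_fn t \<Longrightarrow> definable_fn (\<lambda>e. s e \<triangleright> t e)"
  unfolding push_def by (intro definable_fn_ap[OF push_maps] definable_fn_opair)

lemma definable_fn_app:
  "definable_fn s \<Longrightarrow> definable_fn t \<Longrightarrow> definable_fn (\<lambda>e. s e \<cdot> t e)"
  unfolding app_def by (intro definable_fn_ap[OF app_maps] definable_fn_opair)

lemma definable_fn_star:
  "definable_fn s \<Longrightarrow> definable_fn t \<Longrightarrow> definable_fn (\<lambda>e. s e \<star> t e)"
  unfolding star_def by (intro definable_fn_ap[OF star_maps] definable_fn_opair)

lemmas definable_algebra_intros =
  definable_intros definable_fn_opair definable_fn_push definable_fn_app definable_fn_star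

lemma definable_realizes_set:
  assumes "definable (\<lambda>e. e 0 \<in> X (tl_env e))" "definable_fn t"
  shows "definable (\<lambda>e. realizes_set (t e) (X e))"
  unfolding realizes_set_def Ball_def
  by (intro definable_algebra_intros assms definable_fn_rename[OF assms(2)])

lemma definable_fragment:
  assumes "definable_fn s" "definable_fn t" "definable_fn u"
  shows "definable (\<lambda>e. fragment (s e) (t e) (u e))"
proof (rule definable_app3[where P = fragment, OF _ assms])
  show "definable (\<lambda>e. fragment (e 0) (e 1) (e 2))"
    unfolding fragment_def section_at_def realizes_set_def set_eq_iff mem_Collect_eq Ball_def
    by (intro definable_transitive definable_algebra_intros)
qed

lemma definable_truth_Subset:
  "definable_fn p \<Longrightarrow> definable_fn s \<Longrightarrow> definable_fn t \<Longrightarrow>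
    definable (\<lambda>e. p e \<in> truth (Subset (s e) (t e)))"
proof (rule definable_app3[where P = "\<lambda>p s t. p \<in> truth (Subset s t)"])
  show "definable (\<lambda>e. e 0 \<in> truth (Subset (e 1) (e 2)))"
    unfolding truth.simps section_at_def mem_Collect_eq
    by (intro definable_fragment definable_algebra_intros)
qed

lemma definable_truth_NotIn:
  "definable_fn p \<Longrightarrow> definable_fn s \<Longrightarrow> definable_fn t \<Longrightarrow>
    definable (\<lambda>e. p e \<in> truth (NotIn (s e) (t e)))"
proof (rule definable_app3[where P = "\<lambda>p s t. p \<in> truth (NotIn s t)"])
  show "definable (\<lambda>e. e 0 \<in> truth (NotIn (e 1) (e 2)))"
    unfolding truth.simps section_at_def mem_Collect_eq
    by (intro definable_fragment definable_algebra_intros)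
qed

section \<open>Uniqueness and existence of fragments\<close>

lemma fragment_Subset:
  assumes "fragment T S N" "a \<in> elts T" "b \<in> elts T"
  shows "section_at S a b = {\<xi> \<triangleright> \<pi> | c \<xi> \<pi>. opair c \<pi> \<in>\<^sub>M a \<and> \<pi> \<in>\<^sub>M stacks A \<and>
             realizes_set \<xi> (section_at N c b)}"
  using assms unfolding fragment_def by blast

lemma fragment_NotIn:
  assumes "fragment T S N" "a \<in> elts T" "b \<in> elts T"
  shows "section_at N a b = {\<xi> \<triangleright> \<xi>' \<triangleright> \<pi> | c \<xi> \<xi>' \<pi>. opair c \<pi> \<in>\<^sub>M b \<and> \<pi> \<in>\<^sub>M stacks A \<and>
             realizes_set \<xi> (section_at S a c) \<and> realizes_set \<xi>' (section_at S c a)}"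
  using assms unfolding fragment_def by blast

text \<open>The value of \<open>S\<close> at (a, b) calls \<open>N\<close> at (c, b) with
  \<open>c\<close> occurring in \<open>a\<close>, and this calls \<open>S\<close> at (c, d) and (d,
  c) with \<open>d\<close> occurring in \<open>b\<close>. So induction on \<open>a\<close> alone
  works once both orders of the arguments are treated together and \<open>b\<close> is
  arbitrary.\<close>

lemma fragment_unique:
  assumes f: "fragment T S N" and f': "fragment T' S' N'"
    and a: "a \<in> elts T" "a \<in> elts T'" and b: "b \<in> elts T" "b \<in> elts T'"
  shows "section_at S a b = section_at S' a b" "section_at N a b = section_at N' a b"
proof -
  have T: "transitive T" "transitive T'" using f f' unfolding fragment_def by blast+
  note tr = T[THEN transitive_opair_mem]
  have "\<forall>b. a \<in> elts T \<and> a \<in> elts T' \<and> b \<in> elts T \<and> b \<in> elts T' \<longrightarrow>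
    section_at S a b = section_at S' a b \<and> section_at S b a = section_at S' b a" for a
  proof (rule name_induct[where P = "\<lambda>a. \<forall>b. a \<in> elts T \<and> a \<in> elts T' \<and> b \<in> elts T \<and> b \<in> elts T' \<longrightarrow>
    section_at S a b = section_at S' a b \<and> section_at S b a = section_at S' b a"])
    show "definable (\<lambda>e. \<forall>b. e 0 \<in> elts T \<and> e 0 \<in> elts T' \<and> b \<in> elts T \<and> b \<in> elts T' \<longrightarrow>
      section_at S (e 0) b = section_at S' (e 0) b \<and> section_at S b (e 0) = section_at S' b (e 0))"
      unfolding section_at_def set_eq_iff mem_Collect_eq by (intro definable_algebra_intros)
  next
    fix a
    assume IH: "\<And>c p. opair c p \<in>\<^sub>M a \<Longrightarrow>
      \<forall>b. c \<in> elts T \<and> c \<in> elts T' \<and> b \<in> elts T \<and> b \<in> elts T' \<longrightarrow>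
      section_at S c b = section_at S' c b \<and> section_at S b c = section_at S' b c"
    show "\<forall>b. a \<in> elts T \<and> a \<in> elts T' \<and> b \<in> elts T \<and> b \<in> elts T' \<longrightarrow>
      section_at S a b = section_at S' a b \<and> section_at S b a = section_at S' b a"
    proof (intro allI impI, elim conjE)
      fix b
      assume a: "a \<in> elts T" "a \<in> elts T'" and b: "b \<in> elts T" "b \<in> elts T'"
      have "section_at N c b = section_at N' c b" if c: "opair c \<pi> \<in>\<^sub>M a" for c \<pi>
      proof -
        have cT: "c \<in> elts T" "c \<in> elts T'" using tr(1)[OF a(1) c] tr(2)[OF a(2) c] .
        have "section_at S c d = section_at S' c d \<and> section_at S d c = section_at S' d c"
          if "opair d \<rho> \<in>\<^sub>M b" for d \<rho>
          using IH[OF c] cT tr(1)[OF b(1) that] tr(2)[OF b(2) that] by blast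
        then show ?thesis
          unfolding fragment_NotIn[OF f cT(1) b(1)] fragment_NotIn[OF f' cT(2) b(2)]
          by (intro Collect_cong ex_cong1 conj_cong refl) simp_all
      qed
      then have 1: "section_at S a b = section_at S' a b"
        unfolding fragment_Subset[OF f a(1) b(1)] fragment_Subset[OF f' a(2) b(2)]
        by (intro Collect_cong ex_cong1 conj_cong refl) simp
      have "section_at N d a = section_at N' d a" if d: "opair d \<rho> \<in>\<^sub>M b" for d \<rho>
      proof -
        have dT: "d \<in> elts T" "d \<in> elts T'" using tr(1)[OF b(1) d] tr(2)[OF b(2) d] .
        have "section_at S c d = section_at S' c d \<and> section_at S d c = section_at S' d c"
          if "opair c \<pi> \<in>\<^sub>M a" for c \<pi>
          using IH[OF that] dT tr(1)[OF a(1) that] tr(2)[OF a(2) that] by blast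
        then show ?thesis
          unfolding fragment_NotIn[OF f dT(1) a(1)] fragment_NotIn[OF f' dT(2) a(2)]
          by (intro Collect_cong ex_cong1 conj_cong refl) simp_all
      qed
      then have "section_at S b a = section_at S' b a"
        unfolding fragment_Subset[OF f b(1) a(1)] fragment_Subset[OF f' b(2) a(2)]
        by (intro Collect_cong ex_cong1 conj_cong refl) simp
      with 1 show "section_at S a b = section_at S' a b \<and> section_at S b a = section_at S' b a" ..
    qed
  qed
  then have S: "section_at S a b = section_at S' a b" "section_at S b a = section_at S' b a"
    if "a \<in> elts T" "a \<in> elts T'" "b \<in> elts T" "b \<in> elts T'" for a b
    using that by blast+
  show "section_at S a b = section_at S' a b" using S a b by blast
  have "section_at S a c = section_at S' a c \<and> section_at S c a = section_at S' c a"
    if "opair c \<pi> \<in>\<^sub>M b" for c \<pi>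
    using S a tr(1)[OF b(1) that] tr(2)[OF b(2) that] by blast
  then show "section_at N a b = section_at N' a b"
    unfolding fragment_NotIn[OF f a(1) b(1)] fragment_NotIn[OF f' a(2) b(2)]
    by (intro Collect_cong ex_cong1 conj_cong refl) simp_all
qed

text \<open>Eliminating \<open>N\<close> from the recursion for \<open>(S, N)\<close> leaves a monotone operator in \<open>S\<close>,
  since \<open>S\<close> occurs under two reversals of inclusion; so inside the ground model a fragment is a
  least fixed point, and no transfinite recursion is needed to find it.\<close>

definition notin_step :: "'m \<Rightarrow> 'm \<Rightarrow> 'm \<Rightarrow> 'm set" where
  "notin_step S a b = {\<xi> \<triangleright> \<xi>' \<triangleright> \<pi> | c \<xi> \<xi>' \<pi>. opair c \<pi> \<in>\<^sub>M b \<and> \<pi> \<in>\<^sub>M stacks A \<and>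
     realizes_set \<xi> (section_at S a c) \<and> realizes_set \<xi>' (section_at S c a)}"

definition subset_step :: "'m \<Rightarrow> 'm \<Rightarrow> 'm \<Rightarrow> 'm set" where
  "subset_step S a b = {\<xi> \<triangleright> \<pi> | c \<xi> \<pi>. opair c \<pi> \<in>\<^sub>M a \<and> \<pi> \<in>\<^sub>M stacks A \<and>
     realizes_set \<xi> (notin_step S c b)}"

lemma realizes_set_antimono: "X \<subseteq> Y \<Longrightarrow> realizes_set \<xi> Y \<Longrightarrow> realizes_set \<xi> X"
  unfolding realizes_set_def by blast

lemma subset_step_mono:
  assumes "elts S \<subseteq> elts S'"
  shows "subset_step S a b \<subseteq> subset_step S' a b"
proof -
  have "section_at S x y \<subseteq> section_at S' x y" for x y
    using assms unfolding section_at_def elts_def by blast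
  then have "realizes_set \<xi> (section_at S' x y) \<Longrightarrow> realizes_set \<xi> (section_at S x y)" for \<xi> x y
    by (rule realizes_set_antimono)
  then have "notin_step S' c b \<subseteq> notin_step S c b" for c
    unfolding notin_step_def by blast
  then have "realizes_set \<xi> (notin_step S c b) \<Longrightarrow> realizes_set \<xi> (notin_step S' c b)" for \<xi> c
    by (rule realizes_set_antimono)
  then show ?thesis unfolding subset_step_def by blast
qed

lemma realizes_set_terms: "realizes_set \<xi> X \<Longrightarrow> \<xi> \<in>\<^sub>M terms A"
  unfolding realizes_set_def by blast

lemma step_stacks:
  "\<rho> \<in> notin_step S a b \<Longrightarrow> \<rho> \<in>\<^sub>M stacks A" "\<rho> \<in> subset_step S a b \<Longrightarrow> \<rho> \<in>\<^sub>M stacks A"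
  unfolding notin_step_def subset_step_def by (auto dest!: realizes_set_terms)

lemma fragment_exists:
  assumes T: "transitive T"
  shows "\<exists>S N. fragment T S N"
proof -
  define X where "X = cartesian (cartesian T T) (stacks A)"
  define closed where "closed Z \<longleftrightarrow> (\<forall>a\<in>elts T. \<forall>b\<in>elts T. \<forall>\<rho>. \<rho> \<in> subset_step Z a b \<longrightarrow>
    opair (opair a b) \<rho> \<in>\<^sub>M Z)" for Z
  note step_defs = subset_step_def notin_step_def section_at_def realizes_set_def mem_Collect_eq Ball_def
  have "small {p \<in> elts X. \<forall>Z. closed Z \<longrightarrow> p \<in>\<^sub>M Z}"
    by (rule small_separation, unfold closed_def step_defs) (intro definable_algebra_intros)
  \<comment> \<open>The least fixed point as the intersection of all prefixed points;
    \<open>X\<close> only serves to bound it by a set.\<close>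
  then obtain S where S: "elts S = {p \<in> elts X. \<forall>Z. closed Z \<longrightarrow> p \<in>\<^sub>M Z}"
    unfolding small_def by blast
  have S_closed: "opair (opair a b) \<rho> \<in>\<^sub>M S"
    if "a \<in> elts T" "b \<in> elts T" "\<rho> \<in> subset_step S a b" for a b \<rho>
  proof -
    have "opair (opair a b) \<rho> \<in>\<^sub>M Z" if "closed Z" for Z
    proof -
      have "elts S \<subseteq> elts Z" using S that unfolding elts_def by blast
      then have "\<rho> \<in> subset_step Z a b" using subset_step_mono \<open>\<rho> \<in> subset_step S a b\<close> by blast
      then show ?thesis using that \<open>a \<in> elts T\<close> \<open>b \<in> elts T\<close> unfolding closed_def by blast
    qed
    moreover have "opair (opair a b) \<rho> \<in> elts X"
      using that step_stacks unfolding X_def by (simp add: elts_iff)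
    ultimately have "opair (opair a b) \<rho> \<in> elts S" unfolding S by blast
    then show ?thesis by (simp add: elts_iff)
  qed
  have S_step: "\<rho> \<in> subset_step S a b"
    if "opair (opair a b) \<rho> \<in>\<^sub>M S" for a b \<rho>
  proof -
    \<comment> \<open>The second half of the Knaster-Tarski argument: the part of \<open>S\<close>
      produced by one step from \<open>S\<close> is again closed, so by minimality it is all of
      \<open>S\<close>.\<close>
    have "small {p \<in> elts S. \<forall>a b \<rho>. p = opair (opair a b) \<rho> \<longrightarrow> \<rho> \<in> subset_step S a b}"
      by (rule small_separation, unfold step_defs) (intro definable_algebra_intros)
    then obtain S' where
      S': "elts S' = {p \<in> elts S. \<forall>a b \<rho>. p = opair (opair a b) \<rho> \<longrightarrow> \<rho> \<in> subset_step S a b}"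
      unfolding small_def by blast
    have "closed S'" unfolding closed_def
    proof (intro ballI allI impI)
      fix a b \<rho>
      assume ab: "a \<in> elts T" "b \<in> elts T" and "\<rho> \<in> subset_step S' a b"
      then have \<rho>: "\<rho> \<in> subset_step S a b" using subset_step_mono[of S' S a b] S' by blast
      then have "opair (opair a b) \<rho> \<in> elts S" using S_closed[OF ab] by (simp add: elts_iff)
      then have "opair (opair a b) \<rho> \<in> elts S'" using \<rho> unfolding S' by simp
      then show "opair (opair a b) \<rho> \<in>\<^sub>M S'" by (simp add: elts_iff)
    qed
    moreover have "opair (opair a b) \<rho> \<in> elts S" using that by (simp add: elts_iff)
    ultimately have "opair (opair a b) \<rho> \<in>\<^sub>M S'" unfolding S by blast
    then have "opair (opair a b) \<rho> \<in> elts S'" by (simp add: elts_iff)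
    then show ?thesis unfolding S' by blast
  qed
  have "small {p \<in> elts X. \<exists>a b \<rho>. p = opair (opair a b) \<rho> \<and> \<rho> \<in> notin_step S a b}"
    by (rule small_separation, unfold step_defs) (intro definable_algebra_intros)
  then obtain N where
    N: "elts N = {p \<in> elts X. \<exists>a b \<rho>. p = opair (opair a b) \<rho> \<and> \<rho> \<in> notin_step S a b}"
    unfolding small_def by blast
  have secN: "section_at N a b = notin_step S a b" if "a \<in> elts T" "b \<in> elts T" for a b
  proof -
    have "opair (opair a b) \<rho> \<in> elts N \<longleftrightarrow> \<rho> \<in> notin_step S a b" for \<rho>
      unfolding N X_def using that step_stacks(1)[of \<rho> S a b] by (auto simp: elts_iff)
    then show ?thesis unfolding section_at_def by (simp add: elts_iff)
  qed
  have secS: "section_at S a b = {\<xi> \<triangleright> \<pi> | c \<xi> \<pi>. opair c \<pi> \<in>\<^sub>M a \<and> \<pi> \<in>\<^sub>M stacks A \<and>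
      realizes_set \<xi> (section_at N c b)}" if ab: "a \<in> elts T" "b \<in> elts T" for a b
  proof -
    have "section_at S a b = subset_step S a b"
      using S_closed[OF ab] S_step unfolding section_at_def by blast
    also have "\<dots> = {\<xi> \<triangleright> \<pi> | c \<xi> \<pi>. opair c \<pi> \<in>\<^sub>M a \<and> \<pi> \<in>\<^sub>M stacks A \<and>
      realizes_set \<xi> (section_at N c b)}"
      unfolding subset_step_def
      using secN[OF transitive_opair_mem[OF T ab(1)] ab(2)]
      by (intro Collect_cong ex_cong1 conj_cong refl) simp
    finally show ?thesis .
  qed
  have "fragment T S N"
    unfolding fragment_def using T secS secN[unfolded notin_step_def] by simp
  then show ?thesis by blast
qed

text \<open>\<open>truth\<close> takes the union over all fragments, but these agree wherever they
  are defined, so any single one gives the value.\<close>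

lemma truth_fragment:
  assumes "fragment T S N" "a \<in> elts T" "b \<in> elts T"
  shows "truth (Subset a b) = section_at S a b" "truth (NotIn a b) = section_at N a b"
proof -
  have T: "a \<in>\<^sub>M T" "b \<in>\<^sub>M T" using assms by (simp_all add: elts_iff)
  show "truth (Subset a b) = section_at S a b" "truth (NotIn a b) = section_at N a b"
    using assms(1) T fragment_unique[OF assms(1) _ assms(2) _ assms(3)] elts_iff
    unfolding truth.simps by blast+
qed

lemma
  shows truth_Subset: "truth (Subset a b) = {\<xi> \<triangleright> \<pi> | c \<xi> \<pi>. opair c \<pi> \<in>\<^sub>M a \<and> \<pi> \<in>\<^sub>M stacks A \<and>
      realizes_set \<xi> (truth (NotIn c b))}"
    and truth_NotIn: "truth (NotIn a b) = {\<xi> \<triangleright> \<xi>' \<triangleright> \<pi> | c \<xi> \<xi>' \<pi>. opair c \<pi> \<in>\<^sub>M b \<and>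
      \<pi> \<in>\<^sub>M stacks A \<and> realizes_set \<xi> (truth (Subset a c)) \<and> realizes_set \<xi>' (truth (Subset c a))}"
proof -
  \<comment> \<open>Covering the unordered pair provides one transitive set that contains both
    individuals.\<close>
  obtain T where T: "transitive T" "mk {a, b} \<in> elts T" using transitive_cover by blast
  then have ab: "a \<in> elts T" "b \<in> elts T" unfolding transitive_def by fastforce+
  obtain S N where f: "fragment T S N" using fragment_exists[OF T(1)] by blast
  note tr = transitive_opair_mem[OF T(1)]
  show "truth (Subset a b) = {\<xi> \<triangleright> \<pi> | c \<xi> \<pi>. opair c \<pi> \<in>\<^sub>M a \<and> \<pi> \<in>\<^sub>M stacks A \<and>
      realizes_set \<xi> (truth (NotIn c b))}"
    unfolding truth_fragment(1)[OF f ab] fragment_Subset[OF f ab]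
    using truth_fragment(2)[OF f tr[OF ab(1)] ab(2)]
    by (intro Collect_cong ex_cong1 conj_cong refl) simp
  show "truth (NotIn a b) = {\<xi> \<triangleright> \<xi>' \<triangleright> \<pi> | c \<xi> \<xi>' \<pi>. opair c \<pi> \<in>\<^sub>M b \<and>
      \<pi> \<in>\<^sub>M stacks A \<and> realizes_set \<xi> (truth (Subset a c)) \<and> realizes_set \<xi>' (truth (Subset c a))}"
    unfolding truth_fragment(2)[OF f ab] fragment_NotIn[OF f ab]
    using truth_fragment(1)[OF f tr[OF ab(2)] ab(1)] truth_fragment(1)[OF f ab(1) tr[OF ab(2)]]
    by (intro Collect_cong ex_cong1 conj_cong refl) simp_all
qed

lemma truth_stacks: "\<pi> \<in> truth F \<Longrightarrow> \<pi> \<in>\<^sub>M stacks A"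
proof (induction F arbitrary: \<pi>)
  case (Imp F G)
  then show ?case using realizes_set_terms by fastforce
next
  case (Subset a b)
  then show ?case unfolding truth_Subset using realizes_set_terms by fastforce
next
  case (NotIn a b)
  then show ?case unfolding truth_NotIn using realizes_set_terms push_in_stacks by blast
qed (auto simp: elts_iff)

text \<open>The recursion equations say that \<open>\<subset>\<close> and \<open>\<notin>\<close> have the same truth values as the
  right-hand sides of the extensionality axioms of \<open>ZF\<^sub>\<epsilon>\<close>.\<close>

lemma truth_Subset_unfold:
  "truth (Subset a b) = truth (\<^bold>\<forall>c. NotIn c b \<^bold>\<longrightarrow> NotEps c a)"
  by (subst truth_Subset) (auto simp del: truth.simps(3,4))

lemma truth_NotIn_unfold:
  "truth (NotIn a b) = truth (\<^bold>\<forall>c. Subset a c \<^bold>\<longrightarrow> Subset c a \<^bold>\<longrightarrow> NotEps c b)"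
  by (subst truth_NotIn) (simp del: truth.simps(3,4), blast)

end

section \<open>Realized formulas and completeness\<close>

text \<open>First-order formulas with de Bruijn indices. \<open>Atom k x y z\<close> is the \<open>k\<close>-th relation symbol;
  all symbols are ternary, so that a binary one ignores its last argument.\<close>

datatype fm = Fal | Atom nat nat nat nat | Impl fm fm | All fm

instance fm :: countable by countable_datatype

text \<open>Formulas of type \<open>zfe\<close> contain individuals and functionals over an
  arbitrary type and cannot be enumerated, as a Henkin construction over the natural numbers
  demands. The countable syntax \<open>fm\<close> can; \<open>itp\<close> reads it in the
  realizability model, \<open>sem\<close> in an ordinary structure.\<close>

primrec itp :: "(nat \<Rightarrow> 'm \<Rightarrow> 'm \<Rightarrow> 'm \<Rightarrow> 'm zfe) \<Rightarrow> (nat \<Rightarrow> 'm) \<Rightarrow> fm \<Rightarrow> 'm zfe" where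
  "itp J e Fal = Bot"
| "itp J e (Atom k x y z) = J k (e x) (e y) (e z)"
| "itp J e (Impl F G) = (itp J e F \<^bold>\<longrightarrow> itp J e G)"
| "itp J e (All F) = (\<^bold>\<forall>x. itp J (case_nat x e) F)"

primrec sem :: "(nat \<Rightarrow> 'u \<Rightarrow> 'u \<Rightarrow> 'u \<Rightarrow> bool) \<Rightarrow> (nat \<Rightarrow> 'u) \<Rightarrow> fm \<Rightarrow> bool" where
  "sem R e Fal = False"
| "sem R e (Atom k x y z) = R k (e x) (e y) (e z)"
| "sem R e (Impl F G) = (sem R e F \<longrightarrow> sem R e G)"
| "sem R e (All F) = (\<forall>x. sem R (case_nat x e) F)"

text \<open>A finite assignment of natural numbers, which act as Henkin constants. The default 0
  makes it total with bounded range, so that fresh constants remain.\<close>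

definition lookup :: "nat list \<Rightarrow> nat \<Rightarrow> nat" where
  "lookup l i = (if i < length l then l ! i else 0)"

lemma lookup_Nil [simp]: "lookup [] = (\<lambda>_. 0)"
  by (simp add: lookup_def fun_eq_iff)

lemma lookup_Cons: "lookup (y # l) = case_nat y (lookup l)"
  by (simp add: lookup_def fun_eq_iff split: nat.split)

lemma lookup_bounded: "\<exists>N. \<forall>i. lookup l i < N"
  by (rule exI[of _ "Suc (sum_list l)"])
    (auto simp: lookup_def less_Suc_eq_le intro!: member_le_sum_list)

section \<open>Uniform realizability and the classical logic it validates\<close>

context realizability_algebra
begin

declare truth.simps(3-5) [simp del]

lemma realizes_terms: "realizes \<theta> F \<Longrightarrow> \<theta> \<in>\<^sub>M terms A"
  unfolding realizes_def by (rule realizes_set_terms)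

lemma realizesD: "realizes \<theta> F \<Longrightarrow> \<pi> \<in> truth F \<Longrightarrow> \<theta> \<star> \<pi> \<in>\<^sub>M pole A"
  unfolding realizes_def realizes_set_def by blast

lemma realizes_Imp_iff: "realizes \<theta> (F \<^bold>\<longrightarrow> G) \<longleftrightarrow> \<theta> \<in>\<^sub>M terms A \<and>
    (\<forall>\<xi> \<pi>. realizes \<xi> F \<longrightarrow> \<pi> \<in> truth G \<longrightarrow> \<theta> \<star> \<xi> \<triangleright> \<pi> \<in>\<^sub>M pole A)"
  unfolding realizes_def realizes_set_def truth.simps by blast

lemma truth_Imp: "\<rho> \<in> truth (F \<^bold>\<longrightarrow> G) \<longleftrightarrow> (\<exists>\<xi> \<pi>. \<rho> = \<xi> \<triangleright> \<pi> \<and> realizes \<xi> F \<and> \<pi> \<in> truth G)"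
  unfolding realizes_def truth.simps by auto

lemma realizes_Forall_iff: "realizes \<theta> (\<^bold>\<forall>x. F x) \<longleftrightarrow> (\<forall>x. realizes \<theta> (F x))"
  unfolding realizes_def realizes_set_def by auto

lemma realizes_Imp_Forall_iff: "realizes \<theta> (P \<^bold>\<longrightarrow> (\<^bold>\<forall>x. F x)) \<longleftrightarrow> (\<forall>x. realizes \<theta> (P \<^bold>\<longrightarrow> F x))"
  unfolding realizes_Imp_iff by auto

lemma realizes_mp:
  "realizes \<theta> (F \<^bold>\<longrightarrow> G) \<Longrightarrow> realizes \<eta> F \<Longrightarrow> realizes (\<theta> \<cdot> \<eta>) G"
proof -
  assume \<theta>: "realizes \<theta> (F \<^bold>\<longrightarrow> G)" and \<eta>: "realizes \<eta> F"
  have "\<theta> \<cdot> \<eta> \<star> \<pi> \<in>\<^sub>M pole A" if "\<pi> \<in> truth G" for \<pi>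
    using \<theta> \<eta> that
    by (intro pole_app realizes_terms[OF \<theta>] realizes_terms[OF \<eta>] truth_stacks[OF that])
      (simp add: realizes_Imp_iff)
  then show "realizes (\<theta> \<cdot> \<eta>) G"
    using realizes_terms[OF \<theta>] realizes_terms[OF \<eta>] unfolding realizes_def realizes_set_def by simp
qed

text \<open>The term must not depend on the index: this is how universal quantification is realized,
  and it lets parameters vary freely.\<close>

definition valid :: "'i set \<Rightarrow> ('i \<Rightarrow> 'm zfe) \<Rightarrow> bool" where
  "valid I F \<longleftrightarrow> (\<exists>\<theta>. \<theta> \<in>\<^sub>M prooflike A \<and> (\<forall>i\<in>I. realizes \<theta> (F i)))"

lemma validI: "\<theta> \<in>\<^sub>M prooflike A \<Longrightarrow> (\<And>i. i \<in> I \<Longrightarrow> realizes \<theta> (F i)) \<Longrightarrow> valid I F"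
  unfolding valid_def by blast

lemma valid_mp: "valid I (\<lambda>i. F i \<^bold>\<longrightarrow> G i) \<Longrightarrow> valid I F \<Longrightarrow> valid I G"
proof -
  assume "valid I (\<lambda>i. F i \<^bold>\<longrightarrow> G i)" "valid I F"
  then obtain \<theta> \<eta> where "\<theta> \<in>\<^sub>M prooflike A" "\<forall>i\<in>I. realizes \<theta> (F i \<^bold>\<longrightarrow> G i)"
    "\<eta> \<in>\<^sub>M prooflike A" "\<forall>i\<in>I. realizes \<eta> (F i)" unfolding valid_def by blast
  then show "valid I G" by (intro validI[of "\<theta> \<cdot> \<eta>"] prooflike_app) (auto intro: realizes_mp)
qed

lemma valid_reindex: "valid I F \<Longrightarrow> (\<And>j. j \<in> K \<Longrightarrow> g j \<in> I) \<Longrightarrow> valid K (\<lambda>j. F (g j))"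
  unfolding valid_def by blast

lemma realizes_B: "realizes (cB A) ((G \<^bold>\<longrightarrow> H) \<^bold>\<longrightarrow> (F \<^bold>\<longrightarrow> G) \<^bold>\<longrightarrow> F \<^bold>\<longrightarrow> H)"
proof -
  have "cB A \<star> \<xi> \<triangleright> \<eta> \<triangleright> \<zeta> \<triangleright> \<pi> \<in>\<^sub>M pole A"
    if "realizes \<xi> (G \<^bold>\<longrightarrow> H)" "realizes \<eta> (F \<^bold>\<longrightarrow> G)" "realizes \<zeta> F" "\<pi> \<in> truth H" for \<xi> \<eta> \<zeta> \<pi>
    using that realizes_mp[OF that(2,3)]
    by (intro pole_B realizes_terms[OF that(1)] realizes_terms[OF that(2)]
        realizes_terms[OF that(3)] truth_stacks[OF that(4)]) (simp add: realizes_Imp_iff[of _ G H])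
  then show ?thesis by (auto simp: realizes_Imp_iff[of "cB A"] truth_Imp)
qed

lemma realizes_C: "realizes (cC A) ((F \<^bold>\<longrightarrow> G \<^bold>\<longrightarrow> H) \<^bold>\<longrightarrow> G \<^bold>\<longrightarrow> F \<^bold>\<longrightarrow> H)"
proof -
  have "cC A \<star> \<xi> \<triangleright> \<eta> \<triangleright> \<zeta> \<triangleright> \<pi> \<in>\<^sub>M pole A"
    if "realizes \<xi> (F \<^bold>\<longrightarrow> G \<^bold>\<longrightarrow> H)" "realizes \<eta> G" "realizes \<zeta> F" "\<pi> \<in> truth H" for \<xi> \<eta> \<zeta> \<pi>
  proof (intro pole_C realizes_terms[OF that(1)] realizes_terms[OF that(2)]
        realizes_terms[OF that(3)] truth_stacks[OF that(4)])
    have "\<eta> \<triangleright> \<pi> \<in> truth (G \<^bold>\<longrightarrow> H)" unfolding truth_Imp using that by blast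
    then show "\<xi> \<star> \<zeta> \<triangleright> \<eta> \<triangleright> \<pi> \<in>\<^sub>M pole A" using that(1,3) unfolding realizes_Imp_iff[of \<xi>] by blast
  qed
  then show ?thesis by (auto simp: realizes_Imp_iff[of "cC A"] truth_Imp)
qed

lemma realizes_K: "realizes (cK A) (F \<^bold>\<longrightarrow> G \<^bold>\<longrightarrow> F)"
  by (auto simp: realizes_Imp_iff[of "cK A"] truth_Imp
      intro!: pole_K intro: realizes_terms truth_stacks realizesD)

lemma realizes_W: "realizes (cW A) ((F \<^bold>\<longrightarrow> F \<^bold>\<longrightarrow> G) \<^bold>\<longrightarrow> F \<^bold>\<longrightarrow> G)"
proof -
  have "cW A \<star> \<xi> \<triangleright> \<eta> \<triangleright> \<pi> \<in>\<^sub>M pole A"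
    if "realizes \<xi> (F \<^bold>\<longrightarrow> F \<^bold>\<longrightarrow> G)" "realizes \<eta> F" "\<pi> \<in> truth G" for \<xi> \<eta> \<pi>
  proof (intro pole_W realizes_terms[OF that(1)] realizes_terms[OF that(2)] truth_stacks[OF that(3)])
    have "\<eta> \<triangleright> \<pi> \<in> truth (F \<^bold>\<longrightarrow> G)" unfolding truth_Imp using that by blast
    then show "\<xi> \<star> \<eta> \<triangleright> \<eta> \<triangleright> \<pi> \<in>\<^sub>M pole A" using that(1,2) unfolding realizes_Imp_iff[of \<xi>] by blast
  qed
  then show ?thesis by (auto simp: realizes_Imp_iff[of "cW A"] truth_Imp)
qed

lemma realizes_I: "truth G \<subseteq> truth F \<Longrightarrow> realizes (cI A) (F \<^bold>\<longrightarrow> G)"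
  by (auto simp: realizes_Imp_iff[of "cI A"] intro!: pole_I intro: realizes_terms truth_stacks realizesD)

lemma realizes_cont: "\<pi> \<in> truth F \<Longrightarrow> realizes (cont \<pi>) (F \<^bold>\<longrightarrow> G)"
  by (auto simp: realizes_Imp_iff[of "cont \<pi>"]
      intro!: pole_cont cont_in_terms intro: realizes_terms truth_stacks realizesD)

lemma realizes_cc: "realizes (cc A) (((F \<^bold>\<longrightarrow> G) \<^bold>\<longrightarrow> F) \<^bold>\<longrightarrow> F)"
proof -
  have "cc A \<star> \<xi> \<triangleright> \<pi> \<in>\<^sub>M pole A" if "realizes \<xi> ((F \<^bold>\<longrightarrow> G) \<^bold>\<longrightarrow> F)" "\<pi> \<in> truth F" for \<xi> \<pi>
    using that(1) realizes_cont[OF that(2)] that(2)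
    by (intro pole_cc realizes_terms[OF that(1)] truth_stacks[OF that(2)])
      (simp add: realizes_Imp_iff[of \<xi>])
  then show ?thesis by (auto simp: realizes_Imp_iff[of "cc A"])
qed

lemma valid_sub: "(\<And>i. i \<in> I \<Longrightarrow> truth (G i) \<subseteq> truth (F i)) \<Longrightarrow> valid I (\<lambda>i. F i \<^bold>\<longrightarrow> G i)"
  by (rule validI[of "cI A"]) (simp_all add: realizes_I)

lemma valid_refl: "valid I (\<lambda>i. F i \<^bold>\<longrightarrow> F i)"
  by (rule valid_sub) simp

lemma valid_bot: "valid I (\<lambda>i. Bot \<^bold>\<longrightarrow> F i)"
  by (rule valid_sub) (auto simp: elts_iff truth_stacks)

lemma valid_K: "valid I (\<lambda>i. F i \<^bold>\<longrightarrow> G i \<^bold>\<longrightarrow> F i)"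
  by (rule validI[of "cK A"]) (simp_all add: realizes_K)

lemma valid_B: "valid I (\<lambda>i. (G i \<^bold>\<longrightarrow> H i) \<^bold>\<longrightarrow> (F i \<^bold>\<longrightarrow> G i) \<^bold>\<longrightarrow> F i \<^bold>\<longrightarrow> H i)"
  by (rule validI[of "cB A"]) (simp_all add: realizes_B)

lemma valid_C: "valid I (\<lambda>i. (F i \<^bold>\<longrightarrow> G i \<^bold>\<longrightarrow> H i) \<^bold>\<longrightarrow> G i \<^bold>\<longrightarrow> F i \<^bold>\<longrightarrow> H i)"
  by (rule validI[of "cC A"]) (simp_all add: realizes_C)

lemma valid_W: "valid I (\<lambda>i. (F i \<^bold>\<longrightarrow> F i \<^bold>\<longrightarrow> G i) \<^bold>\<longrightarrow> F i \<^bold>\<longrightarrow> G i)"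
  by (rule validI[of "cW A"]) (simp_all add: realizes_W)

lemma valid_cc: "valid I (\<lambda>i. ((F i \<^bold>\<longrightarrow> G i) \<^bold>\<longrightarrow> F i) \<^bold>\<longrightarrow> F i)"
  by (rule validI[of "cc A"]) (simp_all add: realizes_cc)

lemma valid_weaken: "valid I G \<Longrightarrow> valid I (\<lambda>i. F i \<^bold>\<longrightarrow> G i)"
  by (rule valid_mp[OF valid_K])

lemma valid_trans:
  "valid I (\<lambda>i. F i \<^bold>\<longrightarrow> G i) \<Longrightarrow> valid I (\<lambda>i. G i \<^bold>\<longrightarrow> H i) \<Longrightarrow> valid I (\<lambda>i. F i \<^bold>\<longrightarrow> H i)"
  by (rule valid_mp[OF valid_mp[OF valid_B]])

lemma valid_swap: "valid I (\<lambda>i. F i \<^bold>\<longrightarrow> G i \<^bold>\<longrightarrow> H i) \<Longrightarrow> valid I (\<lambda>i. G i \<^bold>\<longrightarrow> F i \<^bold>\<longrightarrow> H i)"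
  by (rule valid_mp[OF valid_C])

lemma valid_ap:
  "valid I (\<lambda>i. P i \<^bold>\<longrightarrow> F i \<^bold>\<longrightarrow> G i) \<Longrightarrow> valid I (\<lambda>i. P i \<^bold>\<longrightarrow> F i) \<Longrightarrow> valid I (\<lambda>i. P i \<^bold>\<longrightarrow> G i)"
  by (rule valid_mp[OF valid_W]) (rule valid_trans[OF _ valid_swap])

lemma valid_contrapos: "valid I (\<lambda>i. F i \<^bold>\<longrightarrow> G i) \<Longrightarrow> valid I (\<lambda>i. (G i \<^bold>\<longrightarrow> H i) \<^bold>\<longrightarrow> F i \<^bold>\<longrightarrow> H i)"
  by (rule valid_mp[OF valid_swap[OF valid_B]])

text \<open>Weakening the final \<open>Bot\<close> to \<open>F\<close> turns the double negation
  into the premise of Peirce's law, which \<open>cc\<close> realizes.\<close>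

lemma valid_dne: "valid I (\<lambda>i. (\<^bold>\<not> \<^bold>\<not> F i) \<^bold>\<longrightarrow> F i)"
  unfolding Neg_def by (rule valid_trans[OF valid_mp[OF valid_B valid_bot] valid_cc])

lemma valid_absurd: "valid I (\<lambda>i. (\<^bold>\<not> F i) \<^bold>\<longrightarrow> F i \<^bold>\<longrightarrow> G i)"
  unfolding Neg_def by (rule valid_mp[OF valid_B valid_bot])

lemma valid_pair: "valid I (\<lambda>i. F i \<^bold>\<longrightarrow> G i \<^bold>\<longrightarrow> (F i \<^bold>\<and> G i))"
  unfolding And_def
  by (rule valid_trans[OF valid_mp[OF valid_C valid_refl] valid_C])

lemma valid_conj1: "valid I (\<lambda>i. (F i \<^bold>\<and> G i) \<^bold>\<longrightarrow> F i)"
  by (rule valid_trans[OF _ valid_dne], unfold And_def Neg_def)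
    (rule valid_contrapos, rule valid_absurd[unfolded Neg_def])

lemma valid_conj2: "valid I (\<lambda>i. (F i \<^bold>\<and> G i) \<^bold>\<longrightarrow> G i)"
  by (rule valid_trans[OF _ valid_dne], unfold And_def Neg_def)
    (rule valid_contrapos, rule valid_K)

lemma valid_curry:
  assumes "valid I (\<lambda>i. (P i \<^bold>\<and> F i) \<^bold>\<longrightarrow> G i)"
  shows "valid I (\<lambda>i. P i \<^bold>\<longrightarrow> F i \<^bold>\<longrightarrow> G i)"
  by (rule valid_trans[OF valid_pair valid_mp[OF valid_B assms]])

lemma valid_conjI: "valid I F \<Longrightarrow> valid I G \<Longrightarrow> valid I (\<lambda>i. F i \<^bold>\<and> G i)"
  by (rule valid_mp[OF valid_mp[OF valid_pair]])

text \<open>The term acts as \<lambda>x k. k x and does not mention the witness, so one term serves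
  for all \<open>t\<close>.\<close>

lemma realizes_exI: "realizes (cC A \<cdot> cI A) (F t \<^bold>\<longrightarrow> (\<^bold>\<exists>x. F x))"
proof -
  have "realizes (cC A \<cdot> cI A) (F t \<^bold>\<longrightarrow> (\<^bold>\<not> F t) \<^bold>\<longrightarrow> Bot)"
    unfolding Neg_def by (rule realizes_mp[OF realizes_C realizes_I]) simp
  moreover have "truth (\<^bold>\<exists>x. F x) \<subseteq> truth ((\<^bold>\<not> F t) \<^bold>\<longrightarrow> Bot)"
    unfolding Exists_def Neg_def[of "\<^bold>\<forall>x. \<^bold>\<not> F x"] subset_eq Ball_def truth_Imp realizes_Forall_iff by blast
  ultimately show ?thesis unfolding realizes_Imp_iff[of _ "F t"] by blast
qed

lemma valid_exI: "valid I (\<lambda>i. F i (t i)) \<Longrightarrow> valid I (\<lambda>i. \<^bold>\<exists>x. F i x)"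
  by (rule valid_mp[OF validI[of "cC A \<cdot> cI A"]])
    (simp_all add: prooflike_app realizes_exI)

lemma valid_Forall: "valid (I \<times> UNIV) (\<lambda>(i, x). F i x) \<Longrightarrow> valid I (\<lambda>i. \<^bold>\<forall>x. F i x)"
  unfolding valid_def realizes_Forall_iff by fastforce

section \<open>Henkin construction relative to uniform realizability\<close>

definition consistent :: "((nat \<Rightarrow> 'm) \<Rightarrow> 'm zfe) \<Rightarrow> bool" where
  "consistent P \<longleftrightarrow> \<not> valid UNIV (\<lambda>e. P e \<^bold>\<longrightarrow> Bot)"

text \<open>The environment interprets the Henkin constants; a condition that reads only finitely
  many of them leaves fresh ones for witnesses.\<close>

definition finitary :: "((nat \<Rightarrow> 'm) \<Rightarrow> 'm zfe) \<Rightarrow> bool" where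
  "finitary P \<longleftrightarrow> (\<exists>N. \<forall>e e'. (\<forall>n<N. e n = e' n) \<longrightarrow> P e = P e')"

text \<open>A pair of a formula and a list stands for the result of substituting the listed
  variables; it avoids syntactic substitution.\<close>

definition closure ::
    "(nat \<Rightarrow> 'm \<Rightarrow> 'm \<Rightarrow> 'm \<Rightarrow> 'm zfe) \<Rightarrow> fm \<times> nat list \<Rightarrow> (nat \<Rightarrow> 'm) \<Rightarrow> 'm zfe" where
  "closure J c e = itp J (\<lambda>i. e (lookup (snd c) i)) (fst c)"

lemma finitary_closure: "finitary (closure J c)"
proof -
  obtain N where "\<And>i. lookup (snd c) i < N" using lookup_bounded by blast
  then show ?thesis unfolding finitary_def closure_def
    by (intro exI[of _ N] allI impI arg_cong[where f = "\<lambda>e. itp J e (fst c)"]) (simp add: fun_eq_iff)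
qed

lemma finitary_Neg: "finitary P \<Longrightarrow> finitary (\<lambda>e. \<^bold>\<not> P e)"
  unfolding finitary_def by metis

lemma finitary_And:
  assumes "finitary P" "finitary Q" shows "finitary (\<lambda>e. P e \<^bold>\<and> Q e)"
proof -
  obtain N N' where "\<And>e e'. (\<forall>n<N. e n = e' n) \<Longrightarrow> P e = P e'"
    "\<And>e e'. (\<forall>n<N'. e n = e' n) \<Longrightarrow> Q e = Q e'" using assms unfolding finitary_def by blast
  then show ?thesis unfolding finitary_def
    by (intro exI[of _ "max N N'"] allI impI arg_cong2[where f = And]) simp_all
qed

lemma consistent_cases:
  assumes "consistent P" "\<not> consistent (\<lambda>e. P e \<^bold>\<and> F e)"
  shows "consistent (\<lambda>e. P e \<^bold>\<and> \<^bold>\<not> F e)"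
proof (rule ccontr)
  assume "\<not> consistent (\<lambda>e. P e \<^bold>\<and> \<^bold>\<not> F e)"
  then have "valid UNIV (\<lambda>e. P e \<^bold>\<longrightarrow> (\<^bold>\<not> F e) \<^bold>\<longrightarrow> Bot)"
    by (intro valid_curry) (simp add: consistent_def)
  moreover have "valid UNIV (\<lambda>e. P e \<^bold>\<longrightarrow> (\<^bold>\<not> F e))"
    unfolding Neg_def by (rule valid_curry) (use assms(2) in \<open>simp add: consistent_def\<close>)
  ultimately have "valid UNIV (\<lambda>e. P e \<^bold>\<longrightarrow> Bot)" by (rule valid_ap)
  then show False using assms(1) unfolding consistent_def by blast
qed

text \<open>If no fresh \<open>y\<close> were a counterexample, one term would realize the instance
  at \<open>y\<close> under \<open>P\<close> for all environments. As neither \<open>P\<close> nor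
  \<open>l\<close> reads \<open>y\<close>, the value at \<open>y\<close> can be varied alone, so
  that term realizes the universal formula.\<close>

lemma consistent_witness:
  assumes P: "consistent P" "finitary P" "valid UNIV (\<lambda>e. P e \<^bold>\<longrightarrow> \<^bold>\<not> closure J (All \<psi>, l) e)"
  shows "\<exists>y. consistent (\<lambda>e. P e \<^bold>\<and> \<^bold>\<not> closure J (\<psi>, y # l) e)"
proof -
  obtain N where N: "\<And>e e'. (\<forall>n<N. e n = e' n) \<Longrightarrow> P e = P e'"
    using P(2) unfolding finitary_def by blast
  obtain N' where N': "\<And>i. lookup l i < N'" using lookup_bounded by blast
  define y where "y = max N N'"
  have "consistent (\<lambda>e. P e \<^bold>\<and> \<^bold>\<not> closure J (\<psi>, y # l) e)"
  proof (rule ccontr)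
    assume "\<not> consistent (\<lambda>e. P e \<^bold>\<and> \<^bold>\<not> closure J (\<psi>, y # l) e)"
    then have "valid UNIV (\<lambda>e. P e \<^bold>\<longrightarrow> \<^bold>\<not> \<^bold>\<not> closure J (\<psi>, y # l) e)"
      unfolding Neg_def[of "\<^bold>\<not> _"] by (intro valid_curry) (simp add: consistent_def)
    then have "valid UNIV (\<lambda>e. P e \<^bold>\<longrightarrow> closure J (\<psi>, y # l) e)"
      using valid_dne by (rule valid_trans)
    then obtain \<theta> where \<theta>: "\<theta> \<in>\<^sub>M prooflike A"
        "\<And>e. realizes \<theta> (P e \<^bold>\<longrightarrow> closure J (\<psi>, y # l) e)"
      unfolding valid_def by blast
    have "realizes \<theta> (P e \<^bold>\<longrightarrow> itp J (case_nat x (\<lambda>i. e (lookup l i))) \<psi>)" for e x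
    proof -
      have "P (e(y := x)) = P e" by (rule N) (simp add: y_def)
      moreover have "lookup l i \<noteq> y" for i using N'[of i] unfolding y_def by simp
      then have "(\<lambda>i. (e(y := x)) (lookup (y # l) i)) = case_nat x (\<lambda>i. e (lookup l i))"
        by (auto simp: fun_eq_iff lookup_Cons split: nat.split)
      ultimately show ?thesis using \<theta>(2)[of "e(y := x)"] unfolding closure_def by simp
    qed
    then have "valid UNIV (\<lambda>e. P e \<^bold>\<longrightarrow> closure J (All \<psi>, l) e)"
      unfolding closure_def by (intro validI[OF \<theta>(1)]) (simp add: realizes_Imp_Forall_iff)
    then have "valid UNIV (\<lambda>e. P e \<^bold>\<longrightarrow> Bot)"
      using valid_ap[OF P(3)[unfolded Neg_def]] by blast
    then show False using P(1) unfolding consistent_def by blast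
  qed
  then show ?thesis by blast
qed

lemma henkin_step:
  assumes P: "consistent P" "finitary P"
  shows "\<exists>Q. consistent Q \<and> finitary Q \<and> valid UNIV (\<lambda>e. Q e \<^bold>\<longrightarrow> P e) \<and>
    (valid UNIV (\<lambda>e. Q e \<^bold>\<longrightarrow> closure J c e) \<or> valid UNIV (\<lambda>e. Q e \<^bold>\<longrightarrow> \<^bold>\<not> closure J c e) \<and>
      (\<forall>\<psi> l. c = (All \<psi>, l) \<longrightarrow> (\<exists>y. valid UNIV (\<lambda>e. Q e \<^bold>\<longrightarrow> \<^bold>\<not> closure J (\<psi>, y # l) e))))"
proof (cases "consistent (\<lambda>e. P e \<^bold>\<and> closure J c e)")
  case True
  then show ?thesis
    by (intro exI[of _ "\<lambda>e. P e \<^bold>\<and> closure J c e"] conjI disjI1)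
      (simp_all add: valid_conj1 valid_conj2 finitary_And finitary_closure P)
next
  case False
  let ?Q = "\<lambda>e. P e \<^bold>\<and> \<^bold>\<not> closure J c e"
  have Q: "consistent ?Q" using consistent_cases[OF P(1) False] .
  have fQ: "finitary ?Q" by (intro finitary_And finitary_Neg finitary_closure P(2))
  show ?thesis
  proof (cases "\<exists>\<psi> l. c = (All \<psi>, l)")
    case True
    then obtain \<psi> l where c: "c = (All \<psi>, l)" by blast
    obtain y where y: "consistent (\<lambda>e. ?Q e \<^bold>\<and> \<^bold>\<not> closure J (\<psi>, y # l) e)"
      using consistent_witness[OF Q fQ, of J \<psi> l] valid_conj2[of UNIV P "\<lambda>e. \<^bold>\<not> closure J c e"]
      unfolding c by blast
    have "finitary (\<lambda>e. ?Q e \<^bold>\<and> \<^bold>\<not> closure J (\<psi>, y # l) e)"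
      by (intro finitary_And[OF fQ] finitary_Neg finitary_closure)
    moreover have "valid UNIV (\<lambda>e. (?Q e \<^bold>\<and> \<^bold>\<not> closure J (\<psi>, y # l) e) \<^bold>\<longrightarrow> P e)"
      by (rule valid_trans[OF valid_conj1 valid_conj1])
    moreover have "valid UNIV (\<lambda>e. (?Q e \<^bold>\<and> \<^bold>\<not> closure J (\<psi>, y # l) e) \<^bold>\<longrightarrow> \<^bold>\<not> closure J c e)"
      by (rule valid_trans[OF valid_conj1 valid_conj2])
    moreover have "valid UNIV (\<lambda>e. (?Q e \<^bold>\<and> \<^bold>\<not> closure J (\<psi>, y # l) e) \<^bold>\<longrightarrow> \<^bold>\<not> closure J (\<psi>, y # l) e)"
      by (rule valid_conj2)
    ultimately show ?thesis using y c by blast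
  next
    case False
    then show ?thesis
      using Q fQ valid_conj1[of UNIV P "\<lambda>e. \<^bold>\<not> closure J c e"]
        valid_conj2[of UNIV P "\<lambda>e. \<^bold>\<not> closure J c e"] by blast
  qed
qed

text \<open>An unrealized \<phi> makes its negation consistent; a complete Henkin theory extending
  this negation defines a structure on the constants in which all realized formulas hold and \<phi>
  fails.\<close>

theorem completeness:
  assumes models: "\<And>R :: nat \<Rightarrow> nat \<Rightarrow> nat \<Rightarrow> nat \<Rightarrow> bool.
      (\<And>\<psi> l. valid UNIV (\<lambda>e. itp J e \<psi>) \<Longrightarrow> sem R (lookup l) \<psi>) \<Longrightarrow> sem R (\<lambda>_. 0) \<phi>"
  shows "valid UNIV (\<lambda>x. itp J (\<lambda>_. x) \<phi>)"
proof (rule ccontr)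
  assume no: "\<not> valid UNIV (\<lambda>x. itp J (\<lambda>_. x) \<phi>)"
  define P0 where "P0 = (\<lambda>e. \<^bold>\<not> closure J (\<phi>, []) e)"
  have P0: "consistent P0" "finitary P0"
  proof -
    show "consistent P0"
    proof (rule ccontr)
      assume "\<not> consistent P0"
      then have "valid UNIV (\<lambda>e. \<^bold>\<not> \<^bold>\<not> closure J (\<phi>, []) e)"
        unfolding consistent_def P0_def Neg_def by simp
      then have "valid UNIV (closure J (\<phi>, []))" by (rule valid_mp[OF valid_dne])
      then have "valid UNIV (\<lambda>x. closure J (\<phi>, []) (\<lambda>_. x))" by (rule valid_reindex) simp
      then show False using no unfolding closure_def by simp
    qed
    show "finitary P0" unfolding P0_def by (intro finitary_Neg finitary_closure)
  qed
  define rel where "rel n P Q \<longleftrightarrow> valid UNIV (\<lambda>e. Q e \<^bold>\<longrightarrow> P e) \<and>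
    (valid UNIV (\<lambda>e. Q e \<^bold>\<longrightarrow> closure J (from_nat n) e) \<or>
      valid UNIV (\<lambda>e. Q e \<^bold>\<longrightarrow> \<^bold>\<not> closure J (from_nat n) e) \<and>
      (\<forall>\<psi> l. from_nat n = (All \<psi>, l) \<longrightarrow>
        (\<exists>y. valid UNIV (\<lambda>e. Q e \<^bold>\<longrightarrow> \<^bold>\<not> closure J (\<psi>, y # l) e))))"
    for n and P Q :: "(nat \<Rightarrow> 'm) \<Rightarrow> 'm zfe"
  \<comment> \<open>A chain of ever stronger conditions; step \<open>n\<close> decides the
    \<open>n\<close>-th pair of a formula and a list. The clause for \<open>n = 0\<close> fixes the
    start of the dependent choice.\<close>
  have "\<exists>f. \<forall>n. (consistent (f n) \<and> finitary (f n) \<and> (n = 0 \<longrightarrow> f n = P0)) \<and> rel n (f n) (f (Suc n))"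
  proof (rule dependent_nat_choice)
    show "\<exists>P. consistent P \<and> finitary P \<and> (0 = (0::nat) \<longrightarrow> P = P0)" using P0 by blast
    show "\<exists>Q. (consistent Q \<and> finitary Q \<and> (Suc n = 0 \<longrightarrow> Q = P0)) \<and> rel n P Q"
      if "consistent P \<and> finitary P \<and> (n = 0 \<longrightarrow> P = P0)" for P n
      using henkin_step[of P J "from_nat n"] that unfolding rel_def by auto
  qed
  then obtain f where con: "\<And>n. consistent (f n)" and f0: "f 0 = P0"
    and rel: "\<And>n. rel n (f n) (f (Suc n))" by blast
  define Th where "Th F \<longleftrightarrow> (\<exists>n. valid UNIV (\<lambda>e. f n e \<^bold>\<longrightarrow> F e))" for F
  have anti: "valid UNIV (\<lambda>e. f (n + k) e \<^bold>\<longrightarrow> f n e)" for n k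
  proof (induction k)
    case 0
    show ?case by (simp add: valid_refl)
  next
    case (Suc k)
    show ?case using valid_trans[OF _ Suc] rel[of "n + k"] unfolding rel_def by simp
  qed
  have Th_mp: "Th G" if F: "Th F" and FG: "Th (\<lambda>e. F e \<^bold>\<longrightarrow> G e)" for F G
  proof -
    obtain n m where n: "valid UNIV (\<lambda>e. f n e \<^bold>\<longrightarrow> F e)"
      and m: "valid UNIV (\<lambda>e. f m e \<^bold>\<longrightarrow> F e \<^bold>\<longrightarrow> G e)" using F FG unfolding Th_def by blast
    have "valid UNIV (\<lambda>e. f (n + m) e \<^bold>\<longrightarrow> G e)"
      using valid_ap[OF valid_trans[OF anti[of m n] m]] valid_trans[OF anti[of n m] n]
      by (simp add: add.commute)
    then show ?thesis unfolding Th_def by blast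
  qed
  have Th_valid: "Th F" if "valid UNIV F" for F
    unfolding Th_def using valid_weaken[OF that] by blast
  have Th_bot: "\<not> Th (\<lambda>_. Bot)" unfolding Th_def using con unfolding consistent_def by blast
  have Th_Neg: "\<not> Th F" if "Th (\<lambda>e. \<^bold>\<not> F e)" for F
    using Th_mp[of F "\<lambda>_. Bot"] that Th_bot unfolding Neg_def by blast
  have Th_cases: "Th (closure J c) \<or> Th (\<lambda>e. \<^bold>\<not> closure J c e)" for c
    using rel[of "to_nat c"] unfolding rel_def Th_def from_nat_to_nat by blast
  have Th_Imp: "Th (\<lambda>e. F e \<^bold>\<longrightarrow> G e) \<longleftrightarrow> (Th F \<longrightarrow> Th G)"
    if "Th F \<or> Th (\<lambda>e. \<^bold>\<not> F e)" for F G
    using that Th_mp[of F G] Th_mp[OF _ Th_valid[OF valid_K]] Th_mp[OF _ Th_valid[OF valid_absurd]]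
    by blast
  \<comment> \<open>The term model: its elements are the constants themselves, and its atoms are
    those in the limit theory of the chain.\<close>
  define R where "R k x y z \<longleftrightarrow> Th (\<lambda>e. J k (e x) (e y) (e z))" for k x y z
  have truth: "sem R (lookup l) \<psi> \<longleftrightarrow> Th (closure J (\<psi>, l))" for \<psi> l
  proof (induction \<psi> arbitrary: l)
    case Fal
    show ?case using Th_bot unfolding closure_def by simp
  next
    case (Atom k x y z)
    show ?case unfolding R_def closure_def by simp
  next
    case (Impl F G)
    have "closure J (Impl F G, l) = (\<lambda>e. closure J (F, l) e \<^bold>\<longrightarrow> closure J (G, l) e)"
      unfolding closure_def by simp
    then show ?case using Impl Th_Imp[OF Th_cases] by simp
  next
    case (All \<psi>)
    have "Th (closure J (All \<psi>, l)) \<longleftrightarrow> (\<forall>y. Th (closure J (\<psi>, y # l)))"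
    proof
      assume *: "Th (closure J (All \<psi>, l))"
      have "valid UNIV (\<lambda>e. closure J (All \<psi>, l) e \<^bold>\<longrightarrow> closure J (\<psi>, y # l) e)" for y
      proof (rule valid_sub)
        fix e :: "nat \<Rightarrow> 'm"
        have "(\<lambda>i. e (lookup (y # l) i)) = case_nat (e y) (\<lambda>i. e (lookup l i))"
          by (auto simp: fun_eq_iff lookup_Cons split: nat.split)
        then show "truth (closure J (\<psi>, y # l) e) \<subseteq> truth (closure J (All \<psi>, l) e)"
          unfolding closure_def by auto
      qed
      then show "\<forall>y. Th (closure J (\<psi>, y # l))" using Th_mp[OF * Th_valid] by blast
    next
      assume *: "\<forall>y. Th (closure J (\<psi>, y # l))"
      show "Th (closure J (All \<psi>, l))"
      proof (rule ccontr)
        assume "\<not> Th (closure J (All \<psi>, l))"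
        then obtain y where "Th (\<lambda>e. \<^bold>\<not> closure J (\<psi>, y # l) e)"
          using rel[of "to_nat (All \<psi>, l)"] unfolding rel_def Th_def from_nat_to_nat by blast
        then show False using Th_Neg * by blast
      qed
    qed
    then show ?case using All by (simp add: lookup_Cons[symmetric])
  qed
  have "sem R (lookup l) \<psi>" if "valid UNIV (\<lambda>e. itp J e \<psi>)" for \<psi> l
    unfolding truth closure_def using valid_reindex[OF that] by (intro Th_valid) simp
  then have "sem R (lookup []) \<phi>" using models by simp
  then have "Th (closure J (\<phi>, []))" unfolding truth .
  moreover have "Th (\<lambda>e. \<^bold>\<not> closure J (\<phi>, []) e)"
    unfolding Th_def using f0 valid_refl[of UNIV P0] unfolding P0_def by metis
  ultimately show False using Th_Neg by blast
qed

end

section \<open>Realized axioms\<close>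

primrec rename :: "(nat \<Rightarrow> nat) \<Rightarrow> fm \<Rightarrow> fm" where
  "rename \<sigma> Fal = Fal"
| "rename \<sigma> (Atom k x y z) = Atom k (\<sigma> x) (\<sigma> y) (\<sigma> z)"
| "rename \<sigma> (Impl F G) = Impl (rename \<sigma> F) (rename \<sigma> G)"
| "rename \<sigma> (All F) = All (rename (case_nat 0 (\<lambda>n. Suc (\<sigma> n))) F)"

lemma case_nat_drop:
  "(\<lambda>n. case_nat x (case_nat y e) (case_nat 0 (\<lambda>n. Suc (Suc n)) n)) = case_nat x e"
  "(\<lambda>n. case_nat x (case_nat y e) (case_nat (Suc 0) (\<lambda>n. Suc (Suc n)) n)) = case_nat y e"
  by (auto simp: fun_eq_iff split: nat.split)

lemma case_nat_rename:
  "(\<lambda>n. case_nat x e (case_nat 0 (\<lambda>n. Suc (\<sigma> n)) n)) = case_nat x (\<lambda>n. e (\<sigma> n))"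
  by (auto simp: fun_eq_iff split: nat.split)

lemma itp_rename [simp]: "itp J e (rename \<sigma> F) = itp J (\<lambda>n. e (\<sigma> n)) F"
  by (induction F arbitrary: e \<sigma>) (simp_all add: case_nat_rename)

lemma sem_rename [simp]: "sem R e (rename \<sigma> F) = sem R (\<lambda>n. e (\<sigma> n)) F"
  by (induction F arbitrary: e \<sigma>) (simp_all add: case_nat_rename)

text \<open>The relation symbols are numbered as in \<open>atoms\<close>: 0 is
  \<open>NotEps\<close>, 1 is \<open>NotIn\<close>, 2 is \<open>Subset\<close>, and 3 says that the
  pair of the first two arguments is strongly outside the third. For the binary ones the last
  argument is a dummy.\<close>

definition "fNeg F = Impl F Fal"
definition "fAnd F G = fNeg (Impl F (Impl G Fal))"
definition "fEx F = fNeg (All (fNeg F))"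
definition "fEps x y = fNeg (Atom 0 x y 0)"
definition "fIn x y = fNeg (Atom 1 x y 0)"
definition "fExtEq x y = fAnd (Atom 2 x y 0) (Atom 2 y x 0)"
definition "fEq x y = All (Impl (Atom 0 (Suc y) 0 0) (Atom 0 (Suc x) 0 0))"
definition "fAllEps a F = All (Impl (fNeg F) (Atom 0 0 (Suc a) 0))"
definition "fExEps a F = fNeg (All (Impl F (Atom 0 0 (Suc a) 0)))"
definition "fAllIn a F = All (Impl (fNeg F) (Atom 1 0 (Suc a) 0))"
definition "fEpsOp x y f = fNeg (Atom 3 x y f)"
definition "fEqOp z x y = All (Impl (Atom 3 (Suc x) (Suc y) 0) (Atom 0 (Suc z) 0 0))"
definition "fTrans x = fAllIn x (fAllIn 0 (fIn 0 (Suc (Suc x))))"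
definition "fOrd x = fAnd (fTrans x) (fAllIn x (fTrans 0))"
definition "fFunction f d = fAnd
  (fAllEps f (fExEps (Suc d) (fEx (fEqOp (Suc (Suc 0)) (Suc 0) 0))))
  (fAnd (fAllEps d (fEx (fEpsOp (Suc 0) 0 (Suc (Suc f)))))
    (All (All (All (Impl (fEpsOp (Suc (Suc 0)) (Suc 0) (Suc (Suc (Suc f))))
      (Impl (fEpsOp (Suc (Suc 0)) 0 (Suc (Suc (Suc f)))) (fEq (Suc 0) 0)))))))"
definition "fValue f x r = fEx (fAnd (fEpsOp (Suc x) 0 (Suc f)) (fExtEq 0 (Suc r)))"

definition fSurj :: "nat \<Rightarrow> nat \<Rightarrow> nat \<Rightarrow> fm" where
  "fSurj f a k = fAnd (fFunction f a) (fAllIn k (fExEps (Suc a) (fValue (Suc (Suc f)) 0 (Suc 0))))"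

text \<open>The preorder f(x) \<in> f(x') or f(x) \<simeq> f(x'), with f(x') required to lie in
  \<open>k\<close>. Since \<open>f\<close> may also take values outside \<open>k\<close>, this bound
  matters: the points below themselves are exactly those with a value in \<open>k\<close>.\<close>

definition fOrder :: "nat \<Rightarrow> nat \<Rightarrow> nat \<Rightarrow> nat \<Rightarrow> fm" where
  "fOrder f k x x' = fEx (fAnd (fValue (Suc f) (Suc x) 0) (fEx (fAnd (fValue (Suc (Suc f)) (Suc (Suc x')) 0)
    (fAnd (fIn 0 (Suc (Suc k))) (fNeg (fAnd (fNeg (fIn (Suc 0) 0)) (fNeg (fExtEq (Suc 0) 0))))))))"

text \<open>Transitivity of \<open>a\<close> and of its elements for strong membership. The
  contrapositive form turns it into inclusions of truth values, realized by the identity, and in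
  models it implies being an ordinal.\<close>

definition fTame :: "nat \<Rightarrow> fm" where
  "fTame a = fAnd
    (fAllEps a (All (Impl (Atom 0 0 (Suc (Suc a)) 0) (Atom 0 0 (Suc 0) 0))))
    (fAllEps a (fAllEps 0 (All (Impl (Atom 0 0 (Suc (Suc 0)) 0) (Atom 0 0 (Suc 0) 0)))))"

text \<open>Induction for the negation of \<open>F\<close>, its hypothesis contraposed so that it
  ends in an atom \<open>NotEps\<close>: the form that a fixed point combinator realizes directly.
  The renaming skips the variable of the outer quantifier.\<close>

definition fInduct :: "fm \<Rightarrow> fm" where
  "fInduct F = Impl
     (All (Impl (All (Impl (rename (case_nat 0 (\<lambda>n. Suc (Suc n))) F) (Atom 0 0 (Suc 0) 0))) (fNeg F)))
     (All (fNeg F))"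

definition fLeibniz :: "fm \<Rightarrow> fm" where
  "fLeibniz F = Impl (fEq 0 (Suc 0))
     (Impl (rename (case_nat (Suc 0) (\<lambda>n. Suc (Suc n))) F) (rename (case_nat 0 (\<lambda>n. Suc (Suc n))) F))"

text \<open>Innermost, the indices 0 to 6 stand for x', x, g, f, \<beta>, \<alpha>, a.\<close>

definition fPigeonhole :: fm where
  "fPigeonhole = All (fEx (fEx (fAnd (fTame 1) (fAnd (fTame 0) (fAnd (fEps 1 0)
     (All (Impl (fSurj 0 3 2) (fEx (fAnd (fSurj 0 4 2) (fAllEps 4 (fAllEps 5
       (fAnd (Impl (fOrder 3 5 1 0) (fOrder 2 4 1 0))
         (Impl (fOrder 2 4 1 0) (fOrder 3 5 1 0))))))))))))))"

lemmas fm_defs = fNeg_def fAnd_def fEx_def fEps_def fIn_def fExtEq_def fEq_def fAllEps_def fExEps_def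
  fAllIn_def fEpsOp_def fEqOp_def fTrans_def fOrd_def fFunction_def fValue_def

lemmas zfe_defs = Neg_def And_def Exists_def Eps_def In_def ExtEq_def Eq_def all_eps_def ex_eps_def
  all_in_def Trans_def Ord_def function_on_def value_sim_def

context set_structure
begin

lemma definable_app5:
  assumes "definable (\<lambda>e. P (e 0) (e 1) (e 2) (e 3) (e 4))"
    "definable_fn r" "definable_fn s" "definable_fn t" "definable_fn u" "definable_fn v"
  shows "definable (\<lambda>e. P (r e) (s e) (t e) (u e) (v e))"
proof (rule definable_let[OF _ assms(2)])
  show "definable (\<lambda>e. P (e 0) (s (tl_env e)) (t (tl_env e)) (u (tl_env e)) (v (tl_env e)))"
  proof (rule definable_let[OF _ definable_fn_rename[OF assms(3), of Suc]])
    show "definable (\<lambda>e. P (tl_env e 0) (e 0) (t (tl_env (tl_env e))) (u (tl_env (tl_env e)))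
      (v (tl_env (tl_env e))))"
    proof (rule definable_let[OF _ definable_fn_rename[OF assms(4), of "\<lambda>n. Suc (Suc n)"]])
      show "definable (\<lambda>e. P (tl_env (tl_env e) 0) (tl_env e 0) (e 0)
        (u (tl_env (tl_env (tl_env e)))) (v (tl_env (tl_env (tl_env e)))))"
      proof (rule definable_let[OF _ definable_fn_rename[OF assms(5), of "\<lambda>n. Suc (Suc (Suc n))"]])
        show "definable (\<lambda>e. P (tl_env (tl_env (tl_env e)) 0) (tl_env (tl_env e) 0) (tl_env e 0) (e 0)
          (v (tl_env (tl_env (tl_env (tl_env e))))))"
        proof (rule definable_let[OF _
              definable_fn_rename[OF assms(6), of "\<lambda>n. Suc (Suc (Suc (Suc n)))"]])
          show "definable (\<lambda>e. P (tl_env (tl_env (tl_env (tl_env e))) 0)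
            (tl_env (tl_env (tl_env e)) 0) (tl_env (tl_env e) 0) (tl_env e 0) (e 0))"
            using definable_rename[OF assms(1), of "\<lambda>n. 4 - n"] by (simp add: eval_nat_numeral)
        qed
      qed
    qed
  qed
qed

lemma definable_app4:
  assumes "definable (\<lambda>e. P (e 0) (e 1) (e 2) (e 3))"
    "definable_fn r" "definable_fn s" "definable_fn t" "definable_fn u"
  shows "definable (\<lambda>e. P (r e) (s e) (t e) (u e))"
  by (rule definable_app5[where P = "\<lambda>r s t u _. P r s t u"]) (rule assms)+

end

section \<open>Definable truth values; realizing induction and Leibniz's law\<close>

context realizability_algebra
begin

definition atoms :: "nat \<Rightarrow> 'm \<Rightarrow> 'm \<Rightarrow> 'm \<Rightarrow> 'm zfe" where
  "atoms k x y z = (if k = 0 then NotEps x y else if k = 1 then NotIn x y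
     else if k = 2 then Subset x y else NotEps (op x y) z)"

lemma atoms_simps [simp]:
  "atoms 0 x y z = NotEps x y" "atoms 1 x y z = NotIn x y" "atoms (Suc 0) x y z = NotIn x y"
  "atoms 2 x y z = Subset x y" "atoms 3 x y z = NotEps (op x y) z"
  by (simp_all add: atoms_def)

lemma definable_fn_cartesian: "definable_fn t \<Longrightarrow> definable_fn (\<lambda>e. cartesian (t e) c)"
proof (rule definable_fn_app1[where g = "\<lambda>x. cartesian x c"])
  have "z = cartesian x c \<longleftrightarrow> (\<forall>q. q \<in> elts z \<longleftrightarrow> (\<exists>u v. q = opair u v \<and> u \<in>\<^sub>M x \<and> v \<in>\<^sub>M c))" for x z
    using extensionality[of z "cartesian x c"] by auto
  then show "definable (\<lambda>e. e 0 = cartesian (e 1) c)"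
    by (simp only:) (intro definable_algebra_intros)
qed

lemma definable_fn_op:
  "definable_fn s \<Longrightarrow> definable_fn t \<Longrightarrow> definable_fn (\<lambda>e. op (s e) (t e))"
  unfolding op_def pair_def by (intro definable_fn_cartesian definable_fn_mk_pair)

lemma definable_truth_atoms:
  "definable (\<lambda>e. e 0 \<in> truth (atoms k (e x) (e y) (e z)))"
  unfolding atoms_def
  by (simp add: definable_truth_Subset definable_truth_NotIn definable_fn_var definable_algebra_intros
      definable_fn_op)

text \<open>The induction on \<open>F\<close> takes place in the metatheory, giving one defining
  formula for each \<open>F\<close>; this makes separation and induction in the ground model
  applicable to truth values.\<close>

lemma definable_truth_itp: "definable (\<lambda>e. e 0 \<in> truth (itp atoms (tl_env e) F))"
proof (induction F)
  case Fal
  show ?case by (simp add: elts_iff definable_algebra_intros)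
next
  case (Atom k x y z)
  show ?case by (simp add: definable_truth_atoms)
next
  case (Impl F G)
  have "definable (\<lambda>e. \<exists>\<xi> \<pi>. e 0 = \<xi> \<triangleright> \<pi> \<and> realizes_set \<xi> (truth (itp atoms (tl_env e) F)) \<and>
      \<pi> \<in> truth (itp atoms (tl_env e) G))"
    by (intro definable_realizes_set definable_algebra_intros)
      (use definable_rename[OF Impl(1), of "case_nat 0 (\<lambda>n. Suc (Suc (Suc (Suc n))))"]
        definable_rename[OF Impl(2), of "case_nat 0 (\<lambda>n. Suc (Suc (Suc n)))"] in simp_all)
  then show ?case by (simp add: truth_Imp realizes_def)
next
  case (All F)
  have "definable (\<lambda>e. \<exists>x. e 0 \<in> truth (itp atoms (case_nat x (tl_env e)) F))"
  proof (rule definable_ex)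
    have "(\<lambda>n. e (case_nat 1 (case_nat 0 (\<lambda>n. Suc (Suc n))) (Suc n))) = case_nat (e 0) (tl_env (tl_env e))"
      for e :: "nat \<Rightarrow> 'm" by (auto simp: fun_eq_iff split: nat.split)
    then show "definable (\<lambda>e. tl_env e 0 \<in> truth (itp atoms (case_nat (e 0) (tl_env (tl_env e))) F))"
      using definable_rename[OF All, of "case_nat 1 (case_nat 0 (\<lambda>n. Suc (Suc n)))"] by simp
  qed
  then show ?case by simp
qed

lemma definable_truth_instance:
  assumes "definable_fn s" "definable_fn t"
  shows "definable (\<lambda>e. s e \<in> truth (itp atoms (case_nat (t e) c) F))"
proof (rule definable_app2[OF _ assms])
  define u where "u = case_nat (\<lambda>e :: nat \<Rightarrow> 'm. e 0) (case_nat (\<lambda>e. e 1) (\<lambda>m _. c m))"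
  have "definable (\<lambda>e. u 0 e \<in> truth (itp atoms (tl_env (\<lambda>n. u n e)) F))"
    by (rule definable_subst[OF definable_truth_itp]) (auto simp: u_def split: nat.split)
  moreover have "tl_env (\<lambda>n. u n e) = case_nat (e 1) c" for e
    by (auto simp: u_def fun_eq_iff split: nat.split)
  ultimately show "definable (\<lambda>e. e 0 \<in> truth (itp atoms (case_nat (e 1) c) F))"
    by (simp add: u_def)
qed

lemma definable_realizes_instance:
  assumes "definable_fn s" "definable_fn t"
  shows "definable (\<lambda>e. realizes (s e) (itp atoms (case_nat (t e) c) F))"
  unfolding realizes_def
  by (intro definable_realizes_set definable_truth_instance definable_fn_var assms
      definable_fn_rename[OF assms(2)])

text \<open>Turing's fixed point combinator, written with \<open>B, C, I, W\<close>.\<close>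

definition self_app :: 'm where
  "self_app = cW A \<cdot> cI A"

definition cY :: 'm where
  "cY = self_app \<cdot> (cB A \<cdot> cW A \<cdot> (cB A \<cdot> (cC A \<cdot> cB A) \<cdot> self_app))"

lemma self_app_prooflike: "self_app \<in>\<^sub>M prooflike A"
  unfolding self_app_def by (simp add: prooflike_app)

lemma cY_prooflike: "cY \<in>\<^sub>M prooflike A"
  unfolding cY_def by (simp add: prooflike_app self_app_prooflike)

lemma pole_self_app:
  assumes "\<xi> \<in>\<^sub>M terms A" "\<pi> \<in>\<^sub>M stacks A" "\<xi> \<star> \<xi> \<triangleright> \<pi> \<in>\<^sub>M pole A"
  shows "self_app \<star> \<xi> \<triangleright> \<pi> \<in>\<^sub>M pole A"
  unfolding self_app_def using assms by (intro pole_app pole_W pole_I) simp_all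

lemma pole_Y:
  assumes "\<xi> \<in>\<^sub>M terms A" "\<pi> \<in>\<^sub>M stacks A" "\<xi> \<star> (cY \<cdot> \<xi>) \<triangleright> \<pi> \<in>\<^sub>M pole A"
  shows "cY \<star> \<xi> \<triangleright> \<pi> \<in>\<^sub>M pole A"
proof -
  define Z where "Z = cB A \<cdot> cW A \<cdot> (cB A \<cdot> (cC A \<cdot> cB A) \<cdot> self_app)"
  have Y: "cY = self_app \<cdot> Z" unfolding cY_def Z_def ..
  have s: "self_app \<in>\<^sub>M terms A" by (rule prooflike_in_terms[OF self_app_prooflike])
  then have Z: "Z \<in>\<^sub>M terms A" unfolding Z_def by simp
  \<comment> \<open>\<open>Z\<close> sends z and x to x applied to \<open>self_app\<close> z x; for
    z = \<open>Z\<close> the inner term is \<open>cY\<close> applied to x.\<close>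
  have "cB A \<cdot> cW A \<cdot> (cB A \<cdot> (cC A \<cdot> cB A) \<cdot> self_app) \<star> Z \<triangleright> \<xi> \<triangleright> \<pi> \<in>\<^sub>M pole A"
    using assms Z s unfolding Y by (intro pole_app pole_B pole_W pole_C) simp_all
  then have "Z \<star> Z \<triangleright> \<xi> \<triangleright> \<pi> \<in>\<^sub>M pole A" by (fold Z_def)
  then show ?thesis unfolding Y using assms Z s by (intro pole_app pole_self_app) simp_all
qed

text \<open>The recursive call \<open>cY \<cdot> \<xi>\<close> has to realize F y \<longrightarrow>
  \<open>NotEps y x\<close>. The truth value of \<open>NotEps y x\<close> is nonempty only if
  \<open>y\<close> occurs as a first component in \<open>x\<close>, and there induction over names
  applies.\<close>

lemma valid_induct: "valid UNIV (\<lambda>e. itp atoms e (fInduct F))"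
proof (rule validI[OF cY_prooflike])
  fix e :: "nat \<Rightarrow> 'm"
  let ?F = "\<lambda>x. itp atoms (case_nat x e) F"
  let ?H = "\<lambda>x. (\<^bold>\<forall>y. ?F y \<^bold>\<longrightarrow> NotEps y x) \<^bold>\<longrightarrow> ?F x \<^bold>\<longrightarrow> Bot"
  have "realizes cY ((\<^bold>\<forall>x. ?H x) \<^bold>\<longrightarrow> (?F x \<^bold>\<longrightarrow> Bot))" for x
    unfolding realizes_Imp_iff[of cY] truth_Imp
  proof (intro conjI allI impI)
    show "cY \<in>\<^sub>M terms A" by (rule prooflike_in_terms[OF cY_prooflike])
    fix \<xi> \<rho>
    assume \<xi>: "realizes \<xi> (\<^bold>\<forall>x. ?H x)"
      and "\<exists>\<eta> \<pi>. \<rho> = \<eta> \<triangleright> \<pi> \<and> realizes \<eta> (?F x) \<and> \<pi> \<in> truth Bot"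
    then obtain \<eta> \<pi> where \<rho>: "\<rho> = \<eta> \<triangleright> \<pi>" and \<eta>: "realizes \<eta> (?F x)" and \<pi>: "\<pi> \<in> truth Bot"
      by blast
    have "\<forall>\<eta> \<pi>. realizes \<eta> (?F x) \<longrightarrow> \<pi> \<in>\<^sub>M stacks A \<longrightarrow> cY \<star> \<xi> \<triangleright> \<eta> \<triangleright> \<pi> \<in>\<^sub>M pole A"
    proof (rule name_induct[where P = "\<lambda>x. \<forall>\<eta> \<pi>. realizes \<eta> (?F x) \<longrightarrow> \<pi> \<in>\<^sub>M stacks A \<longrightarrow>
        cY \<star> \<xi> \<triangleright> \<eta> \<triangleright> \<pi> \<in>\<^sub>M pole A"])
      show "definable (\<lambda>e'. \<forall>\<eta> \<pi>. realizes \<eta> (?F (e' 0)) \<longrightarrow> \<pi> \<in>\<^sub>M stacks A \<longrightarrow>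
        cY \<star> \<xi> \<triangleright> \<eta> \<triangleright> \<pi> \<in>\<^sub>M pole A)"
        by (intro definable_realizes_instance definable_algebra_intros)
    next
      fix x
      assume IH: "\<And>y p. opair y p \<in>\<^sub>M x \<Longrightarrow> \<forall>\<eta> \<pi>. realizes \<eta> (?F y) \<longrightarrow> \<pi> \<in>\<^sub>M stacks A \<longrightarrow>
        cY \<star> \<xi> \<triangleright> \<eta> \<triangleright> \<pi> \<in>\<^sub>M pole A"
      have in_terms: "\<xi> \<in>\<^sub>M terms A" "cY \<in>\<^sub>M terms A"
        using realizes_terms[OF \<xi>] prooflike_in_terms[OF cY_prooflike] .
      have Y: "realizes (cY \<cdot> \<xi>) (\<^bold>\<forall>y. ?F y \<^bold>\<longrightarrow> NotEps y x)"
        unfolding realizes_Forall_iff realizes_Imp_iff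
        using IH in_terms by (auto intro!: pole_app push_in_stacks intro: realizes_terms)
      show "\<forall>\<eta> \<pi>. realizes \<eta> (?F x) \<longrightarrow> \<pi> \<in>\<^sub>M stacks A \<longrightarrow> cY \<star> \<xi> \<triangleright> \<eta> \<triangleright> \<pi> \<in>\<^sub>M pole A"
      proof (intro allI impI)
        fix \<eta> \<pi>
        assume \<eta>: "realizes \<eta> (?F x)" and \<pi>: "\<pi> \<in>\<^sub>M stacks A"
        have "\<eta> \<triangleright> \<pi> \<in> truth (?F x \<^bold>\<longrightarrow> Bot)" unfolding truth_Imp using \<eta> \<pi> by (auto simp: elts_iff)
        moreover have "realizes \<xi> (?H x)" using \<xi> unfolding realizes_Forall_iff by blast
        ultimately have "\<xi> \<star> (cY \<cdot> \<xi>) \<triangleright> \<eta> \<triangleright> \<pi> \<in>\<^sub>M pole A"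
          using Y unfolding realizes_Imp_iff[of \<xi>] by blast
        then show "cY \<star> \<xi> \<triangleright> \<eta> \<triangleright> \<pi> \<in>\<^sub>M pole A"
          using in_terms \<pi> realizes_terms[OF \<eta>] by (intro pole_Y) simp_all
      qed
    qed
    then show "cY \<star> \<xi> \<triangleright> \<rho> \<in>\<^sub>M pole A" using \<eta> \<pi> unfolding \<rho> by (simp add: elts_iff)
  qed
  then show "realizes cY (itp atoms e (fInduct F))"
    unfolding fInduct_def fNeg_def itp.simps itp_rename case_nat_drop realizes_Imp_Forall_iff by simp
qed

text \<open>Separation yields a name \<open>z\<close> such that \<open>NotEps v z\<close> has the
  truth value of \<open>F\<close> at \<open>v\<close> for the two individuals concerned. The
  equality instantiated at \<open>z\<close> is then the desired implication, so the identity
  realizes it.\<close>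

lemma valid_Leibniz: "valid UNIV (\<lambda>e. itp atoms e (fLeibniz F))"
proof -
  have "truth (itp atoms (case_nat y' e) F \<^bold>\<longrightarrow> itp atoms (case_nat y e) F) \<subseteq> truth (Eq y y')"
    for y y' and e :: "nat \<Rightarrow> 'm"
  proof -
    let ?F = "\<lambda>x. itp atoms (case_nat x e) F"
    define X where "X = cartesian (mk {y, y'}) (stacks A)"
    have "small {q \<in> elts X. \<exists>v \<pi>. q = opair v \<pi> \<and> \<pi> \<in> truth (?F v)}"
      by (rule small_separation)
        (intro definable_truth_instance definable_algebra_intros)
    then obtain z where z: "elts z = {q \<in> elts X. \<exists>v \<pi>. q = opair v \<pi> \<and> \<pi> \<in> truth (?F v)}"
      unfolding small_def by blast
    have mk: "v \<in>\<^sub>M mk {y, y'} \<longleftrightarrow> v = y \<or> v = y'" for v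
      using elts_iff[of v "mk {y, y'}"] by simp
    have "truth (NotEps v z) = truth (?F v)" if "v = y \<or> v = y'" for v
    proof -
      have "opair v \<pi> \<in> elts z \<longleftrightarrow> \<pi> \<in>\<^sub>M stacks A \<and> \<pi> \<in> truth (?F v)" for \<pi>
        using that unfolding z X_def by (auto simp: mk)
      then show ?thesis
        unfolding truth.simps elts_iff using truth_stacks[of _ "?F v"] by blast
    qed
    then have "truth (?F y' \<^bold>\<longrightarrow> ?F y) = truth (NotEps y' z \<^bold>\<longrightarrow> NotEps y z)"
      by (simp add: set_eq_iff truth_Imp realizes_def)
    then show ?thesis unfolding Eq_def by auto
  qed
  then have "realizes (cI A) (Eq (e 0) (e 1) \<^bold>\<longrightarrow>
      itp atoms (case_nat (e 1) (tl_env (tl_env e))) F \<^bold>\<longrightarrow>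
      itp atoms (case_nat (e 0) (tl_env (tl_env e))) F)" for e
    by (intro realizes_I)
  moreover have "(\<lambda>n. e (case_nat i (\<lambda>n. Suc (Suc n)) n)) = case_nat (e i) (tl_env (tl_env e))"
    for e :: "nat \<Rightarrow> 'm" and i by (auto simp: fun_eq_iff split: nat.split)
  ultimately have "realizes (cI A) (itp atoms e (fLeibniz F))" for e
    by (simp add: fLeibniz_def fEq_def Eq_def)
  then show ?thesis by (intro validI[of "cI A"]) simp_all
qed

section \<open>Agreement of the de Bruijn formulas with those of \<open>zfe\<close>\<close>

lemma itp_fm:
  "itp J e (fNeg F) = (\<^bold>\<not> itp J e F)"
  "itp J e (fAnd F G) = (itp J e F \<^bold>\<and> itp J e G)"
  "itp J e (fEx F) = (\<^bold>\<exists>x. itp J (case_nat x e) F)"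
  "itp atoms e (fEps x y) = (e x \<^bold>\<epsilon> e y)"
  "itp atoms e (fIn x y) = (e x \<^bold>\<in> e y)"
  "itp atoms e (fExtEq x y) = (e x \<^bold>\<simeq> e y)"
  "itp atoms e (fEq x y) = (e x \<^bold>= e y)"
  "itp atoms e (fAllEps x F) = all_eps (e x) (\<lambda>x. itp atoms (case_nat x e) F)"
  "itp atoms e (fExEps x F) = ex_eps (e x) (\<lambda>x. itp atoms (case_nat x e) F)"
  "itp atoms e (fAllIn x F) = all_in (e x) (\<lambda>x. itp atoms (case_nat x e) F)"
  "itp atoms e (fEpsOp x y f) = (op (e x) (e y) \<^bold>\<epsilon> e f)"
  "itp atoms e (fEqOp x y f) = (e x \<^bold>= op (e y) (e f))"
  by (simp_all add: fm_defs zfe_defs)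

lemma itp_fTrans: "itp atoms e (fTrans x) = Trans (e x)"
  by (simp add: fTrans_def Trans_def itp_fm)

lemma itp_fOrd: "itp atoms e (fOrd x) = Ord (e x)"
  by (simp add: fOrd_def Ord_def itp_fm itp_fTrans)

lemma itp_fFunction: "itp atoms e (fFunction f d) = function_on op (e f) (e d)"
  by (simp add: fFunction_def function_on_def itp_fm)

lemma itp_fValue: "itp atoms e (fValue f x r) = value_sim op (e f) (e x) (e r)"
  by (simp add: fValue_def value_sim_def itp_fm)

definition Surj :: "'m \<Rightarrow> 'm \<Rightarrow> 'm \<Rightarrow> 'm zfe" where
  "Surj f a k = (function_on op f a \<^bold>\<and> all_in k (\<lambda>\<rho>. ex_eps a (\<lambda>x. value_sim op f x \<rho>)))"

lemma itp_fSurj: "itp atoms e (fSurj f a k) = Surj (e f) (e a) (e k)"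
  by (simp add: fSurj_def Surj_def itp_fm itp_fFunction itp_fValue)

definition Order :: "'m \<Rightarrow> 'm \<Rightarrow> 'm \<Rightarrow> 'm \<Rightarrow> 'm zfe" where
  "Order f k x x' = itp atoms (case_nat f (case_nat k (case_nat x (\<lambda>_. x')))) (fOrder 0 1 2 3)"

lemma itp_fOrder: "itp atoms e (fOrder f k x x') = Order (e f) (e k) (e x) (e x')"
  by (simp add: fOrder_def Order_def itp_fm itp_fValue eval_nat_numeral)

definition Tame :: "'m \<Rightarrow> 'm zfe" where
  "Tame a = (all_eps a (\<lambda>x. \<^bold>\<forall>y. NotEps y a \<^bold>\<longrightarrow> NotEps y x) \<^bold>\<and>
     all_eps a (\<lambda>x. all_eps x (\<lambda>y. \<^bold>\<forall>z. NotEps z x \<^bold>\<longrightarrow> NotEps z y)))"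

lemma itp_fTame: "itp atoms e (fTame a) = Tame (e a)"
  by (simp add: fTame_def Tame_def itp_fm)

lemma definable_truth_Order:
  assumes "definable_fn p" "definable_fn f" "definable_fn k" "definable_fn x" "definable_fn x'"
  shows "definable (\<lambda>e. p e \<in> truth (Order (f e) (k e) (x e) (x' e)))"
proof (rule definable_app5[OF _ assms])
  show "definable (\<lambda>e. e 0 \<in> truth (Order (e 1) (e 2) (e 3) (e 4)))"
    using definable_truth_itp[of "fOrder 0 1 2 3"] by (simp add: itp_fOrder eval_nat_numeral)
qed

lemma definable_realizes_Surj:
  assumes "definable_fn p" "definable_fn f" "definable_fn a" "definable_fn k"
  shows "definable (\<lambda>e. realizes (p e) (Surj (f e) (a e) (k e)))"
proof -
  have "definable (\<lambda>e. e 0 \<in> truth (Surj (e 1) (e 2) (e 3)))"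
    using definable_truth_itp[of "fSurj 0 1 2"] by (simp add: itp_fSurj eval_nat_numeral)
  then have *: "definable (\<lambda>e. e 0 \<in> truth (Surj (e 2) (e 3) (e 4)))"
    by (drule_tac definable_rename[where \<sigma> = "case_nat 0 (\<lambda>n. Suc (Suc n))"]) (simp add: eval_nat_numeral)
  show ?thesis
  proof (rule definable_app4[where P = "\<lambda>p f a k. realizes p (Surj f a k)", OF _ assms])
    show "definable (\<lambda>e. realizes (e 0) (Surj (e 1) (e 2) (e 3)))"
      unfolding realizes_def
      by (rule definable_realizes_set[OF _ definable_fn_var]) (use * in \<open>simp add: eval_nat_numeral\<close>)
  qed
qed

text \<open>For \<open>x\<close> not occurring in \<open>a i\<close> the truth value of
  \<open>NotEps x (a i)\<close> is empty, so nothing is asked there. Elsewhere the term hands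
  \<theta> to the given realizer of the negation.\<close>

lemma valid_all_eps:
  assumes "valid {(i, x). i \<in> I \<and> (\<exists>\<pi>. opair x \<pi> \<in>\<^sub>M a i)} (\<lambda>(i, x). G i x)"
  shows "valid I (\<lambda>i. all_eps (a i) (G i))"
proof -
  obtain \<theta> where \<theta>: "\<theta> \<in>\<^sub>M prooflike A"
      "\<And>i x \<pi>. i \<in> I \<Longrightarrow> opair x \<pi> \<in>\<^sub>M a i \<Longrightarrow> realizes \<theta> (G i x)"
    using assms unfolding valid_def by auto
  show ?thesis
  proof (rule validI[of "cC A \<cdot> cI A \<cdot> \<theta>"])
    show \<eta>: "cC A \<cdot> cI A \<cdot> \<theta> \<in>\<^sub>M prooflike A" using \<theta>(1) by (simp add: prooflike_app)
    fix i
    assume i: "i \<in> I"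
    have "cC A \<cdot> cI A \<cdot> \<theta> \<star> \<xi> \<triangleright> \<pi> \<in>\<^sub>M pole A"
      if "realizes \<xi> (\<^bold>\<not> G i x)" "\<pi> \<in> truth (NotEps x (a i))" for \<xi> \<pi> x
    proof -
      have "realizes (cC A \<cdot> cI A \<cdot> \<theta>) ((\<^bold>\<not> G i x) \<^bold>\<longrightarrow> Bot)"
        unfolding Neg_def
        by (rule realizes_mp[OF realizes_mp[OF realizes_C realizes_I] \<theta>(2)[OF i]])
          (use that(2) in auto)
      then show ?thesis using that unfolding realizes_Imp_iff[of "cC A \<cdot> cI A \<cdot> \<theta>"] by (simp add: elts_iff)
    qed
    then show "realizes (cC A \<cdot> cI A \<cdot> \<theta>) (all_eps (a i) (G i))"
      unfolding all_eps_def realizes_Forall_iff realizes_Imp_iff[of "cC A \<cdot> cI A \<cdot> \<theta>"]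
      using prooflike_in_terms[OF \<eta>] by blast
  qed
qed

text \<open>The witness may depend on the realizer of the hypothesis.\<close>

lemma valid_choose:
  assumes R: "\<theta> \<in>\<^sub>M prooflike A"
    and choose: "\<And>i \<xi>. i \<in> I \<Longrightarrow> realizes \<xi> (P i) \<Longrightarrow> \<exists>g. realizes \<xi> (Q i g) \<and> realizes \<theta> (R i g)"
  shows "valid I (\<lambda>i. P i \<^bold>\<longrightarrow> (\<^bold>\<exists>g. Q i g \<^bold>\<and> R i g))"
proof -
  have "valid UNIV (\<lambda>(F, G). F \<^bold>\<longrightarrow> G \<^bold>\<longrightarrow> (F \<^bold>\<and> G))"
    using valid_pair[of UNIV fst snd] by (simp add: case_prod_unfold)
  then obtain \<eta> where \<eta>: "\<eta> \<in>\<^sub>M prooflike A" "\<And>F G. realizes \<eta> (F \<^bold>\<longrightarrow> G \<^bold>\<longrightarrow> (F \<^bold>\<and> G))"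
    unfolding valid_def by auto
  \<comment> \<open>On a realizer \<xi>, this forms the pair of \<xi> and \<theta> by \<eta>, then
    introduces the existential quantifier; the witness leaves no trace in the term.\<close>
  define t where "t = cB A \<cdot> (cC A \<cdot> cI A) \<cdot> (cC A \<cdot> \<eta> \<cdot> \<theta>)"
  have t: "t \<in>\<^sub>M prooflike A" unfolding t_def using \<eta>(1) R by (simp add: prooflike_app)
  have *: "realizes t (Q i g \<^bold>\<longrightarrow> (\<^bold>\<exists>g. Q i g \<^bold>\<and> R i g))" if "realizes \<theta> (R i g)" for i g
    unfolding t_def
    by (rule realizes_mp[OF realizes_mp[OF realizes_B realizes_exI[where F = "\<lambda>g. Q i g \<^bold>\<and> R i g"]]
          realizes_mp[OF realizes_mp[OF realizes_C \<eta>(2)] that]])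
  show ?thesis
  proof (rule validI[OF t])
    fix i
    assume "i \<in> I"
    then have "t \<star> \<xi> \<triangleright> \<pi> \<in>\<^sub>M pole A" if "realizes \<xi> (P i)" "\<pi> \<in> truth (\<^bold>\<exists>g. Q i g \<^bold>\<and> R i g)" for \<xi> \<pi>
      using choose[OF _ that(1)] * that(2) unfolding realizes_Imp_iff[of t] by blast
    then show "realizes t (P i \<^bold>\<longrightarrow> (\<^bold>\<exists>g. Q i g \<^bold>\<and> R i g))"
      unfolding realizes_Imp_iff[of t] using prooflike_in_terms[OF t] by blast
  qed
qed

section \<open>Names of ordinals and the pigeonhole axiom\<close>

abbreviation ordinal_name :: "'m \<Rightarrow> 'm" where
  "ordinal_name \<equiv> hat (stacks A)"

text \<open>For \<gamma> \<in> \<beta>, transitivity of \<beta> makes the name of \<gamma> a subset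
  of the name of \<beta> in the ground model, so the required implications between atoms are
  inclusions of truth values.\<close>

lemma valid_Tame:
  assumes "\<And>i. i \<in> I \<Longrightarrow> ordinal (\<alpha> i)"
  shows "valid I (\<lambda>i. Tame (ordinal_name (\<alpha> i)))"
proof -
  have sub: "truth (NotEps y (ordinal_name \<gamma>)) \<subseteq> truth (NotEps y (ordinal_name \<beta>))"
    if "ordinal \<beta>" "\<gamma> \<in> elts \<beta>" for y \<beta> \<gamma>
    using ordinal_trans[OF that] by (auto simp: opair_mem_hat)
  let ?D = "{(i, x). i \<in> I \<and> (\<exists>\<pi>. opair x \<pi> \<in>\<^sub>M ordinal_name (\<alpha> i))}"
  have D: "\<exists>\<gamma>\<in>elts (\<alpha> i). x = ordinal_name \<gamma>" "ordinal (\<alpha> i)" if "(i, x) \<in> ?D" for i x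
    using that assms by (auto simp: opair_mem_hat)
  have "valid ?D (\<lambda>(i, x). \<^bold>\<forall>y. NotEps y (ordinal_name (\<alpha> i)) \<^bold>\<longrightarrow> NotEps y x)"
  proof (rule validI[of "cI A"])
    show "realizes (cI A) (case p of (i, x) \<Rightarrow> \<^bold>\<forall>y. NotEps y (ordinal_name (\<alpha> i)) \<^bold>\<longrightarrow> NotEps y x)"
      if "p \<in> ?D" for p
    proof (cases p)
      case (Pair i x)
      with D[of i x] that obtain \<gamma> where "\<gamma> \<in> elts (\<alpha> i)" "x = ordinal_name \<gamma>" "ordinal (\<alpha> i)" by blast
      then show ?thesis unfolding Pair realizes_Forall_iff prod.case using realizes_I[OF sub] by blast
    qed
  qed simp
  then have "valid I (\<lambda>i. all_eps (ordinal_name (\<alpha> i))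
      (\<lambda>x. \<^bold>\<forall>y. NotEps y (ordinal_name (\<alpha> i)) \<^bold>\<longrightarrow> NotEps y x))"
    by (rule valid_all_eps)
  moreover
  let ?D' = "{(p, y). p \<in> ?D \<and> (\<exists>\<pi>. opair y \<pi> \<in>\<^sub>M snd p)}"
  have "valid ?D' (\<lambda>(p, y). \<^bold>\<forall>z. NotEps z (snd p) \<^bold>\<longrightarrow> NotEps z y)"
  proof (rule validI[of "cI A"])
    show "realizes (cI A) (case q of (p, y) \<Rightarrow> \<^bold>\<forall>z. NotEps z (snd p) \<^bold>\<longrightarrow> NotEps z y)"
      if "q \<in> ?D'" for q
    proof -
      obtain i x y where q: "q = ((i, x), y)" by (metis surj_pair)
      then have "(i, x) \<in> ?D" and y: "\<exists>\<pi>. opair y \<pi> \<in>\<^sub>M x" using that by auto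
      then obtain \<gamma> where \<gamma>: "\<gamma> \<in> elts (\<alpha> i)" "x = ordinal_name \<gamma>" "ordinal (\<alpha> i)"
        using D[of i x] by blast
      then obtain \<delta> where "\<delta> \<in> elts \<gamma>" "y = ordinal_name \<delta>" using y opair_mem_hat by blast
      moreover have "ordinal \<gamma>" using ordinal_mem \<gamma>(1,3) by blast
      ultimately show ?thesis
        unfolding q realizes_Forall_iff prod.case snd_conv \<gamma>(2) using realizes_I[OF sub] by blast
    qed
  qed simp
  then have "valid ?D (\<lambda>p. all_eps (snd p) (\<lambda>y. \<^bold>\<forall>z. NotEps z (snd p) \<^bold>\<longrightarrow> NotEps z y))"
    by (rule valid_all_eps)
  then have "valid I (\<lambda>i. all_eps (ordinal_name (\<alpha> i))
      (\<lambda>x. all_eps x (\<lambda>y. \<^bold>\<forall>z. NotEps z x \<^bold>\<longrightarrow> NotEps z y)))"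
    by (intro valid_all_eps) (simp add: case_prod_unfold)
  ultimately show ?thesis unfolding Tame_def by (rule valid_conjI)
qed

text \<open>Cutting the truth values of the preorder down to a set \<open>X\<close> keeps all tables
  in the power set of \<open>X\<close>, although \<open>f\<close> ranges over a proper
  class.\<close>

definition table :: "'m \<Rightarrow> 'm \<Rightarrow> 'm \<Rightarrow> 'm" where
  "table X f k = mk {z \<in> elts X. \<exists>x x' \<pi>. z = opair (opair x x') \<pi> \<and> \<pi> \<in> truth (Order f k x x')}"

lemma elts_table:
  "elts (table X f k) = {z \<in> elts X. \<exists>x x' \<pi>. z = opair (opair x x') \<pi> \<and> \<pi> \<in> truth (Order f k x x')}"
  unfolding table_def
  by (rule elts_mk, rule small_separation) (intro definable_truth_Order definable_algebra_intros)

lemma definable_fn_table: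
  "definable_fn f \<Longrightarrow> definable_fn k \<Longrightarrow> definable_fn (\<lambda>e. table X (f e) (k e))"
proof (rule definable_fn_app2[where g = "table X"])
  have "z = table X f k \<longleftrightarrow> (\<forall>q. q \<in> elts z \<longleftrightarrow> q \<in> elts X \<and>
      (\<exists>x x' \<pi>. q = opair (opair x x') \<pi> \<and> \<pi> \<in> truth (Order f k x x')))" for z f k
  proof -
    have "z = table X f k \<longleftrightarrow> elts z = elts (table X f k)" using extensionality by blast
    then show ?thesis unfolding elts_table set_eq_iff mem_Collect_eq .
  qed
  then show "definable (\<lambda>e. e 0 = table X (e 1) (e 2))"
    by (simp only:) (intro definable_truth_Order definable_algebra_intros)
qed

text \<open>For a fixed \<open>a\<close>, the realizers of ``\<open>f\<close> maps \<open>a\<close> onto the name of \<open>\<alpha>\<close>'', together with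
  the truth values of the induced preorder of \<open>a\<close>, form a set bounded independently of the
  ordinal \<open>\<alpha>\<close>, so it is the same for two different ordinals.\<close>

lemma surjection_pigeonhole:
  "\<exists>\<alpha> \<beta>. ordinal \<alpha> \<and> ordinal \<beta> \<and> \<alpha> \<in> elts \<beta> \<and>
    (\<forall>f \<xi>. realizes \<xi> (Surj f a (ordinal_name \<alpha>)) \<longrightarrow>
      (\<exists>g. realizes \<xi> (Surj g a (ordinal_name \<beta>)) \<and>
        (\<forall>x x' \<pi> \<pi>'. opair x \<pi> \<in>\<^sub>M a \<longrightarrow> opair x' \<pi>' \<in>\<^sub>M a \<longrightarrow>
          truth (Order f (ordinal_name \<alpha>) x x') = truth (Order g (ordinal_name \<beta>) x x'))))"
proof -
  obtain T where T: "transitive T" "a \<in> elts T" using transitive_cover by blast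
  define X where "X = cartesian (cartesian T T) (stacks A)"
  \<comment> \<open>A bound for pairs of a table and a realizer in which no ordinal occurs; hence
    every \<open>G \<alpha>\<close> lies in the power set of \<open>U\<close>.\<close>
  define U where "U = cartesian (mk {y. elts y \<subseteq> elts X}) (terms A)"
  define E where "E \<alpha> z \<longleftrightarrow> (\<exists>f \<xi>. z = opair (table X f (ordinal_name \<alpha>)) \<xi> \<and>
    realizes \<xi> (Surj f a (ordinal_name \<alpha>)))" for \<alpha> z
  define G where "G \<alpha> = mk {z \<in> elts U. E \<alpha> z}" for \<alpha>
  have E: "definable (\<lambda>e. E (s e) (t e))" if "definable_fn s" "definable_fn t" for s t
  proof (rule definable_app2[where P = E, OF _ that])
    show "definable (\<lambda>e. E (e 0) (e 1))"
      unfolding E_def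
      by (intro definable_realizes_Surj definable_fn_table definable_fn_hat definable_algebra_intros)
  qed
  have elts_G: "elts (G \<alpha>) = {z \<in> elts U. E \<alpha> z}" for \<alpha>
    unfolding G_def by (rule elts_mk, rule small_separation) (intro E definable_algebra_intros)
  have "definable_fn (\<lambda>e. G (e 0))"
    unfolding G_def by (rule definable_fn_mk_separation) (intro E definable_algebra_intros)
  moreover have "G \<alpha> \<in> elts (mk {y. elts y \<subseteq> elts U})" for \<alpha>
    using elts_G small_Pow by auto
  ultimately obtain \<alpha> \<beta> where \<alpha>\<beta>: "ordinal \<alpha>" "ordinal \<beta>" "\<alpha> \<in> elts \<beta>" "G \<alpha> = G \<beta>"
    using ordinal_pigeonhole by blast
  have "\<exists>g. realizes \<xi> (Surj g a (ordinal_name \<beta>)) \<and>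
        (\<forall>x x' \<pi> \<pi>'. opair x \<pi> \<in>\<^sub>M a \<longrightarrow> opair x' \<pi>' \<in>\<^sub>M a \<longrightarrow>
          truth (Order f (ordinal_name \<alpha>) x x') = truth (Order g (ordinal_name \<beta>) x x'))"
    if \<xi>: "realizes \<xi> (Surj f a (ordinal_name \<alpha>))" for f \<xi>
  proof -
    have "table X f (ordinal_name \<alpha>) \<in> elts (mk {y. elts y \<subseteq> elts X})"
      using small_Pow elts_table by auto
    then have "opair (table X f (ordinal_name \<alpha>)) \<xi> \<in> elts (G \<alpha>)"
      unfolding elts_G E_def U_def using \<xi> realizes_terms[OF \<xi>] by (auto simp: elts_iff)
    \<comment> \<open>Membership in \<open>G \<beta>\<close> provides a \<open>g\<close> with the
      same table and with the same realizer \<xi>.\<close>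
    then have "opair (table X f (ordinal_name \<alpha>)) \<xi> \<in> elts (G \<beta>)" using \<alpha>\<beta>(4) by simp
    then obtain g where g: "table X f (ordinal_name \<alpha>) = table X g (ordinal_name \<beta>)"
        "realizes \<xi> (Surj g a (ordinal_name \<beta>))"
      unfolding elts_G E_def by auto
    have mem_table: "opair (opair x x') \<rho> \<in> elts (table X f k) \<longleftrightarrow> \<rho> \<in> truth (Order f k x x')"
      if "x \<in>\<^sub>M T" "x' \<in>\<^sub>M T" for x x' \<rho> f k
      unfolding elts_table X_def using that truth_stacks by auto
    have "x \<in>\<^sub>M T" if "opair x \<pi> \<in>\<^sub>M a" for x \<pi>
      using transitive_opair_mem[OF T that] by (simp add: elts_iff)
    then show ?thesis using g mem_table by (metis set_eqI)
  qed
  then show ?thesis using \<alpha>\<beta> by blast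
qed

definition Same_order :: "'m \<Rightarrow> 'm \<Rightarrow> 'm \<Rightarrow> 'm \<Rightarrow> 'm \<Rightarrow> 'm zfe" where
  "Same_order a f k g l = all_eps a (\<lambda>x. all_eps a (\<lambda>x'.
    (Order f k x x' \<^bold>\<longrightarrow> Order g l x x') \<^bold>\<and> (Order g l x x' \<^bold>\<longrightarrow> Order f k x x')))"

lemma itp_fPigeonhole: "itp atoms e fPigeonhole = (\<^bold>\<forall>a. \<^bold>\<exists>\<alpha>. \<^bold>\<exists>\<beta>. Tame \<alpha> \<^bold>\<and> Tame \<beta> \<^bold>\<and> \<alpha> \<^bold>\<epsilon> \<beta> \<^bold>\<and>
    (\<^bold>\<forall>f. Surj f a \<alpha> \<^bold>\<longrightarrow> (\<^bold>\<exists>g. Surj g a \<beta> \<^bold>\<and> Same_order a f \<alpha> g \<beta>)))"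
  by (simp add: fPigeonhole_def Same_order_def itp_fm itp_fTame itp_fSurj itp_fOrder eval_nat_numeral)

lemma valid_Same_order:
  assumes "\<And>i x x' \<pi> \<pi>'. i \<in> I \<Longrightarrow> opair x \<pi> \<in>\<^sub>M a i \<Longrightarrow> opair x' \<pi>' \<in>\<^sub>M a i \<Longrightarrow>
    truth (Order (f i) (k i) x x') = truth (Order (g i) (l i) x x')"
  shows "valid I (\<lambda>i. Same_order (a i) (f i) (k i) (g i) (l i))"
proof -
  let ?D = "{(p, x'). p \<in> {(i, x). i \<in> I \<and> (\<exists>\<pi>. opair x \<pi> \<in>\<^sub>M a i)} \<and> (\<exists>\<pi>. opair x' \<pi> \<in>\<^sub>M a (fst p))}"
  have eq: "truth (Order (f (fst (fst q))) (k (fst (fst q))) (snd (fst q)) (snd q)) =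
      truth (Order (g (fst (fst q))) (l (fst (fst q))) (snd (fst q)) (snd q))" if q: "q \<in> ?D" for q
  proof -
    have "fst (fst q) \<in> I" "\<exists>\<pi>. opair (snd (fst q)) \<pi> \<in>\<^sub>M a (fst (fst q))"
      "\<exists>\<pi>. opair (snd q) \<pi> \<in>\<^sub>M a (fst (fst q))" using q by auto
    then show ?thesis using assms by blast
  qed
  show ?thesis
    unfolding Same_order_def
  proof (rule valid_all_eps, unfold case_prod_unfold, rule valid_all_eps)
    have "valid ?D (\<lambda>q.
        (Order (f (fst (fst q))) (k (fst (fst q))) (snd (fst q)) (snd q) \<^bold>\<longrightarrow>
          Order (g (fst (fst q))) (l (fst (fst q))) (snd (fst q)) (snd q)) \<^bold>\<and>
        (Order (g (fst (fst q))) (l (fst (fst q))) (snd (fst q)) (snd q) \<^bold>\<longrightarrow>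
          Order (f (fst (fst q))) (k (fst (fst q))) (snd (fst q)) (snd q)))"
      by (intro valid_conjI valid_sub) (simp_all only: eq order_refl)
    then show "valid {(p, x'). p \<in> {p. fst p \<in> I \<and> (\<exists>\<pi>. opair (snd p) \<pi> \<in>\<^sub>M a (fst p))} \<and>
          (\<exists>\<pi>. opair x' \<pi> \<in>\<^sub>M a (fst p))}
        (\<lambda>(p, x'). (Order (f (fst p)) (k (fst p)) (snd p) x' \<^bold>\<longrightarrow> Order (g (fst p)) (l (fst p)) (snd p) x') \<^bold>\<and>
          (Order (g (fst p)) (l (fst p)) (snd p) x' \<^bold>\<longrightarrow> Order (f (fst p)) (k (fst p)) (snd p) x'))"
      by (simp add: case_prod_unfold)
  qed
qed

lemma valid_Pigeonhole: "valid UNIV (\<lambda>e. itp atoms e fPigeonhole)"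
proof -
  obtain \<alpha> \<beta> where ord: "\<And>a. ordinal (\<alpha> a)" "\<And>a. ordinal (\<beta> a)" "\<And>a. \<alpha> a \<in> elts (\<beta> a)"
    and g: "\<And>a f \<xi>. realizes \<xi> (Surj f a (ordinal_name (\<alpha> a))) \<Longrightarrow>
      (\<exists>g. realizes \<xi> (Surj g a (ordinal_name (\<beta> a))) \<and>
        (\<forall>x x' \<pi> \<pi>'. opair x \<pi> \<in>\<^sub>M a \<longrightarrow> opair x' \<pi>' \<in>\<^sub>M a \<longrightarrow>
          truth (Order f (ordinal_name (\<alpha> a)) x x') = truth (Order g (ordinal_name (\<beta> a)) x x')))"
    using surjection_pigeonhole by metis
  \<comment> \<open>Taking all triples with matching truth values fixes a single \<theta> before any
    \<open>g\<close> is chosen, as a uniform realizer requires.\<close>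
  define K where "K = {(a, f, g). \<forall>x x' \<pi> \<pi>'. opair x \<pi> \<in>\<^sub>M a \<longrightarrow> opair x' \<pi>' \<in>\<^sub>M a \<longrightarrow>
    truth (Order f (ordinal_name (\<alpha> a)) x x') = truth (Order g (ordinal_name (\<beta> a)) x x')}"
  have "valid K (\<lambda>i. Same_order (fst i) (fst (snd i)) (ordinal_name (\<alpha> (fst i)))
      (snd (snd i)) (ordinal_name (\<beta> (fst i))))"
    by (rule valid_Same_order) (simp add: K_def case_prod_unfold, blast)
  then obtain \<theta> where \<theta>: "\<theta> \<in>\<^sub>M prooflike A"
      and same: "\<And>a f g. (a, f, g) \<in> K \<Longrightarrow>
        realizes \<theta> (Same_order a f (ordinal_name (\<alpha> a)) g (ordinal_name (\<beta> a)))"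
    unfolding valid_def by force
  have "valid UNIV (\<lambda>a. \<^bold>\<forall>f. Surj f a (ordinal_name (\<alpha> a)) \<^bold>\<longrightarrow>
      (\<^bold>\<exists>g. Surj g a (ordinal_name (\<beta> a)) \<^bold>\<and> Same_order a f (ordinal_name (\<alpha> a)) g (ordinal_name (\<beta> a))))"
  proof (rule valid_Forall, unfold case_prod_unfold, rule valid_choose[OF \<theta>])
    fix i :: "'m \<times> 'm" and \<xi>
    assume "realizes \<xi> (Surj (snd i) (fst i) (ordinal_name (\<alpha> (fst i))))"
    from g[OF this] obtain g where "realizes \<xi> (Surj g (fst i) (ordinal_name (\<beta> (fst i))))"
      "(fst i, snd i, g) \<in> K" unfolding K_def by auto
    then show "\<exists>g. realizes \<xi> (Surj g (fst i) (ordinal_name (\<beta> (fst i)))) \<and>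
        realizes \<theta> (Same_order (fst i) (snd i) (ordinal_name (\<alpha> (fst i))) g (ordinal_name (\<beta> (fst i))))"
      using same by blast
  qed
  moreover have "valid UNIV (\<lambda>a. ordinal_name (\<alpha> a) \<^bold>\<epsilon> ordinal_name (\<beta> a))"
    unfolding Eps_def Neg_def
    by (rule valid_sub) (use ord(3) in \<open>auto simp: opair_mem_hat elts_iff\<close>)
  moreover have "valid UNIV (\<lambda>a. Tame (ordinal_name (\<alpha> a)))" "valid UNIV (\<lambda>a. Tame (ordinal_name (\<beta> a)))"
    by (rule valid_Tame, rule ord)+
  ultimately have "valid UNIV (\<lambda>a. Tame (ordinal_name (\<alpha> a)) \<^bold>\<and> Tame (ordinal_name (\<beta> a)) \<^bold>\<and>
      ordinal_name (\<alpha> a) \<^bold>\<epsilon> ordinal_name (\<beta> a) \<^bold>\<and> (\<^bold>\<forall>f. Surj f a (ordinal_name (\<alpha> a)) \<^bold>\<longrightarrow>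
      (\<^bold>\<exists>g. Surj g a (ordinal_name (\<beta> a)) \<^bold>\<and> Same_order a f (ordinal_name (\<alpha> a)) g (ordinal_name (\<beta> a)))))"
    by (intro valid_conjI)
  then have "valid UNIV (\<lambda>a. \<^bold>\<exists>\<alpha>. \<^bold>\<exists>\<beta>. Tame \<alpha> \<^bold>\<and> Tame \<beta> \<^bold>\<and> \<alpha> \<^bold>\<epsilon> \<beta> \<^bold>\<and>
    (\<^bold>\<forall>f. Surj f a \<alpha> \<^bold>\<longrightarrow> (\<^bold>\<exists>g. Surj g a \<beta> \<^bold>\<and> Same_order a f \<alpha> g \<beta>)))"
    by (intro valid_exI[where t = "\<lambda>a. ordinal_name (\<alpha> a)"] valid_exI[where t = "\<lambda>a. ordinal_name (\<beta> a)"])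
  then show ?thesis
    unfolding itp_fPigeonhole valid_def realizes_Forall_iff by blast
qed

lemma valid_extensionality:
  shows "valid UNIV (\<lambda>e. itp atoms e (Impl (Atom 1 0 (Suc 0) 0)
      (All (Impl (Atom 2 (Suc 0) 0 0) (Impl (Atom 2 0 (Suc 0) 0) (Atom 0 0 (Suc (Suc 0)) 0))))))"
    and "valid UNIV (\<lambda>e. itp atoms e (Impl
      (All (Impl (Atom 2 (Suc 0) 0 0) (Impl (Atom 2 0 (Suc 0) 0) (Atom 0 0 (Suc (Suc 0)) 0))))
      (Atom 1 0 (Suc 0) 0)))"
    and "valid UNIV (\<lambda>e. itp atoms e (Impl (Atom 2 0 (Suc 0) 0)
      (All (Impl (Atom 1 0 (Suc (Suc 0)) 0) (Atom 0 0 (Suc 0) 0)))))"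
    and "valid UNIV (\<lambda>e. itp atoms e (Impl
      (All (Impl (Atom 1 0 (Suc (Suc 0)) 0) (Atom 0 0 (Suc 0) 0))) (Atom 2 0 (Suc 0) 0)))"
  by (simp_all add: valid_sub truth_NotIn_unfold truth_Subset_unfold)

lemma valid_third_argument:
  "k < 3 \<Longrightarrow> valid UNIV (\<lambda>e. itp atoms e
    (Impl (Atom k 0 (Suc 0) (Suc (Suc 0))) (Atom k 0 (Suc 0) (Suc (Suc (Suc 0))))))"
  by (auto simp: atoms_def intro!: valid_sub)

end

section \<open>Models of the realized axioms\<close>

lemma sem_fm:
  "sem R e (fNeg F) = (\<not> sem R e F)"
  "sem R e (fAnd F G) = (sem R e F \<and> sem R e G)"
  "sem R e (fEx F) = (\<exists>x. sem R (case_nat x e) F)"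
  by (simp_all add: fNeg_def fAnd_def fEx_def)

text \<open>The facts about a structure supplied by the completeness theorem. The dummy third
  arguments in \<open>notin_iff\<close> and \<open>subset_iff\<close> are whatever index 0 denotes
  at that place, and \<open>third_argument\<close> makes them immaterial.\<close>

locale zfe_model =
  fixes R :: "nat \<Rightarrow> nat \<Rightarrow> nat \<Rightarrow> nat \<Rightarrow> bool"
  assumes third_argument: "k < 3 \<Longrightarrow> R k x y z \<Longrightarrow> R k x y z'"
    and notin_iff: "R 1 x y x \<longleftrightarrow> (\<forall>z. R 2 x z z \<longrightarrow> R 2 z x z \<longrightarrow> R 0 z y z)"
    and subset_iff: "R 2 x y x \<longleftrightarrow> (\<forall>z. R 1 z y z \<longrightarrow> R 0 z x z)"
    and induct_instance: "sem R (lookup l) (fInduct F)"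
    and leibniz_instance: "sem R (lookup l) (fLeibniz F)"
    and pigeonhole_instance: "sem R (lookup l) fPigeonhole"
begin

section \<open>Membership and extensional equality in a model\<close>

definition "eps x y \<longleftrightarrow> \<not> R 0 x y 0"
definition "mem x y \<longleftrightarrow> \<not> R 1 x y 0"
definition "sub x y \<longleftrightarrow> R 2 x y 0"
definition "sim x y \<longleftrightarrow> sub x y \<and> sub y x"
definition "graph f x y \<longleftrightarrow> \<not> R 3 x y f"
definition "val f x r \<longleftrightarrow> (\<exists>y. graph f x y \<and> sim y r)"

lemma R_iff: "R 0 x y z \<longleftrightarrow> \<not> eps x y" "R 1 x y z \<longleftrightarrow> \<not> mem x y"
  "R (Suc 0) x y z \<longleftrightarrow> \<not> mem x y" "R 2 x y z \<longleftrightarrow> sub x y" "R 3 x y z \<longleftrightarrow> \<not> graph z x y"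
  using third_argument[of 0 x y] third_argument[of 1 x y] third_argument[of 2 x y]
  by (auto simp: eps_def mem_def sub_def graph_def)

lemma sem_fm':
  "sem R e (fEps x y) = eps (e x) (e y)"
  "sem R e (fIn x y) = mem (e x) (e y)"
  "sem R e (fExtEq x y) = sim (e x) (e y)"
  "sem R e (fEq x y) = (\<forall>z. eps (e x) z \<longrightarrow> eps (e y) z)"
  "sem R e (fEqOp z x y) = (\<forall>w. eps (e z) w \<longrightarrow> graph w (e x) (e y))"
  "sem R e (fAllEps x F) = (\<forall>y. eps y (e x) \<longrightarrow> sem R (case_nat y e) F)"
  "sem R e (fExEps x F) = (\<exists>y. eps y (e x) \<and> sem R (case_nat y e) F)"
  "sem R e (fAllIn x F) = (\<forall>y. mem y (e x) \<longrightarrow> sem R (case_nat y e) F)"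
  "sem R e (fEpsOp x y f) = graph (e f) (e x) (e y)"
  "sem R e (fValue f x r) = val (e f) (e x) (e r)"
  by (auto simp: fEps_def fIn_def fExtEq_def fEq_def fEqOp_def fAllEps_def fExEps_def fAllIn_def fEpsOp_def
      fValue_def sem_fm R_iff sim_def val_def)

lemma mem_iff: "mem x y \<longleftrightarrow> (\<exists>z. eps z y \<and> sim x z)"
  using notin_iff[of x y] by (auto simp: R_iff sim_def)

lemma sub_iff: "sub x y \<longleftrightarrow> (\<forall>z. eps z x \<longrightarrow> mem z y)"
  using subset_iff[of x y] by (auto simp: R_iff)

lemma memI: "eps z y \<Longrightarrow> sim x z \<Longrightarrow> mem x y"
  unfolding mem_iff by blast

lemma simI: "(\<And>z. eps z x \<Longrightarrow> mem z y) \<Longrightarrow> (\<And>z. eps z y \<Longrightarrow> mem z x) \<Longrightarrow> sim x y"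
  unfolding sim_def sub_iff by blast

lemma simE:
  assumes "sim x y" "eps z x"
  obtains w where "eps w y" "sim z w"
proof -
  have "mem z y" using assms unfolding sim_def sub_iff[of x y] by blast
  then show thesis using that unfolding mem_iff[of z y] by blast
qed

text \<open>Induction is available only for predicates expressed by a formula with a finite list of
  parameters, so every use must supply both. The scheme speaks about negations; it is applied to
  \<open>fNeg F\<close>.\<close>

lemma eps_induct:
  assumes F: "\<And>x. sem R (case_nat x (lookup l)) F \<longleftrightarrow> P x"
    and step: "\<And>x. (\<And>y. eps y x \<Longrightarrow> P y) \<Longrightarrow> P x"
  shows "P x"
proof -
  have "sem R (lookup l) (fInduct (fNeg F)) \<longleftrightarrow>
      ((\<forall>x. (\<forall>y. \<not> P y \<longrightarrow> \<not> eps y x) \<longrightarrow> \<not> \<not> P x) \<longrightarrow> (\<forall>x. \<not> \<not> P x))"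
    unfolding fInduct_def sem.simps sem_fm sem_rename case_nat_drop
    by (simp only: F R_iff nat.case)
  with induct_instance[of l "fNeg F"]
  have "(\<forall>x. (\<forall>y. \<not> P y \<longrightarrow> \<not> eps y x) \<longrightarrow> \<not> \<not> P x) \<longrightarrow> (\<forall>x. \<not> \<not> P x)" by (rule iffD1[rotated])
  moreover have "\<not> \<not> P x" if "\<forall>y. \<not> P y \<longrightarrow> \<not> eps y x" for x
    unfolding not_not by (rule step) (use that in blast)
  ultimately show ?thesis by blast
qed

lemma sub_refl: "sub x x"
proof (rule eps_induct[where F = "Atom 2 0 0 0" and l = "[]"])
  show "sub x x" if "\<And>y. eps y x \<Longrightarrow> sub y y" for x
    using that memI unfolding sub_iff[of x] sim_def by blast
qed (simp add: R_iff)

lemma sim_refl [simp]: "sim x x"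
  by (simp add: sim_def sub_refl)

lemma sim_sym: "sim x y \<Longrightarrow> sim y x"
  by (simp add: sim_def)

lemma sim_trans: "sim x y \<Longrightarrow> sim y z \<Longrightarrow> sim x z"
proof -
  have "\<forall>y z. sim x y \<longrightarrow> sim y z \<longrightarrow> sim x z"
  proof (rule eps_induct[where l = "[]" and F = "All (All (Impl (fExtEq (Suc (Suc 0)) (Suc 0))
      (Impl (fExtEq (Suc 0) 0) (fExtEq (Suc (Suc 0)) 0))))"])
    fix x
    assume IH: "\<And>u. eps u x \<Longrightarrow> \<forall>v w. sim u v \<longrightarrow> sim v w \<longrightarrow> sim u w"
    show "\<forall>y z. sim x y \<longrightarrow> sim y z \<longrightarrow> sim x z"
    proof (intro allI impI)
      fix y z
      assume xy: "sim x y" and yz: "sim y z"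
      show "sim x z"
      proof (rule simI)
        fix u
        assume u: "eps u x"
        obtain v where v: "eps v y" "sim u v" using simE[OF xy u] .
        obtain w where w: "eps w z" "sim v w" using simE[OF yz v(1)] .
        show "mem u z" using w(1) by (rule memI) (use IH[OF u] v(2) w(2) in blast)
      next
        fix w
        assume w: "eps w z"
        obtain v where v: "eps v y" "sim w v" using simE[OF sim_sym[OF yz] w] .
        obtain u where u: "eps u x" "sim v u" using simE[OF sim_sym[OF xy] v(1)] .
        show "mem w x" using u(1)
          by (rule memI) (use IH[OF u(1)] sim_sym[OF u(2)] sim_sym[OF v(2)] sim_sym in blast)
      qed
    qed
  qed (simp add: sem_fm')
  then show "sim x y \<Longrightarrow> sim y z \<Longrightarrow> sim x z" by blast
qed

lemma eps_mem: "eps x y \<Longrightarrow> mem x y"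
  by (rule memI[OF _ sim_refl])

lemma mem_sim_left: "sim x x' \<Longrightarrow> mem x y \<Longrightarrow> mem x' y"
  unfolding mem_iff[of _ y] using sim_sym sim_trans by blast

lemma mem_sim_right:
  assumes "sim y y'" "mem x y"
  shows "mem x y'"
proof -
  obtain z where z: "eps z y" "sim x z" using assms(2) unfolding mem_iff[of x y] by blast
  obtain z' where z': "eps z' y'" "sim z z'" using simE[OF assms(1) z(1)] .
  show ?thesis by (rule memI[OF z'(1) sim_trans[OF z(2) z'(2)]])
qed

text \<open>From x \<in> x one gets a strong element \<open>z\<close> of \<open>x\<close> with x
  \<simeq> z; then z \<in> z, against the induction hypothesis.\<close>

lemma mem_irrefl: "\<not> mem x x"
proof (rule eps_induct[where F = "fNeg (fIn 0 0)" and l = "[]"])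
  show "\<not> mem x x" if IH: "\<And>y. eps y x \<Longrightarrow> \<not> mem y y" for x
  proof
    assume x: "mem x x"
    then obtain z where z: "eps z x" "sim x z" unfolding mem_iff[of x x] by blast
    then have "mem z z" using x mem_sim_left mem_sim_right by blast
    then show False using IH z by blast
  qed
qed (simp add: sem_fm sem_fm')

section \<open>Ordinals, surjections and induced preorders in a model\<close>

definition tame :: "nat \<Rightarrow> bool" where
  "tame a \<longleftrightarrow> (\<forall>x. eps x a \<longrightarrow> (\<forall>y. \<not> eps y a \<longrightarrow> \<not> eps y x)) \<and>
     (\<forall>x. eps x a \<longrightarrow> (\<forall>y. eps y x \<longrightarrow> (\<forall>z. \<not> eps z x \<longrightarrow> \<not> eps z y)))"

lemma sem_fTame: "sem R e (fTame a) = tame (e a)"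
  by (simp only: fTame_def tame_def sem_fm sem_fm' sem.simps R_iff nat.case)

definition trans :: "nat \<Rightarrow> bool" where
  "trans x \<longleftrightarrow> (\<forall>y z. mem y x \<longrightarrow> mem z y \<longrightarrow> mem z x)"

definition ordinal :: "nat \<Rightarrow> bool" where
  "ordinal x \<longleftrightarrow> trans x \<and> (\<forall>y. mem y x \<longrightarrow> trans y)"

lemma sem_fTrans: "sem R e (fTrans x) = trans (e x)"
  by (auto simp: fTrans_def trans_def sem_fm sem_fm')

lemma sem_fOrd: "sem R e (fOrd x) = ordinal (e x)"
  by (simp add: fOrd_def ordinal_def sem_fm sem_fm' sem_fTrans)

lemma trans_eps: "(\<And>y z. eps y x \<Longrightarrow> eps z y \<Longrightarrow> eps z x) \<Longrightarrow> trans x"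
  unfolding trans_def mem_iff[of _ x]
proof (intro allI impI)
  fix y z
  assume eps: "\<And>y z. eps y x \<Longrightarrow> eps z y \<Longrightarrow> eps z x"
    and "\<exists>y'. eps y' x \<and> sim y y'" and z: "mem z y"
  then obtain y' where y': "eps y' x" "sim y y'" by blast
  then have "mem z y'" using z mem_sim_right by blast
  then obtain z' where "eps z' y'" "sim z z'" unfolding mem_iff[of z y'] by blast
  then show "\<exists>z'. eps z' x \<and> sim z z'" using eps y' by blast
qed

lemma trans_sim:
  assumes "sim x x'" "trans x"
  shows "trans x'"
  using assms(2) mem_sim_right[OF assms(1)] mem_sim_right[OF sim_sym[OF assms(1)]]
  unfolding trans_def by blast

lemma tame_ordinal:
  assumes "tame a"
  shows "ordinal a"
  unfolding ordinal_def
proof (intro conjI allI impI)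
  show "trans a" by (rule trans_eps) (use assms in \<open>unfold tame_def, blast\<close>)
  fix y
  assume "mem y a"
  then obtain y' where y': "eps y' a" "sim y y'" unfolding mem_iff[of y a] by blast
  have "trans y'" by (rule trans_eps) (use assms y'(1) in \<open>unfold tame_def, blast\<close>)
  then show "trans y" by (rule trans_sim[OF sim_sym[OF y'(2)]])
qed

definition functional :: "nat \<Rightarrow> bool" where
  "functional f \<longleftrightarrow> (\<forall>x r r'. val f x r \<longrightarrow> val f x r' \<longrightarrow> sim r r')"

definition onto :: "nat \<Rightarrow> nat \<Rightarrow> nat \<Rightarrow> bool" where
  "onto f a k \<longleftrightarrow> (\<forall>r. mem r k \<longrightarrow> (\<exists>x. eps x a \<and> val f x r))"

lemma val_sim: "val f x r \<Longrightarrow> sim r r' \<Longrightarrow> val f x r'"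
  unfolding val_def using sim_trans by blast

lemma sim_if_equal:
  assumes "\<forall>z. eps y z \<longrightarrow> eps y' z"
  shows "sim y y'"
  \<comment> \<open>The transported property is being \<simeq> to y', which y' itself has by
    reflexivity.\<close>
  using leibniz_instance[of "[y, y', y']" "fExtEq 0 (Suc 0)"] assms
  by (simp add: fLeibniz_def sem_fm' lookup_Cons)

definition surj :: "nat \<Rightarrow> nat \<Rightarrow> nat \<Rightarrow> bool" where
  "surj f a k \<longleftrightarrow> sem R (case_nat f (case_nat a (\<lambda>_. k))) (fSurj 0 (Suc 0) (Suc (Suc 0)))"

lemma sem_fSurj: "sem R e (fSurj f a k) = surj (e f) (e a) (e k)"
  by (simp add: surj_def fSurj_def fFunction_def sem_fm sem_fm')

lemma surj_iff:
  "surj f a k \<longleftrightarrow> ((\<forall>z. eps z f \<longrightarrow> (\<exists>x. eps x a \<and> (\<exists>y. \<forall>w. eps z w \<longrightarrow> graph w x y))) \<and>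
      (\<forall>x. eps x a \<longrightarrow> (\<exists>y. graph f x y)) \<and>
      (\<forall>x y y'. graph f x y \<longrightarrow> graph f x y' \<longrightarrow> (\<forall>z. eps y z \<longrightarrow> eps y' z))) \<and> onto f a k"
  by (simp only: surj_def fSurj_def fFunction_def onto_def sem_fm sem_fm' sem.simps nat.case)

lemma surjD:
  assumes "surj f a k"
  shows "functional f" "onto f a k"
proof -
  have graph: "sim y y'" if "graph f x y" "graph f x y'" for x y y'
  proof -
    have "\<forall>x y y'. graph f x y \<longrightarrow> graph f x y' \<longrightarrow> (\<forall>z. eps y z \<longrightarrow> eps y' z)"
      using assms unfolding surj_iff by (elim conjE)
    then have "\<forall>z. eps y z \<longrightarrow> eps y' z" using that by blast
    then show ?thesis by (rule sim_if_equal)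
  qed
  show "functional f"
    unfolding functional_def val_def using graph sim_sym sim_trans by meson
  show "onto f a k"
    using assms unfolding surj_iff by (elim conjE)
qed

definition precedes :: "nat \<Rightarrow> nat \<Rightarrow> nat \<Rightarrow> nat \<Rightarrow> bool" where
  "precedes f k x x' \<longleftrightarrow> (\<exists>u u'. val f x u \<and> val f x' u' \<and> mem u' k \<and> (mem u u' \<or> sim u u'))"

lemma sem_fOrder: "sem R e (fOrder f k x x') = precedes (e f) (e k) (e x) (e x')"
  by (auto simp: fOrder_def precedes_def sem_fm sem_fm')

lemma precedes_iff:
  assumes "functional f" "val f x u" "val f x' u'"
  shows "precedes f k x x' \<longleftrightarrow> mem u' k \<and> (mem u u' \<or> sim u u')"
proof
  assume "precedes f k x x'"
  then obtain v v' where v: "val f x v" "val f x' v'" "mem v' k" "mem v v' \<or> sim v v'"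
    unfolding precedes_def by blast
  have u: "sim v u" "sim v' u'" using assms v unfolding functional_def by blast+
  have "mem u' k" using mem_sim_left[OF u(2) v(3)] .
  moreover have "mem u u' \<or> sim u u'"
    using v(4) mem_sim_left[OF u(1)] mem_sim_right[OF u(2)] sim_trans[OF _ u(2)] sim_sym[OF u(1)]
      sim_trans[of u v v'] by blast
  ultimately show "mem u' k \<and> (mem u u' \<or> sim u u')" ..
qed (use assms in \<open>unfold precedes_def, blast\<close>)

lemma ordinal_memD:
  assumes "ordinal k" "mem u k" "mem w u"
  shows "mem w k" "\<not> (mem u w \<or> sim u w)"
proof -
  show "mem w k" using assms unfolding ordinal_def trans_def by blast
  have "\<not> mem u w" using assms mem_irrefl[of u] unfolding ordinal_def trans_def by blast
  moreover have "\<not> sim u w" using assms(3) mem_sim_right[of u w w] mem_irrefl by blast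
  ultimately show "\<not> (mem u w \<or> sim u w)" by blast
qed

text \<open>A value u = f(x) in \<open>k\<close> has as members exactly the values of the points
  strictly below \<open>x\<close>, as \<open>f\<close> is onto the ordinal \<open>k\<close>. So the
  preorder determines the values, as in a Mostowski collapse, and induction on \<open>u\<close>
  shows that \<open>g\<close> takes the same ones.\<close>

lemma equal_order_imp_sim:
  assumes f: "functional f" "onto f a k" "ordinal k" and g: "functional g" "onto g a l" "ordinal l"
    and order: "\<And>x x'. eps x a \<Longrightarrow> eps x' a \<Longrightarrow> precedes f k x x' \<longleftrightarrow> precedes g l x x'"
  shows "sim k l"
proof -
  \<comment> \<open>The diagonal of the preorder tells which points have a value in the target, so
    these are the same points for \<open>f\<close> and \<open>g\<close>.\<close>
  have dom: "\<exists>v. val g x v \<and> mem v l" if "eps x a" "val f x u" "mem u k" for x u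
  proof -
    have "precedes f k x x" using that precedes_iff[OF f(1)] by auto
    then show ?thesis using order[OF that(1) that(1)] unfolding precedes_def by blast
  qed
  have dom': "\<exists>u. val f x u \<and> mem u k" if "eps x a" "val g x v" "mem v l" for x v
  proof -
    have "precedes g l x x" using that precedes_iff[OF g(1)] by auto
    then show ?thesis using order[OF that(1) that(1)] unfolding precedes_def by blast
  qed
  have agree: "\<forall>x. eps x a \<longrightarrow> val f x u \<longrightarrow> mem u k \<longrightarrow> val g x u" for u
  \<comment> \<open>Under the quantifier of \<open>F\<close>, the indices 0 to 5 stand for x, u, a,
    f, g, k.\<close>
  proof (rule eps_induct[where P = "\<lambda>u. \<forall>x. eps x a \<longrightarrow> val f x u \<longrightarrow> mem u k \<longrightarrow> val g x u"
        and l = "[a, f, g, k]" and F = "All (Impl (fEps 0 (Suc (Suc 0)))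
      (Impl (fValue (Suc (Suc (Suc 0))) 0 (Suc 0)) (Impl (fIn (Suc 0) (Suc (Suc (Suc (Suc (Suc 0))))))
        (fValue (Suc (Suc (Suc (Suc 0)))) 0 (Suc 0)))))"])
    fix u
    assume IH: "\<And>w. eps w u \<Longrightarrow> \<forall>x. eps x a \<longrightarrow> val f x w \<longrightarrow> mem w k \<longrightarrow> val g x w"
    show "\<forall>x. eps x a \<longrightarrow> val f x u \<longrightarrow> mem u k \<longrightarrow> val g x u"
    proof (intro allI impI)
      fix x
      assume x: "eps x a" and fx: "val f x u" and u: "mem u k"
      obtain v where gx: "val g x v" and v: "mem v l" using dom[OF x fx u] by blast
      have "sim u v"
      proof (rule simI)
        fix w
        assume w: "eps w u"
        note wk = ordinal_memD[OF f(3) u eps_mem[OF w]]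
        obtain x' where x': "eps x' a" and fx': "val f x' w" using f(2) wk(1) unfolding onto_def by blast
        have gx': "val g x' w" using IH[OF w] x' fx' wk(1) by blast
        have "precedes f k x' x" "\<not> precedes f k x x'"
          using precedes_iff[OF f(1) fx' fx, of k] precedes_iff[OF f(1) fx fx', of k] u wk eps_mem[OF w]
          by blast+
        then have "precedes g l x' x" "\<not> precedes g l x x'" using order x x' by blast+
        then have "mem w v \<or> sim w v" "\<not> (mem w l \<and> sim v w)"
          using precedes_iff[OF g(1) gx' gx, of l] precedes_iff[OF g(1) gx gx', of l] by blast+
        moreover have "mem w l" if "sim w v" using mem_sim_left[OF sim_sym[OF that] v] .
        ultimately show "mem w v" using sim_sym by blast
      next
        fix w
        assume w: "eps w v"
        note wl = ordinal_memD[OF g(3) v eps_mem[OF w]]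
        obtain x' where x': "eps x' a" and gx': "val g x' w" using g(2) wl(1) unfolding onto_def by blast
        obtain t where fx': "val f x' t" and t: "mem t k" using dom'[OF x' gx' wl(1)] by blast
        have "precedes g l x' x" "\<not> precedes g l x x'"
          using precedes_iff[OF g(1) gx' gx, of l] precedes_iff[OF g(1) gx gx', of l] v wl eps_mem[OF w]
          by blast+
        then have "precedes f k x' x" "\<not> precedes f k x x'" using order x x' by blast+
        then have "mem t u \<or> sim t u" "\<not> sim u t"
          using precedes_iff[OF f(1) fx' fx, of k] precedes_iff[OF f(1) fx fx', of k] t by blast+
        then have "mem t u" using sim_sym by blast
        \<comment> \<open>The induction hypothesis covers only strong elements of \<open>u\<close>,
          so \<open>t\<close> is exchanged for an equivalent one.\<close>
        then obtain t' where t': "eps t' u" "sim t t'" unfolding mem_iff[of t u] by blast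
        have "val g x' t'"
          using IH[OF t'(1)] x' val_sim[OF fx' t'(2)] mem_sim_left[OF t'(2) t] by blast
        then have "sim t' w" using gx' g(1) unfolding functional_def by blast
        then show "mem w u" using t'(1) memI sim_sym by blast
      qed
      then show "val g x u" using val_sim[OF gx] sim_sym by blast
    qed
  qed (simp add: sem_fm' lookup_Cons)
  show ?thesis
  proof (rule simI)
    fix r
    assume "eps r k"
    then have r: "mem r k" by (rule eps_mem)
    then obtain x where x: "eps x a" "val f x r" using f(2) unfolding onto_def by blast
    then obtain v where v: "val g x v" "mem v l" using dom r by blast
    have "sim v r" using v(1) agree x r g(1) unfolding functional_def by blast
    then show "mem r l" using v(2) by (rule mem_sim_left)
  next
    fix r
    assume "eps r l"
    then have r: "mem r l" by (rule eps_mem)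
    then obtain x where x: "eps x a" "val g x r" using g(2) unfolding onto_def by blast
    then obtain u where u: "val f x u" "mem u k" using dom' r by blast
    have "sim u r" using x u agree g(1) unfolding functional_def by blast
    then show "mem r k" using u(2) by (rule mem_sim_left)
  qed
qed

lemma no_surjection:
  "sem R (\<lambda>_. 0) (All (fEx (fAnd (fOrd 0) (fNeg (fEx (fSurj 0 (Suc (Suc 0)) (Suc 0)))))))"
proof -
  have "\<exists>k. ordinal k \<and> (\<forall>f. \<not> surj f a k)" for a
  proof -
    have "\<exists>k l. tame k \<and> tame l \<and> eps k l \<and> (\<forall>f. surj f a k \<longrightarrow> (\<exists>g. surj g a l \<and>
        (\<forall>x. eps x a \<longrightarrow> (\<forall>x'. eps x' a \<longrightarrow>
          (precedes f k x x' \<longrightarrow> precedes g l x x') \<and> (precedes g l x x' \<longrightarrow> precedes f k x x')))))"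
      using pigeonhole_instance[of "[]"]
      by (simp add: fPigeonhole_def sem_fm sem_fm' sem_fTame sem_fSurj sem_fOrder eval_nat_numeral)
    then obtain k l where kl: "tame k" "tame l" "eps k l"
      and choose: "\<And>f. surj f a k \<Longrightarrow> \<exists>g. surj g a l \<and> (\<forall>x. eps x a \<longrightarrow> (\<forall>x'. eps x' a \<longrightarrow>
        (precedes f k x x' \<longrightarrow> precedes g l x x') \<and> (precedes g l x x' \<longrightarrow> precedes f k x x')))"
      by blast
    have "\<not> surj f a k" for f
    proof
      assume f: "surj f a k"
      obtain g where g: "surj g a l" and order: "\<And>x x'. eps x a \<Longrightarrow> eps x' a \<Longrightarrow>
          precedes f k x x' \<longleftrightarrow> precedes g l x x'" using choose[OF f] by blast
      have "sim k l"
        by (rule equal_order_imp_sim[OF surjD[OF f] tame_ordinal[OF kl(1)]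
              surjD[OF g] tame_ordinal[OF kl(2)] order])
      then have "mem l l" using eps_mem[OF kl(3)] mem_sim_left by blast
      then show False using mem_irrefl by blast
    qed
    then show ?thesis using tame_ordinal[OF kl(1)] by blast
  qed
  then show ?thesis by (simp add: sem_fm sem_fOrd sem_fSurj)
qed

end

theorem theorem19:
  fixes mem :: "'m \<Rightarrow> 'm \<Rightarrow> bool" and A :: "'m algebra"
  assumes "realizability_algebra mem A"
  defines "opr \<equiv> algebra_structure.op mem A"
  shows "algebra_structure.holds mem A
    (\<^bold>\<forall>a. \<^bold>\<exists>\<kappa>. Ord \<kappa> \<^bold>\<and>
       \<^bold>\<not> (\<^bold>\<exists>f. function_on opr f a \<^bold>\<and>
            all_in \<kappa> (\<lambda>\<rho>. ex_eps a (\<lambda>x. value_sim opr f x \<rho>))))"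
proof -
  interpret realizability_algebra mem A by (rule assms(1))
  \<comment> \<open>The claim in de Bruijn form: below all binders \<open>f\<close>, \<kappa> and
    \<open>a\<close> have the indices 0, 1, 2. It is closed, so constant environments
    suffice.\<close>
  let ?\<phi> = "All (fEx (fAnd (fOrd 0) (fNeg (fEx (fSurj 0 (Suc (Suc 0)) (Suc 0))))))"
  have "valid UNIV (\<lambda>x. itp atoms (\<lambda>_. x) ?\<phi>)"
  proof (rule completeness)
    fix R :: "nat \<Rightarrow> nat \<Rightarrow> nat \<Rightarrow> nat \<Rightarrow> bool"
    assume R: "\<And>\<psi> l. valid UNIV (\<lambda>e. itp atoms e \<psi>) \<Longrightarrow> sem R (lookup l) \<psi>"
    have "zfe_model R"
    proof
      show "R k x y z'" if "k < 3" "R k x y z" for k x y z z'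
        using R[OF valid_third_argument[OF that(1)], of "[x, y, z, z']"] that(2)
        by (simp add: lookup_Cons)
      show "R 1 x y x \<longleftrightarrow> (\<forall>z. R 2 x z z \<longrightarrow> R 2 z x z \<longrightarrow> R 0 z y z)" for x y
        using R[OF valid_extensionality(1), of "[x, y]"] R[OF valid_extensionality(2), of "[x, y]"]
        unfolding sem.simps lookup_Cons nat.case by blast
      show "R 2 x y x \<longleftrightarrow> (\<forall>z. R 1 z y z \<longrightarrow> R 0 z x z)" for x y
        using R[OF valid_extensionality(3), of "[x, y]"] R[OF valid_extensionality(4), of "[x, y]"]
        unfolding sem.simps lookup_Cons nat.case by blast
      show "sem R (lookup l) (fInduct F)" for l F by (rule R[OF valid_induct])
      show "sem R (lookup l) (fLeibniz F)" for l F by (rule R[OF valid_Leibniz])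
      show "sem R (lookup l) fPigeonhole" for l by (rule R[OF valid_Pigeonhole])
    qed
    then show "sem R (\<lambda>_. 0) ?\<phi>" by (rule zfe_model.no_surjection)
  qed
  then show ?thesis
    unfolding holds_def valid_def opr_def
    by (auto simp: itp_fm itp_fOrd itp_fSurj Surj_def)
qed

end
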